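(* Let $M\in\mathbb N$, let $D\subset\mathbb R^d$ be a bounded Lipschitz domain, $f\in L^2(D)$, and let $a_0,\dots,a_M\in L^\infty(D)$ satisfy, for some $r>0$, $\sum_{m=1}^M|a_m(x)|\le a_0(x)-r$ for almost every $x\in D$. Let $a(x,\mathbf y)=a_0(x)+\sum_{m=1}^M a_m(x)y_m$ for $\mathbf y\in\boldsymbol\Gamma=[-1,1]^M$, and let $u\in C(\boldsymbol\Gamma;H_0^1(D))$ be the parametric weak solution of $-\nabla\cdot(a(\mathbf y)\nabla u(\mathbf y))=f$ in $D$, $u(\mathbf y)=0$ on $\partial D$. Fix $p\in[1,\infty]$. Let $\Delta_k$, $k\in\mathbb N_0$, be the univariate detail operators built from a nested family of interpolation node sets in $[-1,1]$ as described in the context, and assume that there are finite constants $0\le c,\theta<\infty$ with $$\|\Delta_k\|_\infty\le(1+ck)^\theta\qquad\forall k\in\mathbb N_0 .$$ Let $(u_n)_{n\in\mathbb N_0}$ be any sequence of approximations generated by the adaptive sparse collocation algorithm described in the context (run with this $p$). Then $$\lim_{n\to\infty}\|u-u_n\|_{L^p_\mu(\boldsymbol\Gamma;H_0^1(D))}=0 .$$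
   Context: **Parameter domain.** $\Gamma=[-1,1]$, $\boldsymbol\Gamma=\Gamma^M$, $\mu=\bigotimes_{m=1}^M\frac{dy_m}{2}$ is the uniform probability measure on $\boldsymbol\Gamma$, $\mathcal F=\mathbb N_0^M$, and $\mathbf e_m$ is the $m$th unit multi-index. For a Hilbert space $\mathcal H$, $L^p_\mu(\boldsymbol\Gamma;\mathcal H)$ is the Bochner space. $\|\nabla v\|_{L^2(D)}$ is used as norm on $H_0^1(D)$; for vector fields such as $a\nabla u_n$, $L^2(D)$ means $L^2(D)^d$. **Nodes.** $(y_{(i)})_{i\in\mathbb N_0}\subset[-1,1]$ is a sequence of distinct nodes, $\mathfrak m:\mathbb N_0\to\mathbb N_0$ is a strictly increasing function with $\mathfrak m(0)=0$, and $\mathcal Y_k=\{y_{(i)}: i=0,\dots,\mathfrak m(k)\}$ (nested sets, $|\mathcal Y_k|=1+\mathfrak m(k)$). **Detail operators.** $\mathcal I_k$ maps a continuous function on $\Gamma$ (real or Hilbert-space valued) to its unique Lagrange interpolant of degree at most $\mathfrak m(k)$ on $\mathcal Y_k$. $\Delta_0=\mathcal I_0$, $\Delta_k=\mathcal I_k-\mathcal I_{k-1}$ for $k\ge1$, and $\|\Delta_k\|_\infty=\sup_{0\ne g\in C(\Gamma;\mathbb R)}\|\Delta_kg\|_{C(\Gamma;\mathbb R)}/\|g\|_{C(\Gamma;\mathbb R)}$. For $\mathbf i\in\mathcal F$, $\Delta_{\mathbf i}=\bigotimes_{m=1}^M\Delta_{i_m}$ ($\Delta_{i_m}$ acting in the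 variable $y_m$). For finite $\Lambda\subset\mathcal F$, $S_\Lambda=\sum_{\mathbf i\in\Lambda}\Delta_{\mathbf i}$. **Index sets.** $\Lambda\subset\mathcal F$ is monotone (downward closed) if $\mathbf i\in\Lambda$ and $i_m\ge1$ imply $\mathbf i-\mathbf e_m\in\Lambda$. The margin is $\mathrm{Marg}(\Lambda)=\{\mathbf k\in\mathcal F\setminus\Lambda:\ \mathbf k-\mathbf e_m\in\Lambda\text{ for some }m\in\{1,\dots,M\}\}$. For $\mathbf k\in\mathrm{Marg}(\Lambda)$ the monotone envelope is $E_\Lambda(\mathbf k)=\bigcap\{E\subset\mathrm{Marg}(\Lambda):\ \mathbf k\in E,\ \Lambda\cup E\text{ monotone}\}$. **Algorithm.** $\Lambda_0=\{\mathbf 0\}$, $u_0=S_{\Lambda_0}u$. For $n=0,1,2,\dots$: compute $\eta_n(\mathbf k)=\|\Delta_{\mathbf k}(a\nabla u_n)\|_{L^p_\mu(\boldsymbol\Gamma;L^2(D))}$ for all $\mathbf k\in\mathrm{Marg}(\Lambda_n)$; choose $\mathbf k_n^*\in\arg\max_{\mathbf k\in\mathrm{Marg}(\Lambda_n)}\eta_n(\mathbf k)$ (any maximizer); set $\Lambda_{n+1}=\Lambda_n\cup E_{\Lambda_n}(\mathbf k_n^* )$ and $u_{n+1}=S_{\Lambda_{n+1}}u$. *)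

theory Defs
  imports "HOL-Probability.Probability" "HOL-Computational_Algebra.Polynomial"
begin

section \<open>Lebesgue and Bochner norms\<close>

definition epowr :: "ennreal \<Rightarrow> real \<Rightarrow> ennreal" where
  "epowr x r = (if x = \<infinity> then \<infinity> else ennreal (enn2real x powr r))"

text \<open>The norms below take values in the extended nonnegative reals, so that an infinite norm is
  never confused with a finite one. The argument \<open>h\<close> is the pointwise norm of the function
  whose \<open>L\<^sup>p\<close> norm is taken; the intended range of the exponent is \<open>1 \<le> p \<le> \<infinity>\<close>.\<close>

definition Lp_norm :: "ennreal \<Rightarrow> 'a measure \<Rightarrow> ('a \<Rightarrow> ennreal) \<Rightarrow> ennreal" where
  "Lp_norm p N h =
     (if p = \<infinity> then esssup N h
      else epowr (\<integral>\<^sup>+ x. epowr (h x) (enn2real p) \<partial>N) (1 / enn2real p))"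

definition Lp_on :: "ennreal \<Rightarrow> (real^'d) set \<Rightarrow> (real^'d \<Rightarrow> 'b::real_normed_vector) set" where
  "Lp_on p D = {v \<in> borel_measurable (lebesgue_on D).
     Lp_norm p (lebesgue_on D) (\<lambda>x. ennreal (norm (v x))) < \<infinity>}"

definition L2_norm_on :: "(real^'d) set \<Rightarrow> (real^'d \<Rightarrow> 'b::real_normed_vector) \<Rightarrow> ennreal" where
  "L2_norm_on D v = Lp_norm 2 (lebesgue_on D) (\<lambda>x. ennreal (norm (v x)))"

section \<open>Bounded Lipschitz domains\<close>

text \<open>Near every boundary point the domain is, after a rotation taking the last coordinate direction
  to \<open>e\<close>, the part of a neighbourhood lying strictly above the graph of a Lipschitz function
  of the coordinates orthogonal to \<open>e\<close>.\<close>

definition bounded_Lipschitz_domain :: "(real^'d) set \<Rightarrow> bool" where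
  "bounded_Lipschitz_domain D \<longleftrightarrow>
     open D \<and> connected D \<and> D \<noteq> {} \<and> bounded D \<and>
     (\<forall>x0 \<in> frontier D. \<exists>e \<phi> L U.
        norm e = 1 \<and> L-lipschitz_on {z. z \<bullet> e = 0} \<phi> \<and> open U \<and> x0 \<in> U \<and>
        D \<inter> U = {x \<in> U. \<phi> (x - (x \<bullet> e) *\<^sub>R e) < x \<bullet> e})"

section \<open>Sobolev spaces\<close>

definition partial :: "'d \<Rightarrow> (real^'d \<Rightarrow> real) \<Rightarrow> real^'d \<Rightarrow> real" where
  "partial i \<phi> x = frechet_derivative \<phi> (at x) (axis i 1)"

primrec C_k :: "nat \<Rightarrow> (real^'d \<Rightarrow> real) \<Rightarrow> bool" where
  "C_k 0 \<phi> \<longleftrightarrow> continuous_on UNIV \<phi>"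
| "C_k (Suc k) \<phi> \<longleftrightarrow> (\<forall>x. \<phi> differentiable (at x)) \<and> (\<forall>i. C_k k (partial i \<phi>))"

definition test_function :: "(real^'d) set \<Rightarrow> (real^'d \<Rightarrow> real) \<Rightarrow> bool" where
  "test_function D \<phi> \<longleftrightarrow>
     (\<forall>k. C_k k \<phi>) \<and> compact (closure {x. \<phi> x \<noteq> 0}) \<and> closure {x. \<phi> x \<noteq> 0} \<subseteq> D"

definition has_weak_gradient ::
    "(real^'d) set \<Rightarrow> (real^'d \<Rightarrow> real) \<Rightarrow> (real^'d \<Rightarrow> real^'d) \<Rightarrow> bool" where
  "has_weak_gradient D v g \<longleftrightarrow>
     (\<forall>\<phi> i. test_function D \<phi> \<longrightarrow>
        (LINT x|lebesgue_on D. v x * partial i \<phi> x) = - (LINT x|lebesgue_on D. g x $ i * \<phi> x))"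

text \<open>Elements of \<open>L\<^sup>2(D)\<close> and of the Sobolev spaces are represented by functions; all the
  notions below are invariant under changes on null sets of \<open>D\<close>.\<close>

definition H1 :: "(real^'d) set \<Rightarrow> (real^'d \<Rightarrow> real) set" where
  "H1 D = {v \<in> Lp_on 2 D. \<exists>g \<in> Lp_on 2 D. has_weak_gradient D v g}"

text \<open>A representative of the weak gradient, which is unique up to null sets of \<open>D\<close>.\<close>

definition wgrad :: "(real^'d) set \<Rightarrow> (real^'d \<Rightarrow> real) \<Rightarrow> real^'d \<Rightarrow> real^'d" where
  "wgrad D v = (SOME g. g \<in> Lp_on 2 D \<and> has_weak_gradient D v g)"

definition H1_norm :: "(real^'d) set \<Rightarrow> (real^'d \<Rightarrow> real) \<Rightarrow> ennreal" where
  "H1_norm D v = epowr ((L2_norm_on D v)\<^sup>2 + (L2_norm_on D (wgrad D v))\<^sup>2) (1/2)"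

definition H01 :: "(real^'d) set \<Rightarrow> (real^'d \<Rightarrow> real) set" where
  "H01 D = {v \<in> H1 D. \<exists>\<phi>. (\<forall>n::nat. test_function D (\<phi> n)) \<and>
     (\<lambda>n. H1_norm D (\<lambda>x. v x - \<phi> n x)) \<longlonglongrightarrow> 0}"

definition H01_norm :: "(real^'d) set \<Rightarrow> (real^'d \<Rightarrow> real) \<Rightarrow> ennreal" where
  "H01_norm D v = L2_norm_on D (wgrad D v)"

section \<open>The parameter domain\<close>

text \<open>Parameter vectors are functions on \<open>nat\<close> that are only relevant (and extensional)
  on the index set \<open>{1..M}\<close>.\<close>

definition Gam :: "nat \<Rightarrow> (nat \<Rightarrow> real) set" where
  "Gam M = (\<Pi>\<^sub>E m\<in>{1..M}. {-1..1})"

definition mu :: "nat \<Rightarrow> (nat \<Rightarrow> real) measure" where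
  "mu M = (\<Pi>\<^sub>M m\<in>{1..M}. uniform_measure (restrict_space lborel {-1..1}) {-1..1})"

text \<open>The norms of \<open>L\<^sup>p\<^sub>\<mu>(\<Gamma>; L\<^sup>2(D))\<close> and \<open>L\<^sup>p\<^sub>\<mu>(\<Gamma>; H\<^sup>1\<^sub>0(D))\<close>.\<close>

definition Bochner_L2_norm ::
    "ennreal \<Rightarrow> nat \<Rightarrow> (real^'d) set \<Rightarrow> ((nat \<Rightarrow> real) \<Rightarrow> real^'d \<Rightarrow> 'b::real_normed_vector) \<Rightarrow> ennreal" where
  "Bochner_L2_norm p M D v = Lp_norm p (mu M) (\<lambda>y. L2_norm_on D (v y))"

definition Bochner_H01_norm ::
    "ennreal \<Rightarrow> nat \<Rightarrow> (real^'d) set \<Rightarrow> ((nat \<Rightarrow> real) \<Rightarrow> real^'d \<Rightarrow> real) \<Rightarrow> ennreal" where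
  "Bochner_H01_norm p M D v = Lp_norm p (mu M) (\<lambda>y. H01_norm D (v y))"

definition continuous_H01 ::
    "nat \<Rightarrow> (real^'d) set \<Rightarrow> ((nat \<Rightarrow> real) \<Rightarrow> real^'d \<Rightarrow> real) \<Rightarrow> bool" where
  "continuous_H01 M D u \<longleftrightarrow>
     (\<forall>y \<in> Gam M. u y \<in> H01 D) \<and>
     (\<forall>y0 \<in> Gam M. ((\<lambda>y. H01_norm D (\<lambda>x. u y x - u y0 x)) \<longlongrightarrow> 0) (at y0 within Gam M))"

section \<open>The parametric diffusion problem\<close>

definition affine_coeff :: "nat \<Rightarrow> (nat \<Rightarrow> real^'d \<Rightarrow> real) \<Rightarrow> real^'d \<Rightarrow> (nat \<Rightarrow> real) \<Rightarrow> real" where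
  "affine_coeff M a x y = a 0 x + (\<Sum>m=1..M. a m x * y m)"

definition weak_solution ::
    "(real^'d) set \<Rightarrow> (real^'d \<Rightarrow> real) \<Rightarrow> (real^'d \<Rightarrow> real) \<Rightarrow> (real^'d \<Rightarrow> real) \<Rightarrow> bool" where
  "weak_solution D \<alpha> f w \<longleftrightarrow>
     w \<in> H01 D \<and>
     (\<forall>v \<in> H01 D. (LINT x|lebesgue_on D. \<alpha> x * (wgrad D w x \<bullet> wgrad D v x))
                 = (LINT x|lebesgue_on D. f x * v x))"

section \<open>Interpolation and detail operators\<close>

text \<open>The node sequence is \<open>z\<close>; the operator \<open>lagrange_interp z N\<close> uses the nodes
  \<open>z 0, \<dots>, z N\<close>. Values may lie in any real vector space.\<close>

definition lagrange_basis :: "(nat \<Rightarrow> real) \<Rightarrow> nat \<Rightarrow> nat \<Rightarrow> real poly" where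
  "lagrange_basis z N i = (\<Prod>j\<in>{..N} - {i}. smult (1 / (z i - z j)) [:- z j, 1:])"

definition lagrange_interp ::
    "(nat \<Rightarrow> real) \<Rightarrow> nat \<Rightarrow> (real \<Rightarrow> 'b::real_vector) \<Rightarrow> real \<Rightarrow> 'b" where
  "lagrange_interp z N g t = (\<Sum>i\<le>N. poly (lagrange_basis z N i) t *\<^sub>R g (z i))"

text \<open>The next three facts confirm that, for distinct nodes, this is the unique polynomial
  interpolant of degree at most \<open>N\<close>.\<close>

lemma degree_lagrange_basis: "degree (lagrange_basis z N i) \<le> N" if "i \<le> N"
proof -
  have "degree (lagrange_basis z N i) \<le> (\<Sum>j\<in>{..N} - {i}. 1)"
    unfolding lagrange_basis_def
    by (rule order.trans[OF degree_prod_sum_le sum_mono]) (auto intro: degree_smult_le[THEN order.trans])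
  also have "\<dots> = N"
    using that by simp
  finally show ?thesis .
qed

lemma lagrange_interp_node:
  assumes "inj z" "k \<le> N"
  shows "lagrange_interp z N g (z k) = g (z k)"
proof -
  have "poly (lagrange_basis z N i) (z k) = (if i = k then 1 else 0)" if "i \<le> N" for i
  proof (cases "i = k")
    case True
    have "1 / (z k - z j) * (z k - z j) = 1" if "j \<noteq> k" for j
      using assms(1) that by (simp add: inj_eq)
    thus ?thesis
      using True by (auto simp: lagrange_basis_def poly_prod right_diff_distrib intro!: prod.neutral)
  next
    case False
    thus ?thesis
      using assms(2) by (auto simp: lagrange_basis_def poly_prod intro!: bexI[of _ k])
  qed
  hence "lagrange_interp z N g (z k) = (\<Sum>i\<le>N. (if i = k then 1 else 0) *\<^sub>R g (z i))"
    unfolding lagrange_interp_def by (intro sum.cong) auto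
  also have "\<dots> = (\<Sum>i\<le>N. if i = k then g (z i) else 0)"
    by (intro sum.cong) auto
  finally show ?thesis
    using assms(2) by simp
qed

lemma lagrange_interp_poly:
  assumes "inj z" "degree q \<le> N"
  shows "lagrange_interp z N (poly q) = poly q"
proof -
  define r where "r = (\<Sum>i\<le>N. smult (poly q (z i)) (lagrange_basis z N i))"
  have r: "lagrange_interp z N (poly q) t = poly r t" for t
    by (simp add: r_def lagrange_interp_def poly_sum mult.commute)
  have "degree r \<le> N"
    unfolding r_def
    by (intro degree_sum_le) (auto simp: degree_lagrange_basis intro: order.trans[OF degree_smult_le])
  moreover have "card (z ` {..N}) = Suc N"
    using assms(1) by (simp add: card_image inj_on_def inj_def)
  moreover have "poly r x = poly q x" if "x \<in> z ` {..N}" for x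
    using that r lagrange_interp_node[OF assms(1), of _ N "poly q"] by (metis atMost_iff imageE)
  ultimately have "r = q"
    using assms(2) by (intro poly_eqI_degree[of "z ` {..N}"]) auto
  thus ?thesis
    using r by auto
qed

text \<open>In the following, \<open>z\<close> is the node sequence and \<open>mm k + 1\<close> is the number of
  nodes of level \<open>k\<close>.\<close>

definition detail ::
    "(nat \<Rightarrow> real) \<Rightarrow> (nat \<Rightarrow> nat) \<Rightarrow> nat \<Rightarrow> (real \<Rightarrow> 'b::real_vector) \<Rightarrow> real \<Rightarrow> 'b" where
  "detail z mm k g t =
     (if k = 0 then lagrange_interp z (mm 0) g t
      else lagrange_interp z (mm k) g t - lagrange_interp z (mm (k - 1)) g t)"

definition unif_norm :: "(real \<Rightarrow> real) \<Rightarrow> real" where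
  "unif_norm g = (SUP t\<in>{-1..1}. \<bar>g t\<bar>)"

definition detail_op_norm :: "(nat \<Rightarrow> real) \<Rightarrow> (nat \<Rightarrow> nat) \<Rightarrow> nat \<Rightarrow> ereal" where
  "detail_op_norm z mm k =
     (SUP g \<in> {g. continuous_on {-1..1} g \<and> (\<exists>t\<in>{-1..1}. g t \<noteq> 0)}.
        ereal (unif_norm (detail z mm k g) / unif_norm g))"

definition detail_dir ::
    "(nat \<Rightarrow> real) \<Rightarrow> (nat \<Rightarrow> nat) \<Rightarrow> nat \<Rightarrow> nat \<Rightarrow> ((nat \<Rightarrow> real) \<Rightarrow> 'b::real_vector) \<Rightarrow> (nat \<Rightarrow> real) \<Rightarrow> 'b" where
  "detail_dir z mm m k g y = detail z mm k (\<lambda>t. g (y(m := t))) (y m)"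

text \<open>The tensor product operator: the composition over \<open>m = 1, \<dots>, M\<close> of the commuting
  univariate operators acting in the variable \<open>y m\<close>.\<close>

definition tensor_detail ::
    "(nat \<Rightarrow> real) \<Rightarrow> (nat \<Rightarrow> nat) \<Rightarrow> nat \<Rightarrow> (nat \<Rightarrow> nat) \<Rightarrow> ((nat \<Rightarrow> real) \<Rightarrow> 'b::real_vector) \<Rightarrow> (nat \<Rightarrow> real) \<Rightarrow> 'b" where
  "tensor_detail z mm M i g = foldr (\<lambda>m h. detail_dir z mm m (i m) h) [1..<Suc M] g"

text \<open>For functions with values in a space of functions of \<open>x\<close>, the operators only form finite
  linear combinations of point values in \<open>y\<close>, so they may be applied for each \<open>x\<close>
  separately.\<close>

definition tensor_detail_fun ::
    "(nat \<Rightarrow> real) \<Rightarrow> (nat \<Rightarrow> nat) \<Rightarrow> nat \<Rightarrow> (nat \<Rightarrow> nat) \<Rightarrow> ((nat \<Rightarrow> real) \<Rightarrow> 'x \<Rightarrow> 'b::real_vector) \<Rightarrow> (nat \<Rightarrow> real) \<Rightarrow> 'x \<Rightarrow> 'b" where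
  "tensor_detail_fun z mm M i v y x = tensor_detail z mm M i (\<lambda>y'. v y' x) y"

definition sparse_op ::
    "(nat \<Rightarrow> real) \<Rightarrow> (nat \<Rightarrow> nat) \<Rightarrow> nat \<Rightarrow> (nat \<Rightarrow> nat) set \<Rightarrow> ((nat \<Rightarrow> real) \<Rightarrow> 'x \<Rightarrow> 'b::real_vector) \<Rightarrow> (nat \<Rightarrow> real) \<Rightarrow> 'x \<Rightarrow> 'b" where
  "sparse_op z mm M \<Lambda> v y x = (\<Sum>i\<in>\<Lambda>. tensor_detail_fun z mm M i v y x)"

section \<open>Index sets\<close>

text \<open>Multi-indices in \<open>M\<close> variables vanish outside \<open>{1..M}\<close>.\<close>

definition multi_indices :: "nat \<Rightarrow> (nat \<Rightarrow> nat) set" where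
  "multi_indices M = {i. \<forall>m. m \<notin> {1..M} \<longrightarrow> i m = 0}"

definition monotone_set :: "nat \<Rightarrow> (nat \<Rightarrow> nat) set \<Rightarrow> bool" where
  "monotone_set M \<Lambda> \<longleftrightarrow>
     \<Lambda> \<subseteq> multi_indices M \<and> (\<forall>i\<in>\<Lambda>. \<forall>m\<in>{1..M}. 1 \<le> i m \<longrightarrow> i(m := i m - 1) \<in> \<Lambda>)"

definition Marg :: "nat \<Rightarrow> (nat \<Rightarrow> nat) set \<Rightarrow> (nat \<Rightarrow> nat) set" where
  "Marg M \<Lambda> = {k \<in> multi_indices M - \<Lambda>. \<exists>m\<in>{1..M}. 1 \<le> k m \<and> k(m := k m - 1) \<in> \<Lambda>}"

definition envelope :: "nat \<Rightarrow> (nat \<Rightarrow> nat) set \<Rightarrow> (nat \<Rightarrow> nat) \<Rightarrow> (nat \<Rightarrow> nat) set" where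
  "envelope M \<Lambda> k = \<Inter>{E. E \<subseteq> Marg M \<Lambda> \<and> k \<in> E \<and> monotone_set M (\<Lambda> \<union> E)}"

section \<open>The adaptive algorithm\<close>

definition estimator ::
    "(nat \<Rightarrow> real) \<Rightarrow> (nat \<Rightarrow> nat) \<Rightarrow> nat \<Rightarrow> ennreal \<Rightarrow> (real^'d) set \<Rightarrow> (nat \<Rightarrow> real^'d \<Rightarrow> real)
      \<Rightarrow> ((nat \<Rightarrow> real) \<Rightarrow> real^'d \<Rightarrow> real) \<Rightarrow> (nat \<Rightarrow> nat) \<Rightarrow> ennreal" where
  "estimator z mm M p D a w k =
     Bochner_L2_norm p M D
       (tensor_detail_fun z mm M k (\<lambda>y x. affine_coeff M a x y *\<^sub>R wgrad D (w y) x))"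

text \<open>The sequence \<open>un\<close> is a possible output of the algorithm; the maximisers \<open>ks n\<close>
  are arbitrary.\<close>

definition adaptive_collocation ::
    "(nat \<Rightarrow> real) \<Rightarrow> (nat \<Rightarrow> nat) \<Rightarrow> nat \<Rightarrow> ennreal \<Rightarrow> (real^'d) set \<Rightarrow> (nat \<Rightarrow> real^'d \<Rightarrow> real)
      \<Rightarrow> ((nat \<Rightarrow> real) \<Rightarrow> real^'d \<Rightarrow> real) \<Rightarrow> (nat \<Rightarrow> (nat \<Rightarrow> real) \<Rightarrow> real^'d \<Rightarrow> real) \<Rightarrow> bool" where
  "adaptive_collocation z mm M p D a u un \<longleftrightarrow>
     (\<exists>\<Lambda> ks.
        \<Lambda> 0 = {\<lambda>_. 0} \<and>
        (\<forall>n. un n = sparse_op z mm M (\<Lambda> n) u) \<and>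
        (\<forall>n. ks n \<in> Marg M (\<Lambda> n) \<and>
             (\<forall>k \<in> Marg M (\<Lambda> n). estimator z mm M p D a (un n) k \<le> estimator z mm M p D a (un n) (ks n))) \<and>
        (\<forall>n. \<Lambda> (Suc n) = \<Lambda> n \<union> envelope M (\<Lambda> n) (ks n)))"

end

theory Submission
  imports Defs
begin

text \<open>
  Let \<open>U(y)\<close> be the gradient of \<open>u(y)\<close> and \<open>S\<^sub>\<Lambda>\<close> the sparse interpolation operator. Since the univariate
  detail operators are mutually orthogonal projections and multiplication by \<open>y\<^sub>m\<close> raises a level by at
  most one, \<open>a S\<^sub>\<Lambda>U\<close> differs from a field with the same weak divergence as \<open>a U\<close> only by the
  contributions \<open>\<Delta>\<^sub>k(a S\<^sub>\<Lambda>U)\<close> with \<open>k\<close> in the margin of \<open>\<Lambda>\<close>. By coercivity the error is therefore at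
  most \<open>1/r\<close> times the sum of the norms of these contributions, and each of them only involves
  \<open>\<Delta>\<^sub>iU\<close> for the predecessors \<open>i = k - e\<^sub>m\<close> of \<open>k\<close> in \<open>\<Lambda>\<close>. Hence it is bounded by a \<open>majorant\<close>
  that does not depend on \<open>\<Lambda>\<close>. The majorant is summable because \<open>\<Delta>\<^sub>iU\<close> decays geometrically: in each
  direction \<open>U\<close> is approximated by Newton interpolation at nodes clustered near \<open>0\<close>, whose
  divided differences solve the elliptic problem recursively and contract in the energy norm.

  Given \<open>\<epsilon>\<close>, fix a finite set \<open>F\<close> outside of which the majorant sums to at most \<open>\<epsilon>\<close>. The marked indices
  are pairwise distinct, so the maximal estimator, being bounded by the majorant of the
  marked index, tends to zero; this controls the finitely many contributions from \<open>F\<close>.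
\<close>

section \<open>Square integrable functions\<close>

text \<open>The margins grow with \<open>n\<close>, so smallness of each single contribution is not
  enough: a bound is needed that does not see the index set. This is why the contribution of a
  margin index is expressed through details of the exact gradient.

  Their decay rests on polynomial approximation in one variable. With interpolation nodes anywhere
  in [-1,1] the Newton factors |t - \<tau>_i| may reach 2, and divided differences contract only by
  \<rho>/(1 - \<rho>) per step, where \<rho> < 1 bounds the variation of the coefficient in that
  direction relative to its value at 0. Nodes within \<epsilon> of 0 improve the two factors to 1 +
  \<epsilon> and \<rho>/(1 - \<epsilon> \<rho>), whose product is below 1 for small \<epsilon>.
  These nodes are chosen for the approximation, independently of the collocation nodes.

  Each direction yields decay in its own level alone. The geometric mean of the M bounds decays in
  all levels at once, as summability over multi-indices requires, and the algebraic growth of the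
  operator norms cannot spoil it.\<close>

definition L2 :: "'a measure \<Rightarrow> ('a \<Rightarrow> 'b::euclidean_space) set" where
  "L2 N = {v \<in> borel_measurable N. integrable N (\<lambda>x. (norm (v x))\<^sup>2)}"

definition l2norm :: "'a measure \<Rightarrow> ('a \<Rightarrow> 'b::euclidean_space) \<Rightarrow> real" where
  "l2norm N v = sqrt (LINT x|N. (norm (v x))\<^sup>2)"

lemma L2_measurable [measurable_dest]: "v \<in> L2 N \<Longrightarrow> v \<in> borel_measurable N"
  by (simp add: L2_def)

lemma L2_dominated:
  assumes "v \<in> borel_measurable N" "integrable N g" "AE x in N. (norm (v x))\<^sup>2 \<le> g x"
  shows "v \<in> L2 N"
  unfolding L2_def
  using assms by (auto intro!: Bochner_Integration.integrable_bound[OF assms(2)] elim!: AE_mp)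

lemma L2_zero [simp]: "(\<lambda>x. 0) \<in> L2 N"
  by (simp add: L2_def)

lemma L2_add [intro]:
  assumes "v \<in> L2 N" "w \<in> L2 N"
  shows "(\<lambda>x. v x + w x) \<in> L2 N"
proof (rule L2_dominated)
  show "(\<lambda>x. v x + w x) \<in> borel_measurable N"
    using assms by (auto simp: L2_def)
  show "integrable N (\<lambda>x. 2 * (norm (v x))\<^sup>2 + 2 * (norm (w x))\<^sup>2)"
    using assms by (auto simp: L2_def)
  have "(norm (a + b))\<^sup>2 \<le> 2 * (norm a)\<^sup>2 + 2 * (norm b)\<^sup>2" for a b :: 'b
  proof -
    have "(norm (a + b))\<^sup>2 \<le> (norm a + norm b)\<^sup>2"
      by (intro power_mono norm_triangle_ineq) auto
    also have "\<dots> \<le> 2 * (norm a)\<^sup>2 + 2 * (norm b)\<^sup>2"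
      using zero_le_power2[of "norm a - norm b"] by (simp add: power2_eq_square algebra_simps)
    finally show ?thesis .
  qed
  thus "AE x in N. (norm (v x + w x))\<^sup>2 \<le> 2 * (norm (v x))\<^sup>2 + 2 * (norm (w x))\<^sup>2"
    by simp
qed

lemma L2_bounded_mult:
  assumes [measurable]: "h \<in> borel_measurable N" and "AE x in N. \<bar>h x\<bar> \<le> B" and v: "v \<in> L2 N"
  shows "(\<lambda>x. h x *\<^sub>R v x) \<in> L2 N"
proof (rule L2_dominated)
  note [measurable] = L2_measurable[OF v]
  show "(\<lambda>x. h x *\<^sub>R v x) \<in> borel_measurable N"
    by measurable
  show "integrable N (\<lambda>x. B\<^sup>2 * (norm (v x))\<^sup>2)"
    using v by (auto simp: L2_def)
  show "AE x in N. (norm (h x *\<^sub>R v x))\<^sup>2 \<le> B\<^sup>2 * (norm (v x))\<^sup>2"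
    using assms(2)
  proof eventually_elim
    case (elim x)
    have "\<bar>h x\<bar>\<^sup>2 \<le> B\<^sup>2"
      using elim by (intro power_mono) auto
    thus ?case
      by (auto simp: power_mult_distrib intro: mult_right_mono)
  qed
qed

lemma L2_scaleR [intro]:
  "v \<in> L2 N \<Longrightarrow> (\<lambda>x. c *\<^sub>R v x) \<in> L2 N"
  by (rule L2_bounded_mult[where B = "\<bar>c\<bar>"]) auto

lemma L2_sum:
  "(\<And>i. i \<in> I \<Longrightarrow> v i \<in> L2 N) \<Longrightarrow> (\<lambda>x. \<Sum>i\<in>I. v i x) \<in> L2 N"
  by (induction I rule: infinite_finite_induct) auto

lemma L2_diff [intro]:
  assumes "v \<in> L2 N" "w \<in> L2 N"
  shows "(\<lambda>x. v x - w x) \<in> L2 N"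
  using L2_add[OF assms(1) L2_scaleR[OF assms(2), of "-1"]] by simp

lemma l2norm_nonneg [simp]: "0 \<le> l2norm N v"
  by (simp add: l2norm_def)

lemma l2norm_power2: "(l2norm N v)\<^sup>2 = (LINT x|N. (norm (v x))\<^sup>2)"
  by (simp add: l2norm_def)

lemma l2norm_zero [simp]: "l2norm N (\<lambda>x. 0) = 0"
  by (simp add: l2norm_def)

lemma l2norm_cong_AE:
  assumes "v \<in> borel_measurable N" "w \<in> borel_measurable N" "AE x in N. v x = w x"
  shows "l2norm N v = l2norm N w"
  unfolding l2norm_def using assms by (auto intro!: arg_cong[where f = sqrt] integral_cong_AE)

lemma integrable_inner_L2:
  assumes v: "v \<in> L2 N" and w: "w \<in> L2 N"
  shows "integrable N (\<lambda>x. v x \<bullet> w x)"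
proof (rule Bochner_Integration.integrable_bound)
  note [measurable] = L2_measurable[OF v] L2_measurable[OF w]
  show "integrable N (\<lambda>x. (norm (v x))\<^sup>2 + (norm (w x))\<^sup>2)"
    using v w by (auto simp: L2_def)
  show "(\<lambda>x. v x \<bullet> w x) \<in> borel_measurable N"
    by measurable
  have "\<bar>a \<bullet> b\<bar> \<le> (norm a)\<^sup>2 + (norm b)\<^sup>2" for a b :: 'b
    using Cauchy_Schwarz_ineq2[of a b] zero_le_power2[of "norm a - norm b"]
      zero_le_power2[of "norm a + norm b"]
    by (simp add: power2_eq_square algebra_simps)
  thus "AE x in N. norm (v x \<bullet> w x) \<le> norm ((norm (v x))\<^sup>2 + (norm (w x))\<^sup>2)"
    by (auto simp: abs_of_nonneg)
qed

text \<open>Letting s approach the minimiser b / a gives the claim; adding d > 0 to both numbers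
  keeps the choice admissible when one of them vanishes.\<close>

lemma product_bound_from_Young:
  fixes x a b :: real
  assumes "0 \<le> a" "0 \<le> b" and Y: "\<And>s. 0 < s \<Longrightarrow> 2 * x \<le> s * a\<^sup>2 + b\<^sup>2 / s"
  shows "x \<le> a * b"
proof (rule field_le_epsilon)
  fix e :: real assume "0 < e"
  \<comment> \<open>The shift costs d (a + b) / 2 in the final bound, which this size keeps below
    e.\<close>
  define d where "d = 2 * e / (a + b + 1)"
  have d: "0 < d" "d * (a + b) \<le> 2 * e"
    using assms \<open>0 < e\<close> by (auto simp: d_def field_simps)
  define s where "s = (b + d) / (a + d)"
  have s: "0 < s"
    using assms d by (auto simp: s_def intro!: divide_pos_pos)
  have "s * a\<^sup>2 \<le> (b + d) * a"
  proof -
    have "s * a\<^sup>2 = (b + d) * (a * (a / (a + d)))"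
      by (simp add: s_def power2_eq_square)
    also have "\<dots> \<le> (b + d) * (a * 1)"
      using assms d by (intro mult_left_mono) (auto simp: field_simps)
    finally show ?thesis by simp
  qed
  moreover have "b\<^sup>2 / s \<le> b * (a + d)"
  proof -
    have "b\<^sup>2 / s = (a + d) * (b * (b / (b + d)))"
      by (simp add: s_def power2_eq_square)
    also have "\<dots> \<le> (a + d) * (b * 1)"
      using assms d by (intro mult_left_mono) (auto simp: field_simps)
    finally show ?thesis by (simp add: mult.commute)
  qed
  ultimately have "2 * x \<le> (b + d) * a + b * (a + d)"
    using Y[OF s] by linarith
  thus "x \<le> a * b + e"
    using d(2) by (simp add: algebra_simps)
qed

lemma inner_Young:
  fixes a b :: "'b::real_inner"
  assumes "0 < s"
  shows "2 * \<bar>a \<bullet> b\<bar> \<le> s * (norm a)\<^sup>2 + (norm b)\<^sup>2 / s"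
proof -
  have "0 \<le> (s * norm a - norm b)\<^sup>2 / s"
    using assms by simp
  also have "\<dots> = s * (norm a)\<^sup>2 + (norm b)\<^sup>2 / s - 2 * (norm a * norm b)"
    using assms by (simp add: power2_eq_square field_simps)
  finally show ?thesis
    using Cauchy_Schwarz_ineq2[of a b] by linarith
qed

lemma l2norm_Cauchy_Schwarz:
  assumes v: "v \<in> L2 N" and w: "w \<in> L2 N"
  shows "\<bar>LINT x|N. v x \<bullet> w x\<bar> \<le> l2norm N v * l2norm N w"
proof (rule product_bound_from_Young)
  fix s :: real assume s: "0 < s"
  have i: "integrable N (\<lambda>x. (norm (v x))\<^sup>2)" "integrable N (\<lambda>x. (norm (w x))\<^sup>2)"
    using v w by (auto simp: L2_def)
  have "2 * \<bar>LINT x|N. v x \<bullet> w x\<bar> \<le> 2 * (LINT x|N. \<bar>v x \<bullet> w x\<bar>)"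
    by (simp add: integral_abs_bound)
  also have "\<dots> = (LINT x|N. 2 * \<bar>v x \<bullet> w x\<bar>)"
    by simp
  also have "\<dots> \<le> (LINT x|N. s * (norm (v x))\<^sup>2 + (norm (w x))\<^sup>2 / s)"
    using i s integrable_inner_L2[OF v w] by (intro integral_mono inner_Young) auto
  also have "\<dots> = s * (l2norm N v)\<^sup>2 + (l2norm N w)\<^sup>2 / s"
    using i by (simp add: l2norm_power2)
  finally show "2 * \<bar>LINT x|N. v x \<bullet> w x\<bar> \<le> s * (l2norm N v)\<^sup>2 + (l2norm N w)\<^sup>2 / s" .
qed auto

lemma l2norm_triangle:
  assumes v: "v \<in> L2 N" and w: "w \<in> L2 N"
  shows "l2norm N (\<lambda>x. v x + w x) \<le> l2norm N v + l2norm N w"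
proof (rule power2_le_imp_le)
  have i: "integrable N (\<lambda>x. (norm (v x))\<^sup>2)" "integrable N (\<lambda>x. (norm (w x))\<^sup>2)"
    using v w by (auto simp: L2_def)
  have "(l2norm N (\<lambda>x. v x + w x))\<^sup>2 = (LINT x|N. (norm (v x))\<^sup>2 + (norm (w x))\<^sup>2 + 2 * (v x \<bullet> w x))"
    by (simp add: l2norm_power2 power2_norm_eq_inner inner_add algebra_simps inner_commute)
  also have "\<dots> = (l2norm N v)\<^sup>2 + (l2norm N w)\<^sup>2 + 2 * (LINT x|N. v x \<bullet> w x)"
    using i integrable_inner_L2[OF v w] by (simp add: l2norm_power2)
  also have "\<dots> \<le> (l2norm N v + l2norm N w)\<^sup>2"
    using l2norm_Cauchy_Schwarz[OF v w] by (simp add: power2_sum)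
  finally show "(l2norm N (\<lambda>x. v x + w x))\<^sup>2 \<le> (l2norm N v + l2norm N w)\<^sup>2" .
qed simp

lemma l2norm_bounded_mult:
  assumes [measurable]: "h \<in> borel_measurable N" and "AE x in N. \<bar>h x\<bar> \<le> B" and "0 \<le> B"
    and v: "v \<in> L2 N"
  shows "l2norm N (\<lambda>x. h x *\<^sub>R v x) \<le> B * l2norm N v"
proof -
  have "(LINT x|N. (norm (h x *\<^sub>R v x))\<^sup>2) \<le> (LINT x|N. B\<^sup>2 * (norm (v x))\<^sup>2)"
  proof (rule integral_mono_AE)
    show "integrable N (\<lambda>x. (norm (h x *\<^sub>R v x))\<^sup>2)"
      using L2_bounded_mult[OF assms(1,2) v] by (simp add: L2_def)
    show "integrable N (\<lambda>x. B\<^sup>2 * (norm (v x))\<^sup>2)"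
      using v by (auto simp: L2_def)
    show "AE x in N. (norm (h x *\<^sub>R v x))\<^sup>2 \<le> B\<^sup>2 * (norm (v x))\<^sup>2"
      using assms(2)
    proof eventually_elim
      case (elim x)
      have "\<bar>h x\<bar>\<^sup>2 \<le> B\<^sup>2"
        using elim by (intro power_mono) auto
      thus ?case
        by (auto simp: power_mult_distrib intro: mult_right_mono)
    qed
  qed
  hence "l2norm N (\<lambda>x. h x *\<^sub>R v x) \<le> sqrt (B\<^sup>2 * (LINT x|N. (norm (v x))\<^sup>2))"
    unfolding l2norm_def by simp
  also have "\<dots> = B * l2norm N v"
    using \<open>0 \<le> B\<close> by (simp add: l2norm_def real_sqrt_mult)
  finally show ?thesis .
qed

lemma l2norm_scaleR: "l2norm N (\<lambda>x. c *\<^sub>R v x) = \<bar>c\<bar> * l2norm N v"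
  by (simp add: l2norm_def power_mult_distrib real_sqrt_mult)

lemma l2norm_sum:
  assumes "\<And>i. i \<in> I \<Longrightarrow> v i \<in> L2 N"
  shows "l2norm N (\<lambda>x. \<Sum>i\<in>I. v i x) \<le> (\<Sum>i\<in>I. l2norm N (v i))"
  using assms
proof (induction I rule: infinite_finite_induct)
  case (insert i I)
  have "l2norm N (\<lambda>x. v i x + (\<Sum>j\<in>I. v j x)) \<le> l2norm N (v i) + l2norm N (\<lambda>x. \<Sum>j\<in>I. v j x)"
    using insert by (intro l2norm_triangle L2_sum) auto
  thus ?case
    using insert by force
qed auto

lemma l2norm_lincomb:
  assumes "\<And>i. i \<in> I \<Longrightarrow> v i \<in> L2 N"
  shows "l2norm N (\<lambda>x. \<Sum>i\<in>I. c i *\<^sub>R v i x) \<le> (\<Sum>i\<in>I. \<bar>c i\<bar> * l2norm N (v i))"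
  using l2norm_sum[of I "\<lambda>i x. c i *\<^sub>R v i x" N] assms by (auto simp: l2norm_scaleR)

lemma l2norm_triangle_diff:
  assumes "v \<in> L2 N" "w \<in> L2 N"
  shows "l2norm N v \<le> l2norm N w + l2norm N (\<lambda>x. v x - w x)"
  using l2norm_triangle[OF assms(2) L2_diff[OF assms]] by simp

section \<open>Comparison with the extended-valued norms\<close>

lemma epowr_ennreal: "0 \<le> t \<Longrightarrow> epowr (ennreal t) q = ennreal (t powr q)"
  by (simp add: epowr_def)

lemma Lp_norm_2_L2:
  fixes v :: "'a \<Rightarrow> 'b::euclidean_space"
  assumes v: "v \<in> L2 N"
  shows "Lp_norm 2 N (\<lambda>x. ennreal (norm (v x))) = ennreal (l2norm N v)"
proof -
  have "(\<integral>\<^sup>+ x. epowr (ennreal (norm (v x))) 2 \<partial>N) = (\<integral>\<^sup>+ x. ennreal ((norm (v x))\<^sup>2) \<partial>N)"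
    by (simp add: epowr_ennreal powr_numeral)
  also have "\<dots> = ennreal (LINT x|N. (norm (v x))\<^sup>2)"
    using v by (intro nn_integral_eq_integral) (auto simp: L2_def)
  finally show ?thesis
    by (simp add: Lp_norm_def epowr_ennreal l2norm_def powr_half_sqrt)
qed

text \<open>Finiteness of the extended norm amounts to integrability of the square. The Hilbert
  space argument can therefore use the real-valued norm, with extended norms only at the
  interface.\<close>

lemma Lp_on_2_eq: "Lp_on 2 D = (L2 (lebesgue_on D) :: (real^'d \<Rightarrow> 'b::euclidean_space) set)"
proof (intro set_eqI iffI)
  fix v :: "real^'d \<Rightarrow> 'b" assume "v \<in> L2 (lebesgue_on D)"
  thus "v \<in> Lp_on 2 D"
    using Lp_norm_2_L2[of v] by (auto simp: Lp_on_def L2_def)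
next
  fix v :: "real^'d \<Rightarrow> 'b" assume v: "v \<in> Lp_on 2 D"
  hence [measurable]: "v \<in> borel_measurable (lebesgue_on D)"
    by (simp add: Lp_on_def)
  have "epowr (\<integral>\<^sup>+ x. epowr (ennreal (norm (v x))) 2 \<partial>lebesgue_on D) (1 / 2) < \<infinity>"
    using v by (auto simp: Lp_on_def Lp_norm_def)
  hence "(\<integral>\<^sup>+ x. epowr (ennreal (norm (v x))) 2 \<partial>lebesgue_on D) < \<infinity>"
    by (auto simp: epowr_def top.not_eq_extremum split: if_splits)
  moreover have "(\<integral>\<^sup>+ x. epowr (ennreal (norm (v x))) 2 \<partial>lebesgue_on D)
      = (\<integral>\<^sup>+ x. ennreal ((norm (v x))\<^sup>2) \<partial>lebesgue_on D)"
    by (simp add: epowr_ennreal powr_numeral)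
  ultimately have "integrable (lebesgue_on D) (\<lambda>x. (norm (v x))\<^sup>2)"
    by (intro integrableI_nonneg) auto
  thus "v \<in> L2 (lebesgue_on D)"
    by (simp add: L2_def)
qed

lemma L2_norm_on_eq:
  "v \<in> L2 (lebesgue_on D) \<Longrightarrow> L2_norm_on D v = ennreal (l2norm (lebesgue_on D) v)"
  for v :: "real^'d \<Rightarrow> 'b::euclidean_space"
  unfolding L2_norm_on_def by (rule Lp_norm_2_L2)

lemma Lp_on_infty_bound:
  assumes "h \<in> Lp_on \<infinity> D"
  obtains B where "0 \<le> B" "AE x in lebesgue_on D. norm (h x) \<le> B"
proof -
  define E where "E = esssup (lebesgue_on D) (\<lambda>x. ennreal (norm (h x)))"
  have "E < \<infinity>"
    using assms by (auto simp: Lp_on_def Lp_norm_def E_def)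
  then obtain B where B: "0 \<le> B" "E = ennreal B"
    by (cases E) auto
  have "AE x in lebesgue_on D. ennreal (norm (h x)) \<le> E"
    unfolding E_def by (rule esssup_AE)
  hence "AE x in lebesgue_on D. norm (h x) \<le> B"
    using B by (simp add: ennreal_le_iff)
  thus thesis
    using B(1) by (rule that[rotated])
qed

section \<open>Smooth bump functions and the fundamental lemma of the calculus of variations\<close>

text \<open>All derivatives of the flat function exp(-1/x), extended by 0, have this form for some
  polynomial P.\<close>

definition flat :: "real poly \<Rightarrow> real \<Rightarrow> real" where
  "flat P x = (if 0 < x then poly P (1 / x) * exp (- (1 / x)) else 0)"

lemma poly_times_exp_tendsto_0: "((\<lambda>s. poly P s * exp (- s)) \<longlongrightarrow> (0::real)) at_top"
proof -
  have "((\<lambda>s. \<Sum>i\<le>degree P. coeff P i * (s ^ i / exp s)) \<longlongrightarrow> (\<Sum>i\<le>degree P. coeff P i * 0)) at_top"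
    by (intro tendsto_intros tendsto_power_div_exp_0)
  thus ?thesis
    by (simp add: poly_altdef sum_distrib_right exp_minus divide_inverse mult.assoc)
qed

lemma flat_tendsto_0: "(flat P \<longlongrightarrow> 0) (at 0)"
proof -
  have "filterlim (\<lambda>x::real. 1 / x) at_top (at_right 0)"
    using filterlim_inverse_at_top_right by (simp add: inverse_eq_divide)
  hence "((\<lambda>x. poly P (1 / x) * exp (- (1 / x))) \<longlongrightarrow> 0) (at_right 0)"
    by (rule filterlim_compose[OF poly_times_exp_tendsto_0])
  hence "(flat P \<longlongrightarrow> 0) (at_right 0)"
    by (rule Lim_transform_eventually) (auto simp: flat_def eventually_at_filter)
  moreover have "(flat P \<longlongrightarrow> 0) (at_left 0)"
    by (rule Lim_transform_eventually[OF tendsto_const]) (auto simp: flat_def eventually_at_filter)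
  ultimately show ?thesis
    by (simp add: filterlim_split_at)
qed

text \<open>With s = 1/x one has ds/dx = -s^2, so the product rule replaces P by s^2 (P -
  P').\<close>

lemma flat_has_derivative:
  "(flat P has_real_derivative flat (monom 1 2 * (P - pderiv P)) x) (at x)"
proof -
  consider "0 < x" | "x < 0" | "x = 0" by linarith
  thus ?thesis
  proof cases
    case 1
    have "((\<lambda>x. poly P (1 / x) * exp (- (1 / x))) has_real_derivative
        flat (monom 1 2 * (P - pderiv P)) x) (at x)"
      using 1 by (auto intro!: derivative_eq_intros
        simp: flat_def poly_monom power2_eq_square field_simps)
    thus ?thesis
    proof (rule DERIV_cong_ev[THEN iffD1, rotated 3])
      show "\<forall>\<^sub>F y in nhds x. poly P (1 / y) * exp (- (1 / y)) = flat P y"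
        using eventually_nhds_in_open[of "{0<..}" x] 1 by (auto simp: flat_def elim!: eventually_mono)
    qed auto
  next
    case 2
    have "((\<lambda>x. 0) has_real_derivative flat (monom 1 2 * (P - pderiv P)) x) (at x)"
      using 2 by (simp add: flat_def)
    thus ?thesis
    proof (rule DERIV_cong_ev[THEN iffD1, rotated 3])
      show "\<forall>\<^sub>F y in nhds x. 0 = flat P y"
        using eventually_nhds_in_open[of "{..<0}" x] 2 by (auto simp: flat_def elim!: eventually_mono)
    qed auto
  next
    case 3
    \<comment> \<open>The difference quotient at 0 is again of this form: dividing by h multiplies
      P(s) by s = 1/h.\<close>
    have "((\<lambda>h. flat (pCons 0 P) h) \<longlongrightarrow> 0) (at 0)"
      by (rule flat_tendsto_0)
    hence "((\<lambda>h. (flat P h - flat P 0) / (h - 0)) \<longlongrightarrow> 0) (at 0)"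
      by (rule Lim_transform_eventually) (auto simp: flat_def eventually_at_filter)
    thus ?thesis
      using 3 by (simp add: has_field_derivative_iff flat_def)
  qed
qed

text \<open>The generators are chosen so that the class is closed under partial derivatives;
  smoothness of every order then follows by induction on the order.\<close>

inductive_set smooth_class :: "(real^'d \<Rightarrow> real) set" where
  const: "(\<lambda>x. c) \<in> smooth_class"
| flat: "(\<lambda>x. flat P (s * x $ i + t)) \<in> smooth_class"
| add: "\<phi> \<in> smooth_class \<Longrightarrow> \<psi> \<in> smooth_class \<Longrightarrow> (\<lambda>x. \<phi> x + \<psi> x) \<in> smooth_class"
| mult: "\<phi> \<in> smooth_class \<Longrightarrow> \<psi> \<in> smooth_class \<Longrightarrow> (\<lambda>x. \<phi> x * \<psi> x) \<in> smooth_class"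

lemma partial_eqI:
  assumes "\<And>x. (\<phi> has_derivative \<phi>' x) (at x)"
  shows "partial i \<phi> = (\<lambda>x. \<phi>' x (axis i 1))"
  by (simp add: partial_def fun_eq_iff flip: frechet_derivative_at[OF assms])

lemma partial_add:
  assumes "\<And>x. \<phi> differentiable (at x)" "\<And>x. \<psi> differentiable (at x)"
  shows "partial i (\<lambda>x. \<phi> x + \<psi> x) = (\<lambda>x. partial i \<phi> x + partial i \<psi> x)"
  using partial_eqI[of "\<lambda>x. \<phi> x + \<psi> x"
      "\<lambda>x h. frechet_derivative \<phi> (at x) h + frechet_derivative \<psi> (at x) h" i] assms
  by (auto simp: partial_def frechet_derivative_works intro: has_derivative_add)

lemma partial_mult:
  assumes "\<And>x. \<phi> differentiable (at x)" "\<And>x. \<psi> differentiable (at x)"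
  shows "partial i (\<lambda>x. \<phi> x * \<psi> x) = (\<lambda>x. \<phi> x * partial i \<psi> x + partial i \<phi> x * \<psi> x)"
  using partial_eqI[of "\<lambda>x. \<phi> x * \<psi> x"
      "\<lambda>x h. \<phi> x * frechet_derivative \<psi> (at x) h + frechet_derivative \<phi> (at x) h * \<psi> x" i] assms
  by (auto simp: partial_def frechet_derivative_works intro: has_derivative_mult)

lemma flat_coordinate_has_derivative:
  "((\<lambda>x::real^'d. flat P (s * x $ i + t)) has_derivative
     (\<lambda>h. flat (monom 1 2 * (P - pderiv P)) (s * x $ i + t) * (s * h $ i))) (at x)"
proof -
  have "((\<lambda>x::real^'d. s * x $ i + t) has_derivative (\<lambda>h. s * h $ i)) (at x)"
    by (auto intro!: derivative_eq_intros bounded_linear_imp_has_derivative bounded_linear_vec_nth)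
  from has_derivative_compose[OF this flat_has_derivative[THEN has_field_derivative_imp_has_derivative]]
  show ?thesis by simp
qed

lemma smooth_class_partial:
  assumes "\<phi> \<in> smooth_class"
  shows "(\<forall>x. \<phi> differentiable (at x)) \<and> (\<forall>i. partial i \<phi> \<in> smooth_class)"
  using assms
proof induction
  case (const c)
  have "partial i (\<lambda>x::real^'a. c) = (\<lambda>x. 0)" for i
    by (rule partial_eqI) (rule has_derivative_const)
  thus ?case
    by (auto intro: smooth_class.const)
next
  case (flat P s i t)
  have "partial j (\<lambda>x::real^'a. flat P (s * x $ i + t))
      = (\<lambda>x. flat (monom 1 2 * (P - pderiv P)) (s * x $ i + t) * (s * axis j 1 $ i))" for j
    by (rule partial_eqI) (rule flat_coordinate_has_derivative)
  thus ?case
    using flat_coordinate_has_derivative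
    by (auto intro!: smooth_class.mult smooth_class.flat smooth_class.const
        differentiableI[OF flat_coordinate_has_derivative])
next
  case (add \<phi> \<psi>)
  thus ?case
    by (auto simp: partial_add intro: smooth_class.add differentiable_add)
next
  case (mult \<phi> \<psi>)
  thus ?case
    by (auto simp: partial_mult intro!: smooth_class.add smooth_class.mult differentiable_mult)
qed

lemma C_k_smooth_class: "\<phi> \<in> smooth_class \<Longrightarrow> C_k k \<phi>"
proof (induction k arbitrary: \<phi>)
  case 0
  thus ?case
    using smooth_class_partial[OF 0]
    by (auto simp: continuous_on_eq_continuous_at intro: differentiable_imp_continuous_within)
qed (use smooth_class_partial in auto)

lemma smooth_class_prod:
  assumes "finite I" "\<And>i. i \<in> I \<Longrightarrow> \<phi> i \<in> smooth_class"
  shows "(\<lambda>x. \<Prod>i\<in>I. \<phi> i x) \<in> smooth_class"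
  using assms
  by (induction I rule: finite_induct) (auto intro: smooth_class.const smooth_class.mult)

text \<open>The factor n + 1 steepens the profile: inside the box each factor tends to exp(0) = 1,
  outside the product is always 0, so the bumps converge to the indicator of the open box.\<close>

definition box_bump :: "real^'d \<Rightarrow> real^'d \<Rightarrow> nat \<Rightarrow> real^'d \<Rightarrow> real" where
  "box_bump a b n x = (\<Prod>i\<in>UNIV. flat 1 (real (Suc n) * (x $ i - a $ i)) * flat 1 (real (Suc n) * (b $ i - x $ i)))"

lemma mem_box_vec: "x \<in> box a b \<longleftrightarrow> (\<forall>i. a $ i < x $ i \<and> x $ i < b $ i)" for x :: "real^'d"
  by (auto simp: mem_box_cart)

lemma box_bump_eq_0: "x \<notin> box a b \<Longrightarrow> box_bump a b n x = 0"
proof -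
  assume "x \<notin> box a b"
  then obtain i where "x $ i - a $ i \<le> 0 \<or> b $ i - x $ i \<le> 0"
    by (auto simp: mem_box_vec not_less)
  hence "flat 1 (real (Suc n) * (x $ i - a $ i)) * flat 1 (real (Suc n) * (b $ i - x $ i)) = 0"
    by (auto simp: flat_def zero_less_mult_iff)
  thus ?thesis
    unfolding box_bump_def by (intro prod_zero) auto
qed

lemma flat_1_bounds: "0 \<le> flat 1 t" "flat 1 t \<le> 1"
  by (auto simp: flat_def)

lemma box_bump_bounds: "0 \<le> box_bump a b n x" "box_bump a b n x \<le> 1"
  unfolding box_bump_def
  by (auto intro!: prod_nonneg prod_le_1 mult_nonneg_nonneg mult_le_one flat_1_bounds)

lemma box_bump_tendsto: "(\<lambda>n. box_bump a b n x) \<longlonglongrightarrow> indicator (box a b) x"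
proof (cases "x \<in> box a b")
  case True
  have lim: "(\<lambda>n. flat 1 (real (Suc n) * t)) \<longlonglongrightarrow> 1" if "0 < t" for t
  proof -
    have "(\<lambda>n. exp (- (1 / t * inverse (real (Suc n))))) \<longlonglongrightarrow> exp (- (1 / t * 0))"
      by (intro tendsto_intros LIMSEQ_inverse_real_of_nat)
    moreover have "flat 1 (real (Suc n) * t) = exp (- (1 / t * inverse (real (Suc n))))" for n
      using that unfolding flat_def by (simp add: zero_less_mult_iff divide_inverse del: of_nat_Suc)
    ultimately show ?thesis
      by simp
  qed
  have "(\<lambda>n. box_bump a b n x) \<longlonglongrightarrow> (\<Prod>i\<in>(UNIV::'a set). 1 * 1)"
    unfolding box_bump_def using True by (intro tendsto_intros lim) (auto simp: mem_box_vec)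
  thus ?thesis
    using True by simp
qed (simp add: box_bump_eq_0)

lemma box_bump_smooth: "box_bump a b n \<in> smooth_class"
proof -
  have "(\<lambda>x. flat 1 (real (Suc n) * x $ i + (- real (Suc n) * a $ i))
      * flat 1 (- real (Suc n) * x $ i + real (Suc n) * b $ i)) \<in> smooth_class" for i
    by (intro smooth_class.mult smooth_class.flat)
  hence "(\<lambda>x. \<Prod>i\<in>UNIV. flat 1 (real (Suc n) * x $ i + (- real (Suc n) * a $ i))
      * flat 1 (- real (Suc n) * x $ i + real (Suc n) * b $ i)) \<in> smooth_class"
    by (intro smooth_class_prod) auto
  moreover have "box_bump a b n = (\<lambda>x. \<Prod>i\<in>UNIV. flat 1 (real (Suc n) * x $ i + (- real (Suc n) * a $ i))
      * flat 1 (- real (Suc n) * x $ i + real (Suc n) * b $ i))"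
    unfolding box_bump_def by (simp only: algebra_simps) (simp add: fun_eq_iff algebra_simps)
  ultimately show ?thesis
    by simp
qed

lemma test_function_box_bump:
  assumes "cbox a b \<subseteq> D"
  shows "test_function D (box_bump a b n)"
proof -
  have "{x. box_bump a b n x \<noteq> 0} \<subseteq> cbox a b"
    using box_bump_eq_0 box_subset_cbox by blast
  hence "closure {x. box_bump a b n x \<noteq> 0} \<subseteq> cbox a b"
    by (simp add: closure_minimal closed_cbox)
  moreover from this have "compact (closure {x. box_bump a b n x \<noteq> 0})"
    by (meson bounded_cbox bounded_subset closed_closure compact_eq_bounded_closed)
  ultimately show ?thesis
    unfolding test_function_def using C_k_smooth_class[OF box_bump_smooth] assms by blast
qed

text \<open>Open boxes form an intersection-stable generator of the Borel sets, so a Dynkin argument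
  applies; its complement step uses the total integral. Lebesgue sets differ from Borel sets by null
  sets, and the integrals over all of them determine G almost everywhere.\<close>

lemma zero_AE_if_box_integrals_zero:
  fixes G :: "real^'d \<Rightarrow> real"
  assumes G: "integrable lebesgue G" and z: "\<And>a b. (LINT x:box a b|lebesgue. G x) = 0"
    and tot: "(LINT x|lebesgue. G x) = 0"
  shows "AE x in lebesgue. G x = 0"
proof -
  have si: "set_integrable lebesgue A G" if "A \<in> sets lebesgue" for A
    using that G unfolding set_integrable_def by (rule integrable_mult_indicator)
  have borel: "(LINT x:A|lebesgue. G x) = 0" if "A \<in> sets borel" for A
  proof -
    have S: "A \<in> sigma_sets UNIV (range (\<lambda>(a, b). box a b))"
      using that by (simp add: borel_eq_box)
    have "Int_stable (range (\<lambda>(a, b). box a b :: (real^'d) set))"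
      by (auto simp: Int_stable_def box_Int_box)
    moreover have "range (\<lambda>(a, b). box a b :: (real^'d) set) \<subseteq> Pow UNIV"
      by simp
    ultimately show ?thesis
      using S
    proof (induction rule: sigma_sets_induct_disjoint)
      case (compl A)
      hence "A \<in> sets borel"
        by (simp add: borel_eq_box)
      hence A: "A \<in> sets lebesgue"
        by auto
      have "(LINT x:UNIV|lebesgue. G x) = (LINT x:A|lebesgue. G x) + (LINT x:UNIV - A|lebesgue. G x)"
        using A set_integral_Un[of A "UNIV - A" lebesgue G] si[of "UNIV - A"] si[of A]
        by (simp add: sets.compl_sets[of A lebesgue, simplified] Compl_eq_Diff_UNIV)
      thus ?case
        using compl tot by (simp add: set_lebesgue_integral_def)
    next
      case (union A)
      hence "A i \<in> sets borel" for i
        by (auto simp: borel_eq_box)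
      hence A: "A i \<in> sets lebesgue" for i
        by auto
      have "(LINT x:(\<Union>i. A i)|lebesgue. G x) = (\<Sum>i. (LINT x:(A i)|lebesgue. G x))"
        using A union by (intro lebesgue_integral_countable_add si) (auto simp: disjoint_family_on_def)
      thus ?case
        using union by simp
    qed (use z in \<open>auto simp: set_lebesgue_integral_def\<close>)
  qed
  show ?thesis
  proof (rule density_unique_real[OF G])
    fix A :: "(real^'d) set" assume "A \<in> sets lebesgue"
    then obtain S N N' where A: "A = S \<union> N" "N \<subseteq> N'" "N' \<in> null_sets lborel" "S \<in> sets lborel"
      by (rule sets_completionE)
    have N': "N' \<in> null_sets lebesgue"
      using A(3) by (simp add: null_sets_completionI)
    have "(LINT x:A|lebesgue. G x) = (LINT x:S|lebesgue. G x)"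
    proof (rule set_integral_cong_set)
      show "AE x in lebesgue. (x \<in> S) = (x \<in> A)"
        using AE_not_in[OF N'] by eventually_elim (use A in auto)
      have "S \<in> sets lebesgue"
        using A(4) by auto
      thus "set_borel_measurable lebesgue S G" "set_borel_measurable lebesgue A G"
        using \<open>A \<in> sets lebesgue\<close> borel_measurable_integrable[OF G]
        unfolding set_borel_measurable_def by measurable
    qed
    thus "(LINT x:A|lebesgue. G x) = (LINT x:A|lebesgue. 0)"
      using borel A(4) by (simp add: set_lebesgue_integral_def)
  qed simp
qed

text \<open>Testing with bumps and dominated convergence give zero integrals over all boxes whose
  closed box lies in D. \<open>zero_AE_if_box_integrals_zero\<close>, applied inside one such box,
  shows g = 0 there, and countably many of them cover D.\<close>

lemma fundamental_lemma:
  fixes g :: "real^'d \<Rightarrow> real"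
  assumes D: "open D" and g: "integrable (lebesgue_on D) g"
    and zero: "\<And>\<phi>. test_function D \<phi> \<Longrightarrow> (LINT x|lebesgue_on D. g x * \<phi> x) = 0"
  shows "AE x in lebesgue_on D. g x = 0"
proof -
  have Dm: "D \<in> sets lebesgue"
    using D by auto
  define G where "G x = indicator D x * g x" for x
  have G: "integrable lebesgue G"
    using g Dm unfolding G_def by (simp add: integrable_restrict_space)
  hence [measurable]: "G \<in> borel_measurable lebesgue"
    by auto
  have box0: "(LINT x:box a b|lebesgue. G x) = 0" if ab: "cbox a b \<subseteq> D" for a b
  proof -
    have "(\<lambda>n. LINT x|lebesgue. G x * box_bump a b n x) \<longlonglongrightarrow> (LINT x|lebesgue. G x * indicator (box a b) x)"
    proof (rule integral_dominated_convergence)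
      show "integrable lebesgue (\<lambda>x. \<bar>G x\<bar>)"
        using G by simp
      have "continuous_on UNIV (box_bump a b n)" for n
        using C_k_smooth_class[OF box_bump_smooth, of 0] by simp
      hence "box_bump a b n \<in> borel_measurable borel" for n
        by (rule borel_measurable_continuous_onI)
      hence [measurable]: "box_bump a b n \<in> borel_measurable lebesgue" for n
        by (simp add: measurable_completion)
      show "(\<lambda>x. G x * box_bump a b n x) \<in> borel_measurable lebesgue" for n
        by measurable
      have "box a b \<in> sets lebesgue"
        by auto
      thus "(\<lambda>x. G x * indicator (box a b) x) \<in> borel_measurable lebesgue"
        by (intro borel_measurable_times borel_measurable_indicator) measurable
      show "AE x in lebesgue. norm (G x * box_bump a b n x) \<le> \<bar>G x\<bar>" for n
        using box_bump_bounds[of a b n] by (simp add: abs_mult mult_left_le)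
      show "AE x in lebesgue. (\<lambda>n. G x * box_bump a b n x) \<longlonglongrightarrow> G x * indicator (box a b) x"
        by (intro AE_I2 tendsto_intros box_bump_tendsto)
    qed
    moreover have "(LINT x|lebesgue. G x * box_bump a b n x) = 0" for n
      using zero[OF test_function_box_bump[OF ab, of n]] Dm
      by (simp add: G_def integral_restrict_space mult.assoc)
    ultimately have "(LINT x|lebesgue. G x * indicator (box a b) x) = 0"
      by (simp add: LIMSEQ_const_iff)
    thus ?thesis
      by (simp add: set_lebesgue_integral_def mult.commute)
  qed
  have AEbox: "AE x in lebesgue. x \<in> box a b \<longrightarrow> G x = 0" if ab: "cbox a b \<subseteq> D" for a b
  proof -
    have "AE x in lebesgue. indicator (box a b) x * G x = 0"
    proof (rule zero_AE_if_box_integrals_zero)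
      show "integrable lebesgue (\<lambda>x. indicator (box a b) x * G x)"
        using integrable_mult_indicator[OF _ G, of "box a b"] by simp
      show "(LINT x|lebesgue. indicator (box a b) x * G x) = 0"
        using box0[OF ab] by (simp add: set_lebesgue_integral_def)
      fix c d :: "real^'d"
      obtain a' b' where ab': "box c d \<inter> box a b = box a' b'"
        using box_Int_box by blast
      have mem: "x \<in> box a' b' \<longleftrightarrow> x \<in> box c d \<and> x \<in> box a b" for x
        using ab' by blast
      have "(LINT x:box c d|lebesgue. indicator (box a b) x * G x) = (LINT x:box a' b'|lebesgue. G x)"
        by (simp add: set_lebesgue_integral_def indicator_def mem of_bool_conj mult.assoc)
      also have "\<dots> = 0"
      \<comment> \<open>If the open intersection is empty, \<open>cbox a' b'\<close> need not be its
        closure and might leave D; hence the separate case.\<close>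
      proof (cases "box a' b' = {}")
        case True
        thus ?thesis
          by (simp add: set_lebesgue_integral_def)
      next
        case False
        hence "cbox a' b' = closure (box a' b')"
          by (simp add: closure_box)
        also have "\<dots> \<subseteq> cbox a b"
          using mem box_subset_cbox[of a b] by (intro closure_minimal subsetI) auto
        finally show ?thesis
          using ab by (intro box0) auto
      qed
      finally show "(LINT x:box c d|lebesgue. indicator (box a b) x * G x) = 0" .
    qed
    thus ?thesis
      by eventually_elim (auto simp: indicator_def)
  qed
  define \<F> where "\<F> = {box a b | a b. cbox a b \<subseteq> D}"
  \<comment> \<open>Countability is needed to unite the exceptional null sets of the individual
    boxes.\<close>
  obtain \<F>' where F': "\<F>' \<subseteq> \<F>" "countable \<F>'" "\<Union>\<F>' = \<Union>\<F>"
    by (rule Lindelof[of \<F>]) (auto simp: \<F>_def open_box)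
  have "D \<subseteq> \<Union>\<F>"
  proof
    fix x assume "x \<in> D"
    obtain a b where "cbox a b \<subseteq> D" "x \<in> box a b" "\<forall>i\<in>Basis. a \<bullet> i < b \<bullet> i"
      by (rule open_contains_cbox[OF D \<open>x \<in> D\<close>])
    thus "x \<in> \<Union>\<F>"
      by (auto simp: \<F>_def)
  qed
  moreover have "AE x in lebesgue. \<forall>B\<in>\<F>'. x \<in> B \<longrightarrow> G x = 0"
    using F' AEbox by (subst AE_ball_countable) (auto simp: \<F>_def)
  ultimately have "AE x in lebesgue. x \<in> D \<longrightarrow> G x = 0"
    using F'(3) by (auto elim!: eventually_mono)
  thus ?thesis
    using Dm by (subst AE_restrict_space_iff) (auto simp: G_def elim!: eventually_mono)
qed

section \<open>Weak gradients\<close>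

lemma continuous_L2_on_bounded:
  fixes h :: "real^'d \<Rightarrow> 'b::euclidean_space"
  assumes D: "open D" "bounded D" and h: "continuous_on UNIV h"
  shows "h \<in> L2 (lebesgue_on D)"
proof -
  have "D \<in> lmeasurable"
    using D by (simp add: bounded_set_imp_lmeasurable lmeasurable_open)
  then interpret finite_measure "lebesgue_on D"
    by (rule finite_measure_lebesgue_on)
  have "bounded (h ` closure D)"
    using D by (intro compact_imp_bounded compact_continuous_image continuous_on_subset[OF h]) auto
  then obtain B where B: "\<And>x. x \<in> closure D \<Longrightarrow> norm (h x) \<le> B"
    by (auto simp: bounded_iff)
  have "h \<in> borel_measurable borel"
    using h by (rule borel_measurable_continuous_onI)
  hence "h \<in> borel_measurable lebesgue"
    by (simp add: measurable_completion)
  hence "h \<in> borel_measurable (lebesgue_on D)"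
    by (rule measurable_restrict_space1)
  thus ?thesis
  proof (rule L2_dominated)
    show "AE x in lebesgue_on D. (norm (h x))\<^sup>2 \<le> B\<^sup>2"
    proof (rule AE_I2)
      fix x assume "x \<in> space (lebesgue_on D)"
      hence "x \<in> closure D"
        using closure_subset by (auto simp: space_restrict_space)
      thus "(norm (h x))\<^sup>2 \<le> B\<^sup>2"
        by (intro power_mono B) auto
    qed
  qed simp
qed

lemma integrable_mult_L2:
  fixes v w :: "'a \<Rightarrow> real"
  shows "v \<in> L2 N \<Longrightarrow> w \<in> L2 N \<Longrightarrow> integrable N (\<lambda>x. v x * w x)"
  using integrable_inner_L2[of v N w] by simp

lemma L2_vec_nth:
  fixes g :: "'a \<Rightarrow> real^'d"
  assumes "g \<in> L2 N"
  shows "(\<lambda>x. g x $ i) \<in> L2 N"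
proof (rule L2_dominated)
  show "integrable N (\<lambda>x. (norm (g x))\<^sup>2)"
    using assms by (simp add: L2_def)
  show "(\<lambda>x. g x $ i) \<in> borel_measurable N"
    using L2_measurable[OF assms] by (simp add: cart_eq_inner_axis)
  show "AE x in N. (norm (g x $ i))\<^sup>2 \<le> (norm (g x))\<^sup>2"
    using component_le_norm_cart by (intro AE_I2 power_mono) auto
qed

lemma C_k_lincomb:
  "C_k k \<phi> \<Longrightarrow> C_k k \<psi> \<Longrightarrow> C_k k (\<lambda>x. a * \<phi> x + b * \<psi> x)"
proof (induction k arbitrary: \<phi> \<psi>)
  case 0
  thus ?case
    by (auto intro!: continuous_intros)
next
  case (Suc k)
  have "partial i (\<lambda>x. a * \<phi> x + b * \<psi> x) = (\<lambda>x. a * partial i \<phi> x + b * partial i \<psi> x)" for i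
  proof -
    have "((\<lambda>x. a * \<phi> x + b * \<psi> x) has_derivative
        (\<lambda>h. a * frechet_derivative \<phi> (at x) h + b * frechet_derivative \<psi> (at x) h)) (at x)" for x
      using Suc.prems
      by (intro has_derivative_add has_derivative_mult_right) (auto simp: frechet_derivative_works)
    from partial_eqI[OF this] show ?thesis
      by (simp add: partial_def)
  qed
  thus ?case
    using Suc by (auto intro!: derivative_intros)
qed

lemma test_function_lincomb:
  assumes "test_function D \<phi>" "test_function D \<psi>"
  shows "test_function D (\<lambda>x. a * \<phi> x + b * \<psi> x)"
proof -
  let ?A = "{x. \<phi> x \<noteq> 0}" and ?B = "{x. \<psi> x \<noteq> 0}" and ?C = "{x. a * \<phi> x + b * \<psi> x \<noteq> 0}"
  have AB: "compact (closure ?A)" "closure ?A \<subseteq> D" "compact (closure ?B)" "closure ?B \<subseteq> D"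
    using assms by (auto simp only: test_function_def)
  have "?C \<subseteq> ?A \<union> ?B"
    by auto
  hence C: "closure ?C \<subseteq> closure ?A \<union> closure ?B"
    unfolding closure_Un[symmetric] by (rule closure_mono)
  have "compact (closure ?C)"
    unfolding compact_eq_bounded_closed
    using bounded_subset[OF compact_imp_bounded[OF compact_Un[OF AB(1,3)]] C] by simp
  moreover have "closure ?C \<subseteq> D"
    using C AB(2,4) by (rule order.trans[OF _ Un_least])
  moreover have "C_k k (\<lambda>x. a * \<phi> x + b * \<psi> x)" for k
    using assms by (intro C_k_lincomb) (simp_all only: test_function_def)
  ultimately show ?thesis
    unfolding test_function_def by blast
qed

lemma test_function_zero: "test_function D (\<lambda>x. 0)"
  using C_k_smooth_class[OF smooth_class.const] by (auto simp: test_function_def)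

lemma test_function_regular:
  assumes "test_function D \<phi>"
  shows "\<phi> differentiable (at x)" "continuous_on UNIV \<phi>" "continuous_on UNIV (partial i \<phi>)"
proof -
  have *: "C_k (Suc (Suc 0)) \<phi>" "C_k 0 \<phi>"
    using assms unfolding test_function_def by blast+
  thus "\<phi> differentiable (at x)" "continuous_on UNIV \<phi>"
    by auto
  have "C_k (Suc 0) \<phi>"
    using assms unfolding test_function_def by blast
  thus "continuous_on UNIV (partial i \<phi>)"
    by auto
qed

lemma partial_eq_0_outside_support:
  assumes "x \<notin> closure {x. \<phi> x \<noteq> 0}"
  shows "partial i \<phi> x = 0"
proof -
  have "((\<lambda>x. 0::real) has_derivative (\<lambda>h. 0)) (at x)"
    by (rule has_derivative_const)
  hence "(\<phi> has_derivative (\<lambda>h. 0)) (at x)"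
  proof (rule has_derivative_transform_within_open)
    show "open (- closure {x. \<phi> x \<noteq> 0})"
      by auto
    show "0 = \<phi> y" if "y \<in> - closure {x. \<phi> x \<noteq> 0}" for y
    proof -
      have "y \<notin> {x. \<phi> x \<noteq> 0}"
        using that closure_subset[of "{x. \<phi> x \<noteq> 0}"] by blast
      thus ?thesis
        by simp
    qed
  qed (use assms in auto)
  from frechet_derivative_at[OF this] show ?thesis
    by (simp add: partial_def fun_eq_iff)
qed

lemma test_function_outside:
  assumes "test_function D \<phi>" "x \<notin> D"
  shows "\<phi> x = 0" "partial i \<phi> x = 0"
proof -
  have *: "x \<notin> closure {x. \<phi> x \<noteq> 0}"
    using assms unfolding test_function_def by blast
  have "x \<notin> {x. \<phi> x \<noteq> 0}"
    using * closure_subset[of "{x. \<phi> x \<noteq> 0}"] by blast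
  thus "\<phi> x = 0"
    by simp
  show "partial i \<phi> x = 0"
    using * by (rule partial_eq_0_outside_support)
qed

lemma DERIV_along_axis:
  assumes "F differentiable (at (x + t *\<^sub>R axis i 1))"
  shows "((\<lambda>t. F (x + t *\<^sub>R axis i 1)) has_real_derivative partial i F (x + t *\<^sub>R axis i 1)) (at t)"
proof -
  let ?F' = "frechet_derivative F (at (x + t *\<^sub>R axis i 1))"
  have F': "(F has_derivative ?F') (at (x + t *\<^sub>R axis i 1))"
    using assms by (simp add: frechet_derivative_works)
  have "((\<lambda>t. x + t *\<^sub>R axis i 1) has_derivative (\<lambda>h. h *\<^sub>R axis i 1)) (at t)"
    by (auto intro!: derivative_eq_intros)
  from has_derivative_compose[OF this F']
  have "((\<lambda>t. F (x + t *\<^sub>R axis i 1)) has_derivative (\<lambda>h. ?F' (h *\<^sub>R axis i 1))) (at t)" .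
  moreover have "?F' (h *\<^sub>R axis i 1) = partial i F (x + t *\<^sub>R axis i 1) * h" for h
    using linear_scale[OF has_derivative_linear[OF F']] by (simp add: partial_def)
  ultimately show ?thesis
    by (simp add: has_field_derivative_def)
qed

text \<open>The difference quotients of \<open>F\<close> have integral zero by translation invariance.\<close>

lemma integral_partial_eq_0:
  fixes F :: "real^'d \<Rightarrow> real"
  assumes diff: "\<And>x. F differentiable (at x)" and cont: "continuous_on UNIV (partial i F)"
    and supp: "\<And>x. R < norm x \<Longrightarrow> F x = 0"
  shows "(LINT x|lborel. partial i F x) = 0"
proof -
  define e where "e = (axis i 1 :: real^'d)"
  have e: "norm e = 1"
    by (simp add: e_def)
  define h where "h n = inverse (real (Suc n))" for n
  have h: "0 < h n" "h n \<le> 1" for n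
    by (auto simp: h_def field_simps)
  have contF: "continuous_on UNIV F"
    using diff differentiable_imp_continuous_within continuous_on_eq_continuous_within by blast
  have [measurable]: "F \<in> borel_measurable borel"
    using contF by (rule borel_measurable_continuous_onI)
  \<comment> \<open>Steps have length at most 1: the difference quotients vanish outside the ball of
    radius R + 1, and inside it the mean value theorem evaluates the derivative in the ball of
    radius R + 2.\<close>
  have "bounded (partial i F ` cball 0 (R + 2))"
    by (intro compact_imp_bounded compact_continuous_image continuous_on_subset[OF cont]) auto
  then obtain B where "\<forall>y\<in>partial i F ` cball 0 (R + 2). norm y \<le> B"
    unfolding bounded_iff by blast
  hence B: "\<bar>partial i F x\<bar> \<le> B" if "x \<in> cball 0 (R + 2)" for x
    using that by simp
  have suppc: "integrable lborel F"
  proof -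
    have "integrable lborel (\<lambda>x. indicator (cball 0 R) x *\<^sub>R F x)"
      using borel_integrable_compact[of "cball 0 R" F] contF
      by (auto intro: continuous_on_subset simp: set_integrable_def)
    also have "(\<lambda>x. indicator (cball 0 R) x *\<^sub>R F x) = F"
      using supp by (fastforce simp: indicator_def not_le)
    finally show ?thesis .
  qed
  have trans: "integrable lborel (\<lambda>x. F (c + x))" "(LINT x|lborel. F (c + x)) = (LINT x|lborel. F x)" for c
  proof -
    have "integrable (distr lborel borel ((+) c)) F" "(LINT x|distr lborel borel ((+) c). F x) = (LINT x|lborel. F x)"
      using suppc by (simp_all add: lborel_distr_plus)
    thus "integrable lborel (\<lambda>x. F (c + x))" "(LINT x|lborel. F (c + x)) = (LINT x|lborel. F x)"
      by (simp_all add: integrable_distr_eq integral_distr)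
  qed
  define q where "q n x = (F (h n *\<^sub>R e + x) - F x) / h n" for n x
  have "(\<lambda>n. LINT x|lborel. q n x) \<longlonglongrightarrow> (LINT x|lborel. partial i F x)"
  proof (rule integral_dominated_convergence)
    show "integrable lborel (\<lambda>x. indicator (cball 0 (R + 1)) x * B :: real)"
      by (intro integrable_mult_left integrable_real_indicator emeasure_bounded_finite) auto
    show "(\<lambda>x. q n x) \<in> borel_measurable lborel" for n
      unfolding q_def by measurable
    show "partial i F \<in> borel_measurable lborel"
      using cont by (simp add: borel_measurable_continuous_onI)
    show "AE x in lborel. (\<lambda>n. q n x) \<longlonglongrightarrow> partial i F x"
    proof (rule AE_I2)
      fix x :: "real^'d"
      have "((\<lambda>t. F (x + t *\<^sub>R e)) has_real_derivative partial i F x) (at 0)"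
        using DERIV_along_axis[of F x 0 i] diff by (simp add: e_def)
      hence "((\<lambda>t. (F (x + t *\<^sub>R e) - F x) / t) \<longlongrightarrow> partial i F x) (at 0)"
        by (simp add: has_field_derivative_iff)
      moreover have "filterlim h (at 0) sequentially"
        using LIMSEQ_inverse_real_of_nat by (auto simp: filterlim_at h_def[abs_def])
      ultimately have "(\<lambda>n. (F (x + h n *\<^sub>R e) - F x) / h n) \<longlonglongrightarrow> partial i F x"
        by (rule filterlim_compose)
      thus "(\<lambda>n. q n x) \<longlonglongrightarrow> partial i F x"
        by (simp add: q_def add.commute)
    qed
    show "AE x in lborel. norm (q n x) \<le> indicator (cball 0 (R + 1)) x * B" for n
    proof (rule AE_I2)
      fix x :: "real^'d"
      show "norm (q n x) \<le> indicator (cball 0 (R + 1)) x * B"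
      proof (cases "x \<in> cball 0 (R + 1)")
        case True
        obtain t where t: "0 < t" "t < h n"
          "F (x + h n *\<^sub>R e) - F (x + 0 *\<^sub>R e) = (h n - 0) * partial i F (x + t *\<^sub>R e)"
          using MVT2[of 0 "h n" "\<lambda>t. F (x + t *\<^sub>R e)" "\<lambda>t. partial i F (x + t *\<^sub>R e)"] h
            DERIV_along_axis[of F x _ i] diff by (auto simp: e_def)
        have "norm (x + t *\<^sub>R e) \<le> norm x + norm (t *\<^sub>R e)"
          by (rule norm_triangle_ineq)
        also have "\<dots> \<le> R + 2"
          using True t h[of n] e by simp
        finally have "\<bar>partial i F (x + t *\<^sub>R e)\<bar> \<le> B"
          by (intro B) simp
        thus ?thesis
          using t h[of n] True by (simp add: q_def add.commute)
      next
        case False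
        hence "R + 1 < norm x"
          by simp
        moreover have "norm x \<le> norm (h n *\<^sub>R e + x) + norm (h n *\<^sub>R e)"
          by (metis add_diff_cancel_left' norm_triangle_ineq4 add.commute)
        ultimately have "R < norm (h n *\<^sub>R e + x)" "R < norm x"
          using h[of n] e by auto
        thus ?thesis
          using False by (simp add: q_def supp)
      qed
    qed
  qed
  moreover have "(LINT x|lborel. q n x) = 0" for n
    using trans[of "h n *\<^sub>R e"] suppc by (simp add: q_def)
  ultimately show ?thesis
    by (simp add: LIMSEQ_const_iff)
qed

section \<open>Classical and weak gradients\<close>

definition grad :: "(real^'d \<Rightarrow> real) \<Rightarrow> real^'d \<Rightarrow> real^'d" where
  "grad \<phi> x = (\<chi> i. partial i \<phi> x)"

lemma continuous_grad: "test_function D \<phi> \<Longrightarrow> continuous_on UNIV (grad \<phi>)"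
  unfolding grad_def by (intro continuous_on_vec_lambda test_function_regular)

text \<open>Integration by parts: the product of both test functions vanishes outside the bounded
  set D, so its partial derivatives have integral zero.\<close>

lemma test_function_weak_gradient:
  assumes D: "open D" "bounded D" and \<phi>: "test_function D \<phi>"
  shows "has_weak_gradient D \<phi> (grad \<phi>)"
  unfolding has_weak_gradient_def
proof (intro allI impI)
  fix \<psi> i assume \<psi>: "test_function D \<psi>"
  obtain R where R: "\<And>x. x \<in> D \<Longrightarrow> norm x \<le> R"
    using D(2) by (auto simp: bounded_iff)
  have Dm: "D \<in> sets lebesgue"
    using D by auto
  note reg = test_function_regular[OF \<phi>] test_function_regular[OF \<psi>]
  let ?F = "\<lambda>x. \<phi> x * \<psi> x"
  have partial: "partial i ?F = (\<lambda>x. \<phi> x * partial i \<psi> x + partial i \<phi> x * \<psi> x)"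
    by (intro partial_mult reg)
  have "(LINT x|lborel. partial i ?F x) = 0"
  proof (rule integral_partial_eq_0[where R = R])
    show "?F differentiable (at x)" for x
      by (intro differentiable_mult reg)
    show "continuous_on UNIV (partial i ?F)"
      unfolding partial by (intro continuous_intros reg)
    show "?F x = 0" if "R < norm x" for x
      using R[of x] that test_function_outside[OF \<phi>, of x] by force
  qed
  moreover have "continuous_on UNIV (partial i ?F)"
    unfolding partial by (intro continuous_intros reg)
  hence "partial i ?F \<in> borel_measurable lborel"
    by (simp add: borel_measurable_continuous_onI)
  ultimately have "(LINT x|lebesgue. partial i ?F x) = 0"
    by (simp add: integral_completion)
  also have "(LINT x|lebesgue. partial i ?F x) = (LINT x|lebesgue_on D. partial i ?F x)"
    using Dm test_function_outside[OF \<phi>]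
    by (auto simp: partial integral_restrict_space indicator_def intro!: Bochner_Integration.integral_cong)
  also have "\<dots> = (LINT x|lebesgue_on D. \<phi> x * partial i \<psi> x) + (LINT x|lebesgue_on D. partial i \<phi> x * \<psi> x)"
    unfolding partial
    by (intro Bochner_Integration.integral_add integrable_mult_L2
        continuous_L2_on_bounded[OF D] reg)
  finally show "(LINT x|lebesgue_on D. \<phi> x * partial i \<psi> x) = - (LINT x|lebesgue_on D. grad \<phi> x $ i * \<psi> x)"
    by (simp add: grad_def)
qed

lemma grad_lincomb:
  assumes "test_function D \<phi>" "test_function D \<psi>"
  shows "grad (\<lambda>x. a * \<phi> x + b * \<psi> x) x = a *\<^sub>R grad \<phi> x + b *\<^sub>R grad \<psi> x"
proof -
  have "((\<lambda>x. a * \<phi> x + b * \<psi> x) has_derivative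
      (\<lambda>h. a * frechet_derivative \<phi> (at x) h + b * frechet_derivative \<psi> (at x) h)) (at x)" for x
    using test_function_regular(1)[OF assms(1)] test_function_regular(1)[OF assms(2)]
    by (intro has_derivative_add has_derivative_mult_right) (auto simp: frechet_derivative_works)
  from partial_eqI[OF this] show ?thesis
    by (simp add: grad_def vec_eq_iff partial_def)
qed

lemma has_weak_gradient_lincomb:
  assumes D: "open D" "bounded D"
    and v: "v \<in> L2 (lebesgue_on D)" "g \<in> L2 (lebesgue_on D)" "has_weak_gradient D v g"
    and w: "w \<in> L2 (lebesgue_on D)" "h \<in> L2 (lebesgue_on D)" "has_weak_gradient D w h"
  shows "has_weak_gradient D (\<lambda>x. a * v x + b * w x) (\<lambda>x. a *\<^sub>R g x + b *\<^sub>R h x)"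
  unfolding has_weak_gradient_def
proof (intro allI impI)
  fix \<psi> i assume \<psi>: "test_function D \<psi>"
  note int = integrable_mult_L2[OF _ continuous_L2_on_bounded[OF D]]
  have i: "integrable (lebesgue_on D) (\<lambda>x. v x * partial i \<psi> x)" "integrable (lebesgue_on D) (\<lambda>x. w x * partial i \<psi> x)"
    "integrable (lebesgue_on D) (\<lambda>x. g x $ i * \<psi> x)" "integrable (lebesgue_on D) (\<lambda>x. h x $ i * \<psi> x)"
    using v w by (auto intro!: int L2_vec_nth test_function_regular[OF \<psi>])
  have "(LINT x|lebesgue_on D. (a * v x + b * w x) * partial i \<psi> x)
      = a * (LINT x|lebesgue_on D. v x * partial i \<psi> x) + b * (LINT x|lebesgue_on D. w x * partial i \<psi> x)"
    using i by (simp add: ring_distribs mult.assoc)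
  also have "\<dots> = - (a * (LINT x|lebesgue_on D. g x $ i * \<psi> x) + b * (LINT x|lebesgue_on D. h x $ i * \<psi> x))"
    using v(3) w(3) \<psi> by (simp add: has_weak_gradient_def)
  also have "\<dots> = - (LINT x|lebesgue_on D. (a *\<^sub>R g x + b *\<^sub>R h x) $ i * \<psi> x)"
    using i by (simp add: ring_distribs mult.assoc)
  finally show "(LINT x|lebesgue_on D. (a * v x + b * w x) * partial i \<psi> x)
      = - (LINT x|lebesgue_on D. (a *\<^sub>R g x + b *\<^sub>R h x) $ i * \<psi> x)" .
qed

text \<open>The fundamental lemma is applied to each component of the difference. It is integrable
  because the constant 1 is square integrable on a bounded domain.\<close>

lemma weak_gradient_unique:
  assumes D: "open D" "bounded D"
    and g: "g \<in> L2 (lebesgue_on D)" "has_weak_gradient D v g"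
    and h: "h \<in> L2 (lebesgue_on D)" "has_weak_gradient D v h"
  shows "AE x in lebesgue_on D. g x = h x"
proof -
  note int = integrable_mult_L2[OF _ continuous_L2_on_bounded[OF D]]
  have "AE x in lebesgue_on D. g x $ i - h x $ i = 0" for i
  proof (rule fundamental_lemma[OF D(1)])
    have "integrable (lebesgue_on D) (\<lambda>x. (g x $ i - h x $ i) * 1)"
      by (intro int L2_diff L2_vec_nth g h) auto
    thus "integrable (lebesgue_on D) (\<lambda>x. g x $ i - h x $ i)"
      by simp
    fix \<phi> assume \<phi>: "test_function D \<phi>"
    have i: "integrable (lebesgue_on D) (\<lambda>x. g x $ i * \<phi> x)" "integrable (lebesgue_on D) (\<lambda>x. h x $ i * \<phi> x)"
      by (intro int L2_vec_nth g h test_function_regular[OF \<phi>])+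
    show "(LINT x|lebesgue_on D. (g x $ i - h x $ i) * \<phi> x) = 0"
      using i g(2) h(2) \<phi> by (simp add: left_diff_distrib has_weak_gradient_def)
  qed
  hence "AE x in lebesgue_on D. \<forall>i\<in>UNIV. g x $ i - h x $ i = 0"
    by (intro AE_finite_allI) auto
  thus ?thesis
    by eventually_elim (simp add: vec_eq_iff)
qed

text \<open>Relates a function to any representative of its gradient, whereas \<open>wgrad\<close>
  selects one. Linear combinations can thus be formed pointwise, and almost-everywhere equalities
  are postponed to the end.\<close>

definition H01_gradient :: "(real^'d) set \<Rightarrow> (real^'d \<Rightarrow> real) \<Rightarrow> (real^'d \<Rightarrow> real^'d) \<Rightarrow> bool" where
  "H01_gradient D v g \<longleftrightarrow> v \<in> L2 (lebesgue_on D) \<and> g \<in> L2 (lebesgue_on D)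
     \<and> has_weak_gradient D v g \<and> (\<exists>\<phi>. (\<forall>n::nat. test_function D (\<phi> n))
       \<and> (\<lambda>n. l2norm (lebesgue_on D) (\<lambda>x. v x - \<phi> n x)) \<longlonglongrightarrow> 0
       \<and> (\<lambda>n. l2norm (lebesgue_on D) (\<lambda>x. g x - grad (\<phi> n) x)) \<longlonglongrightarrow> 0)"

lemma wgrad_weak_gradient:
  assumes "g \<in> L2 (lebesgue_on D)" "has_weak_gradient D v g"
  shows "wgrad D v \<in> L2 (lebesgue_on D)" "has_weak_gradient D v (wgrad D v)"
  using someI[of "\<lambda>g. g \<in> Lp_on 2 D \<and> has_weak_gradient D v g" g] assms
  by (auto simp: wgrad_def Lp_on_2_eq)

lemma H1_norm_eq:
  assumes D: "open D" "bounded D"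
    and v: "v \<in> L2 (lebesgue_on D)" "g \<in> L2 (lebesgue_on D)" "has_weak_gradient D v g"
  shows "H1_norm D v = ennreal (sqrt ((l2norm (lebesgue_on D) v)\<^sup>2 + (l2norm (lebesgue_on D) g)\<^sup>2))"
proof -
  note w = wgrad_weak_gradient[OF v(2,3)]
  have "l2norm (lebesgue_on D) (wgrad D v) = l2norm (lebesgue_on D) g"
    by (intro l2norm_cong_AE L2_measurable weak_gradient_unique[OF D w v(2,3)] w v)
  thus ?thesis
    using v w by (simp add: H1_norm_def L2_norm_on_eq epowr_ennreal powr_half_sqrt ennreal_power
        flip: ennreal_plus)
qed

text \<open>For test functions the weak gradient is the classical one, so H1 convergence splits into
  L2 convergence of the functions and of the gradients.\<close>

lemma H01_gradient_iff:
  assumes D: "open D" "bounded D"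
  shows "H01_gradient D v g \<longleftrightarrow> v \<in> H01 D \<and> g \<in> L2 (lebesgue_on D) \<and> has_weak_gradient D v g"
proof -
  have "(\<lambda>n. H1_norm D (\<lambda>x. v x - \<phi> n x)) \<longlonglongrightarrow> 0 \<longleftrightarrow>
      (\<lambda>n. l2norm (lebesgue_on D) (\<lambda>x. v x - \<phi> n x)) \<longlonglongrightarrow> 0
       \<and> (\<lambda>n. l2norm (lebesgue_on D) (\<lambda>x. g x - grad (\<phi> n) x)) \<longlonglongrightarrow> 0"
    if v: "v \<in> L2 (lebesgue_on D)" "g \<in> L2 (lebesgue_on D)" "has_weak_gradient D v g"
      and \<phi>: "\<forall>n::nat. test_function D (\<phi> n)" for \<phi>
  proof -
    define A where "A n = l2norm (lebesgue_on D) (\<lambda>x. v x - \<phi> n x)" for n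
    define B where "B n = l2norm (lebesgue_on D) (\<lambda>x. g x - grad (\<phi> n) x)" for n
    have nn: "0 \<le> A n" "0 \<le> B n" for n
      by (auto simp: A_def B_def)
    have H: "H1_norm D (\<lambda>x. v x - \<phi> n x) = ennreal (sqrt ((A n)\<^sup>2 + (B n)\<^sup>2))" for n
    proof -
      have t: "\<phi> n \<in> L2 (lebesgue_on D)" "grad (\<phi> n) \<in> L2 (lebesgue_on D)"
        using \<phi> by (auto intro!: continuous_L2_on_bounded[OF D]
            test_function_regular continuous_grad[of D])
      have "has_weak_gradient D (\<lambda>x. 1 * v x + (- 1) * \<phi> n x) (\<lambda>x. 1 *\<^sub>R g x + (- 1) *\<^sub>R grad (\<phi> n) x)"
        using \<phi> test_function_weak_gradient[OF D] by (intro has_weak_gradient_lincomb D v t) auto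
      hence "has_weak_gradient D (\<lambda>x. v x - \<phi> n x) (\<lambda>x. g x - grad (\<phi> n) x)"
        by simp
      thus ?thesis
        unfolding A_def B_def by (intro H1_norm_eq D L2_diff v t)
    qed
    have "(\<lambda>n. H1_norm D (\<lambda>x. v x - \<phi> n x)) \<longlonglongrightarrow> 0 \<longleftrightarrow> (\<lambda>n. sqrt ((A n)\<^sup>2 + (B n)\<^sup>2)) \<longlonglongrightarrow> 0"
      unfolding H by (rule ennreal_tendsto_0_iff) auto
    also have "\<dots> \<longleftrightarrow> A \<longlonglongrightarrow> 0 \<and> B \<longlonglongrightarrow> 0"
    proof safe
      assume L: "(\<lambda>n. sqrt ((A n)\<^sup>2 + (B n)\<^sup>2)) \<longlonglongrightarrow> 0"
      show "A \<longlonglongrightarrow> 0"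
        by (rule tendsto_sandwich[OF _ _ tendsto_const L]) (auto simp: nn intro!: always_eventually real_le_rsqrt)
      show "B \<longlonglongrightarrow> 0"
        by (rule tendsto_sandwich[OF _ _ tendsto_const L]) (auto simp: nn intro!: always_eventually real_le_rsqrt)
    next
      assume "A \<longlonglongrightarrow> 0" "B \<longlonglongrightarrow> 0"
      hence "(\<lambda>n. sqrt ((A n)\<^sup>2 + (B n)\<^sup>2)) \<longlonglongrightarrow> sqrt (0\<^sup>2 + 0\<^sup>2)"
        by (intro tendsto_intros)
      thus "(\<lambda>n. sqrt ((A n)\<^sup>2 + (B n)\<^sup>2)) \<longlonglongrightarrow> 0"
        by simp
    qed
    finally show ?thesis
      by (simp add: A_def[abs_def] B_def[abs_def])
  qed
  thus ?thesis
    unfolding H01_gradient_def H01_def H1_def by (auto simp: Lp_on_2_eq)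
qed

lemma H01_gradient_wgrad:
  assumes D: "open D" "bounded D" and v: "v \<in> H01 D"
  shows "H01_gradient D v (wgrad D v)"
proof -
  obtain g where "g \<in> L2 (lebesgue_on D)" "has_weak_gradient D v g"
    using v by (auto simp: H01_def H1_def Lp_on_2_eq)
  from wgrad_weak_gradient[OF this] show ?thesis
    using v by (simp add: H01_gradient_iff[OF D])
qed

lemma H01_gradient_unique:
  assumes "open D" "bounded D" "H01_gradient D v g" "H01_gradient D v h"
  shows "AE x in lebesgue_on D. g x = h x"
  using assms weak_gradient_unique[of D g v h] by (auto simp: H01_gradient_def)

lemma H01_gradient_imp_H01: "open D \<Longrightarrow> bounded D \<Longrightarrow> H01_gradient D v g \<Longrightarrow> v \<in> H01 D"
  by (simp add: H01_gradient_iff)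

lemma H01_gradient_L2: "H01_gradient D v g \<Longrightarrow> g \<in> L2 (lebesgue_on D)"
  by (simp add: H01_gradient_def)

lemma l2norm_lincomb2_diff:
  assumes "p \<in> L2 N" "q \<in> L2 N" "p' \<in> L2 N" "q' \<in> L2 N"
  shows "l2norm N (\<lambda>x. a *\<^sub>R (p x - q x) + b *\<^sub>R (p' x - q' x))
      \<le> \<bar>a\<bar> * l2norm N (\<lambda>x. p x - q x) + \<bar>b\<bar> * l2norm N (\<lambda>x. p' x - q' x)"
  using l2norm_triangle[OF L2_scaleR[OF L2_diff[OF assms(1,2)]]
      L2_scaleR[OF L2_diff[OF assms(3,4)]], of a b] by (simp add: l2norm_scaleR)

lemma H01_gradient_lincomb:
  assumes D: "open D" "bounded D" and v: "H01_gradient D v g" and w: "H01_gradient D w h"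
  shows "H01_gradient D (\<lambda>x. a * v x + b * w x) (\<lambda>x. a *\<^sub>R g x + b *\<^sub>R h x)"
proof -
  let ?N = "lebesgue_on D"
  obtain \<phi> where \<phi>: "\<forall>n::nat. test_function D (\<phi> n)" "(\<lambda>n. l2norm ?N (\<lambda>x. v x - \<phi> n x)) \<longlonglongrightarrow> 0"
      "(\<lambda>n. l2norm ?N (\<lambda>x. g x - grad (\<phi> n) x)) \<longlonglongrightarrow> 0"
    using v unfolding H01_gradient_def by blast
  obtain \<psi> where \<psi>: "\<forall>n::nat. test_function D (\<psi> n)" "(\<lambda>n. l2norm ?N (\<lambda>x. w x - \<psi> n x)) \<longlonglongrightarrow> 0"
      "(\<lambda>n. l2norm ?N (\<lambda>x. h x - grad (\<psi> n) x)) \<longlonglongrightarrow> 0"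
    using w unfolding H01_gradient_def by blast
  have v: "v \<in> L2 ?N" "g \<in> L2 ?N" "has_weak_gradient D v g"
    using v unfolding H01_gradient_def by blast+
  have w: "w \<in> L2 ?N" "h \<in> L2 ?N" "has_weak_gradient D w h"
    using w unfolding H01_gradient_def by blast+
  note \<phi>n = \<phi>(1)[rule_format] and \<psi>n = \<psi>(1)[rule_format]
  define \<zeta> where "\<zeta> n x = a * \<phi> n x + b * \<psi> n x" for n x
  have \<zeta>: "test_function D (\<zeta> n)" for n
    unfolding \<zeta>_def[abs_def] by (intro test_function_lincomb \<phi>n \<psi>n)
  have sq: "\<phi> n \<in> L2 ?N" "\<psi> n \<in> L2 ?N" "grad (\<phi> n) \<in> L2 ?N"
    "grad (\<psi> n) \<in> L2 ?N" for n
    by (auto intro!: continuous_L2_on_bounded[OF D]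
        test_function_regular[OF \<phi>n] test_function_regular[OF \<psi>n] continuous_grad[of D] \<phi>n \<psi>n)
  have lim: "(\<lambda>n. \<bar>a\<bar> * s n + \<bar>b\<bar> * t n) \<longlonglongrightarrow> 0" if "s \<longlonglongrightarrow> 0" "t \<longlonglongrightarrow> 0" for s t
    using tendsto_add[OF tendsto_mult[OF tendsto_const that(1)] tendsto_mult[OF tendsto_const that(2)]] by simp
  have "(\<lambda>n. l2norm ?N (\<lambda>x. (a * v x + b * w x) - \<zeta> n x)) \<longlonglongrightarrow> 0"
  proof (rule tendsto_sandwich[OF _ _ tendsto_const lim[OF \<phi>(2) \<psi>(2)]])
    have eq: "(\<lambda>x. (a * v x + b * w x) - \<zeta> n x) = (\<lambda>x. a *\<^sub>R (v x - \<phi> n x) + b *\<^sub>R (w x - \<psi> n x))" for n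
      by (auto simp: \<zeta>_def algebra_simps)
    show "\<forall>\<^sub>F n in sequentially. l2norm ?N (\<lambda>x. (a * v x + b * w x) - \<zeta> n x)
        \<le> \<bar>a\<bar> * l2norm ?N (\<lambda>x. v x - \<phi> n x) + \<bar>b\<bar> * l2norm ?N (\<lambda>x. w x - \<psi> n x)"
      unfolding eq by (intro always_eventually allI l2norm_lincomb2_diff v w sq)
  qed simp
  moreover have "(\<lambda>n. l2norm ?N (\<lambda>x. (a *\<^sub>R g x + b *\<^sub>R h x) - grad (\<zeta> n) x)) \<longlonglongrightarrow> 0"
  proof (rule tendsto_sandwich[OF _ _ tendsto_const lim[OF \<phi>(3) \<psi>(3)]])
    have eq: "(\<lambda>x. (a *\<^sub>R g x + b *\<^sub>R h x) - grad (\<zeta> n) x)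
        = (\<lambda>x. a *\<^sub>R (g x - grad (\<phi> n) x) + b *\<^sub>R (h x - grad (\<psi> n) x))" for n
      unfolding \<zeta>_def[abs_def] grad_lincomb[OF \<phi>n \<psi>n] by (auto simp: algebra_simps)
    show "\<forall>\<^sub>F n in sequentially. l2norm ?N (\<lambda>x. (a *\<^sub>R g x + b *\<^sub>R h x) - grad (\<zeta> n) x)
        \<le> \<bar>a\<bar> * l2norm ?N (\<lambda>x. g x - grad (\<phi> n) x) + \<bar>b\<bar> * l2norm ?N (\<lambda>x. h x - grad (\<psi> n) x)"
      unfolding eq by (intro always_eventually allI l2norm_lincomb2_diff v w sq)
  qed simp
  moreover have "(\<lambda>x. a * v x + b * w x) \<in> L2 ?N"
    using L2_add[OF L2_scaleR[OF v(1)] L2_scaleR[OF w(1)]] by simp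
  ultimately show ?thesis
    unfolding H01_gradient_def using has_weak_gradient_lincomb[OF D v w] v w \<zeta> by auto
qed

lemma H01_gradient_zero: "H01_gradient D (\<lambda>x. 0) (\<lambda>x. 0)"
proof -
  have "partial i (\<lambda>x::real^'a. 0) = (\<lambda>x. 0)" for i
    by (rule partial_eqI) (rule has_derivative_const)
  hence g: "grad (\<lambda>x::real^'a. 0) = (\<lambda>x. 0)"
    by (auto simp: grad_def vec_eq_iff fun_eq_iff)
  show ?thesis
    unfolding H01_gradient_def
    by (auto simp: has_weak_gradient_def g test_function_zero intro!: exI[of _ "\<lambda>n x. 0"])
qed

lemma H01_gradient_sum:
  assumes D: "open D" "bounded D" and v: "\<And>i. i \<in> I \<Longrightarrow> H01_gradient D (v i) (g i)"
  shows "H01_gradient D (\<lambda>x. \<Sum>i\<in>I. c i * v i x) (\<lambda>x. \<Sum>i\<in>I. c i *\<^sub>R g i x)"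
  using v
proof (induction I rule: infinite_finite_induct)
  case (insert i I)
  have "H01_gradient D (\<lambda>x. c i * v i x + 1 * (\<Sum>j\<in>I. c j * v j x)) (\<lambda>x. c i *\<^sub>R g i x + 1 *\<^sub>R (\<Sum>j\<in>I. c j *\<^sub>R g j x))"
    using insert by (intro H01_gradient_lincomb D) auto
  thus ?case
    using insert by simp
qed (auto simp: H01_gradient_zero)

section \<open>Algebra of the detail operators\<close>

lemma lagrange_interp_add:
  "lagrange_interp z N (\<lambda>t. g t + h t) t = lagrange_interp z N g t + lagrange_interp z N h t"
  by (simp add: lagrange_interp_def scaleR_right_distrib sum.distrib)

lemma lagrange_interp_scaleR:
  "lagrange_interp z N (\<lambda>t. c *\<^sub>R g t) t = c *\<^sub>R lagrange_interp z N g t"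
  by (simp add: lagrange_interp_def scaleR_sum_right mult.commute)

lemma detail_add: "detail z mm k (\<lambda>t. g t + h t) t = detail z mm k g t + detail z mm k h t"
  by (simp add: detail_def lagrange_interp_add)

lemma detail_scaleR: "detail z mm k (\<lambda>t. c *\<^sub>R g t) t = c *\<^sub>R detail z mm k g t"
  by (simp add: detail_def lagrange_interp_scaleR scaleR_right_diff_distrib)

lemma detail_zero: "detail z mm k (\<lambda>t. 0) t = 0"
  by (simp add: detail_def lagrange_interp_def)

lemma detail_sum: "detail z mm k (\<lambda>t. \<Sum>j\<in>J. g j t) t = (\<Sum>j\<in>J. detail z mm k (g j) t)"
  by (induction J rule: infinite_finite_induct) (auto simp: detail_zero detail_add)

definition mult_var :: "nat \<Rightarrow> ((nat \<Rightarrow> real) \<Rightarrow> 'b::real_vector) \<Rightarrow> (nat \<Rightarrow> real) \<Rightarrow> 'b" where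
  "mult_var m g y = y m *\<^sub>R g y"

lemma detail_dir_add:
  "detail_dir z mm m k (\<lambda>y. g y + h y) y = detail_dir z mm m k g y + detail_dir z mm m k h y"
  by (simp add: detail_dir_def detail_add)

lemma detail_dir_scaleR: "detail_dir z mm m k (\<lambda>y. c *\<^sub>R g y) y = c *\<^sub>R detail_dir z mm m k g y"
  by (simp add: detail_dir_def detail_scaleR)

lemma detail_dir_zero: "detail_dir z mm m k (\<lambda>y. 0) = (\<lambda>y. 0)"
  by (simp add: detail_dir_def detail_zero fun_eq_iff)

text \<open>An arbitrary list of directions, so that a single direction can be taken out and treated
  separately.\<close>

definition dir_ops ::
    "(nat \<Rightarrow> real) \<Rightarrow> (nat \<Rightarrow> nat) \<Rightarrow> (nat \<Rightarrow> nat) \<Rightarrow> nat list \<Rightarrow> ((nat \<Rightarrow> real) \<Rightarrow> 'b::real_vector) \<Rightarrow> (nat \<Rightarrow> real) \<Rightarrow> 'b" where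
  "dir_ops z mm i xs g = foldr (\<lambda>m h. detail_dir z mm m (i m) h) xs g"

lemma dir_ops_simps [simp]:
  "dir_ops z mm i [] g = g"
  "dir_ops z mm i (m # xs) g = detail_dir z mm m (i m) (dir_ops z mm i xs g)"
  by (auto simp: dir_ops_def)

lemma tensor_detail_dir_ops: "tensor_detail z mm M i g = dir_ops z mm i [1..<Suc M] g"
  by (simp add: tensor_detail_def dir_ops_def)

lemma dir_ops_add: "dir_ops z mm i xs (\<lambda>y. g y + h y) = (\<lambda>y. dir_ops z mm i xs g y + dir_ops z mm i xs h y)"
  by (induction xs) (auto simp: detail_dir_add)

lemma dir_ops_scaleR: "dir_ops z mm i xs (\<lambda>y. c *\<^sub>R g y) = (\<lambda>y. c *\<^sub>R dir_ops z mm i xs g y)"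
  by (induction xs) (auto simp: detail_dir_scaleR)

lemma dir_ops_zero: "dir_ops z mm i xs (\<lambda>y. 0) = (\<lambda>y. 0)"
  by (induction xs) (auto simp: detail_dir_zero)

lemma dir_ops_cong: "(\<And>m. m \<in> set xs \<Longrightarrow> i m = j m) \<Longrightarrow> dir_ops z mm i xs g = dir_ops z mm j xs g"
  by (induction xs) auto

lemma tensor_detail_add:
  "tensor_detail z mm M i (\<lambda>y. g y + h y) y = tensor_detail z mm M i g y + tensor_detail z mm M i h y"
  by (simp add: tensor_detail_dir_ops dir_ops_add)

lemma tensor_detail_scaleR:
  "tensor_detail z mm M i (\<lambda>y. c *\<^sub>R g y) y = c *\<^sub>R tensor_detail z mm M i g y"
  by (simp add: tensor_detail_dir_ops dir_ops_scaleR)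

lemma tensor_detail_zero: "tensor_detail z mm M i (\<lambda>y. 0) = (\<lambda>y. 0)"
  by (simp add: tensor_detail_dir_ops dir_ops_zero)

lemma tensor_detail_sum:
  "tensor_detail z mm M i (\<lambda>y. \<Sum>j\<in>J. g j y) y = (\<Sum>j\<in>J. tensor_detail z mm M i (g j) y)"
  by (induction J rule: infinite_finite_induct) (auto simp: tensor_detail_zero tensor_detail_add)

definition level_down :: "nat \<Rightarrow> (nat \<Rightarrow> nat) \<Rightarrow> nat \<Rightarrow> nat" where
  "level_down m k = k(m := k m - 1)"

definition level_up :: "nat \<Rightarrow> (nat \<Rightarrow> nat) \<Rightarrow> nat \<Rightarrow> nat" where
  "level_up m i = i(m := Suc (i m))"

lemma level_down_up [simp]: "level_down m (level_up m i) = i"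
  by (simp add: level_down_def level_up_def)

lemma level_up_down: "k m \<noteq> 0 \<Longrightarrow> level_up m (level_down m k) = k"
  by (simp add: level_down_def level_up_def)

lemma level_multi_indices:
  "m \<in> {1..M} \<Longrightarrow> i \<in> multi_indices M \<Longrightarrow> level_up m i \<in> multi_indices M"
  "i \<in> multi_indices M \<Longrightarrow> level_down m i \<in> multi_indices M"
  by (auto simp: multi_indices_def level_up_def level_down_def)

lemma Marg_notin: "k \<in> Marg M \<Lambda> \<Longrightarrow> k \<notin> \<Lambda>"
  by (simp add: Marg_def)

lemma level_up_neq [simp]: "level_up m i \<noteq> i"
  by (auto simp: level_up_def fun_eq_iff)

section \<open>Univariate details on nested nodes\<close>

locale nested_nodes =
  fixes z :: "nat \<Rightarrow> real" and mm :: "nat \<Rightarrow> nat"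
  assumes inj_z: "inj z" and strict_mono_mm: "strict_mono mm"
begin

lemma mm_mono: "k \<le> l \<Longrightarrow> mm k \<le> mm l"
  using strict_mono_mm by (simp add: strict_mono_less_eq)

text \<open>Coefficient of the value at node i in the detail of level k. By nestedness both
  interpolants use nodes of level k; the coarser one contributes only at nodes it already
  has.\<close>

definition detail_poly :: "nat \<Rightarrow> nat \<Rightarrow> real poly" where
  "detail_poly k i = lagrange_basis z (mm k) i -
     (if k \<noteq> 0 \<and> i \<le> mm (k - 1) then lagrange_basis z (mm (k - 1)) i else 0)"

lemma degree_detail_poly: "i \<le> mm k \<Longrightarrow> degree (detail_poly k i) \<le> mm k"
  unfolding detail_poly_def
  by (auto intro!: degree_diff_le degree_lagrange_basis order.trans[OF degree_lagrange_basis mm_mono])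

lemma detail_eq: "detail z mm k g t = (\<Sum>i\<le>mm k. poly (detail_poly k i) t *\<^sub>R g (z i))"
proof (cases "k = 0")
  case False
  have "lagrange_interp z (mm (k - 1)) g t
      = (\<Sum>i\<le>mm k. poly (if i \<le> mm (k - 1) then lagrange_basis z (mm (k - 1)) i else 0) t *\<^sub>R g (z i))"
    unfolding lagrange_interp_def using mm_mono[of "k - 1" k]
    by (intro sum.mono_neutral_cong_left) auto
  thus ?thesis
    using False by (simp add: detail_def detail_poly_def lagrange_interp_def sum_subtractf[symmetric]
        scaleR_left_diff_distrib)
qed (simp add: detail_def detail_poly_def lagrange_interp_def)

lemma interp_reproduces:
  assumes "\<And>j. j \<in> J \<Longrightarrow> degree (q j) \<le> N"
  shows "lagrange_interp z N (\<lambda>t. \<Sum>j\<in>J. poly (q j) t *\<^sub>R w j) t = (\<Sum>j\<in>J. poly (q j) t *\<^sub>R w j)"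
  using assms
proof (induction J rule: infinite_finite_induct)
  case (insert j J)
  have "lagrange_interp z N (\<lambda>t. poly (q j) t *\<^sub>R w j) t = lagrange_interp z N (poly (q j)) t *\<^sub>R w j"
    by (simp add: lagrange_interp_def scaleR_sum_left)
  thus ?case
    using insert by (simp add: lagrange_interp_add lagrange_interp_poly[OF inj_z])
qed (auto simp: lagrange_interp_def)

lemma detail_cong: "(\<And>i. i \<le> mm k \<Longrightarrow> g (z i) = h (z i)) \<Longrightarrow> detail z mm k g t = detail z mm k h t"
  by (simp add: detail_eq)

lemma detail_at_node: "k \<noteq> 0 \<Longrightarrow> i \<le> mm (k - 1) \<Longrightarrow> detail z mm k g (z i) = 0"
  using mm_mono[of "k - 1" k] by (simp add: detail_def lagrange_interp_node[OF inj_z])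

lemma detail_vanishes_poly:
  assumes "k \<noteq> 0" "\<And>j. j \<in> J \<Longrightarrow> degree (q j) \<le> mm (k - 1)"
  shows "detail z mm k (\<lambda>t. \<Sum>j\<in>J. poly (q j) t *\<^sub>R w j) t = 0"
  using assms mm_mono[of "k - 1" k] by (auto simp: detail_def intro!: interp_reproduces[THEN trans] sym[OF interp_reproduces]
      dest: order.trans)

lemma detail_vanishes_nodes:
  assumes "\<And>i. i \<le> mm k \<Longrightarrow> g (z i) = 0"
  shows "detail z mm k g t = 0"
  using detail_cong[of k g "\<lambda>_. 0" t] assms by (simp add: detail_zero)

lemma times_detail_eq:
  "t *\<^sub>R detail z mm k g t = (\<Sum>i\<le>mm k. poly (pCons 0 (detail_poly k i)) t *\<^sub>R g (z i))"
  by (simp add: detail_eq scaleR_sum_right)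

text \<open>Strict growth of \<open>mm\<close> leaves room for one more degree on the next level.
  This confines multiplication by the variable to one additional level.\<close>

lemma degree_pCons_detail_poly: "i \<le> mm k \<Longrightarrow> degree (pCons 0 (detail_poly k i)) \<le> mm (Suc k)"
proof -
  assume "i \<le> mm k"
  hence "degree (pCons 0 (detail_poly k i)) \<le> Suc (mm k)"
    using degree_detail_poly[of i k] by (simp add: degree_pCons_eq_if)
  also have "\<dots> \<le> mm (Suc k)"
    using strict_mono_mm by (simp add: Suc_leI strict_mono_less)
  finally show ?thesis .
qed

text \<open>A detail of level l vanishes at the nodes of all lower levels, which settles k < l, and
  its degree is small enough to be reproduced by all interpolants from level l on, which settles l <
  k.\<close>

lemma detail_detail: "detail z mm k (detail z mm l g) t = (if k = l then detail z mm k g t else 0)"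
proof -
  consider "k < l" | "l < k" | "k = l" by linarith
  thus ?thesis
  proof cases
    case 1
    hence "detail z mm l g (z i) = 0" if "i \<le> mm k" for i
      using that mm_mono[of k "l - 1"] 1 by (intro detail_at_node) linarith+
    thus ?thesis
      using 1 detail_vanishes_nodes[of k "detail z mm l g"] by simp
  next
    case 2
    have "degree (detail_poly l i) \<le> mm (k - 1)" if "i \<le> mm l" for i
      using degree_detail_poly[OF that] mm_mono[of l "k - 1"] 2 by linarith
    thus ?thesis
      using 2 unfolding detail_eq[of l g, abs_def] by (subst detail_vanishes_poly) auto
  next
    case 3
    have "lagrange_interp z (mm k) (detail z mm k g) t = detail z mm k g t"
      unfolding detail_eq[of k g, abs_def] by (intro interp_reproduces) (auto intro: degree_detail_poly)
    moreover have "lagrange_interp z (mm (k - 1)) (detail z mm k g) t = 0" if "k \<noteq> 0"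
      using that by (simp add: lagrange_interp_def detail_at_node)
    ultimately show ?thesis
      unfolding 3[symmetric] by (subst detail_def) auto
  qed
qed

text \<open>The factor t keeps the zeros at the nodes and adds one degree, so the argument for
  orthogonality loses just the level l + 1.\<close>

lemma detail_times_detail:
  assumes "k \<noteq> l" "k \<noteq> Suc l"
  shows "detail z mm k (\<lambda>t. t *\<^sub>R detail z mm l g t) t = 0"
proof (cases "k < l")
  case True
  hence "detail z mm l g (z i) = 0" if "i \<le> mm k" for i
    using that mm_mono[of k "l - 1"] True by (intro detail_at_node) linarith+
  thus ?thesis
    by (intro detail_vanishes_nodes) simp
next
  case False
  hence k: "Suc l \<le> k - 1" "k \<noteq> 0"
    using assms by auto
  have "degree (pCons 0 (detail_poly l i)) \<le> mm (k - 1)" if "i \<le> mm l" for i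
    using degree_pCons_detail_poly[OF that] mm_mono[OF k(1)] by linarith
  thus ?thesis
    unfolding times_detail_eq using k by (intro detail_vanishes_poly) auto
qed

text \<open>The product is its own interpolant on level k + 1 and vanishes at the nodes of level k -
  1; the two details telescope between these levels.\<close>

lemma times_detail_decomp:
  "t *\<^sub>R detail z mm k g t =
     detail z mm k (\<lambda>t. t *\<^sub>R detail z mm k g t) t + detail z mm (Suc k) (\<lambda>t. t *\<^sub>R detail z mm k g t) t"
proof -
  let ?h = "\<lambda>t. t *\<^sub>R detail z mm k g t"
  have "lagrange_interp z (mm (Suc k)) ?h t = ?h t"
    unfolding times_detail_eq by (intro interp_reproduces degree_pCons_detail_poly) simp
  moreover have "lagrange_interp z (mm (k - 1)) ?h t = 0" if "k \<noteq> 0"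
    using that by (simp add: lagrange_interp_def detail_at_node)
  ultimately show ?thesis
    by (simp add: detail_def[of z mm _ ?h])
qed

lemma interp_eq_sum_detail: "lagrange_interp z (mm k) g t = (\<Sum>l\<le>k. detail z mm l g t)"
  by (induction k) (auto simp: detail_def)

text \<open>Only values at nodes of level k enter, so g may be replaced by its interpolant, a sum of
  details. By \<open>detail_times_detail\<close> all of them drop out except levels k and k -
  1.\<close>

lemma detail_times:
  "detail z mm k (\<lambda>t. t *\<^sub>R g t) t =
     detail z mm k (\<lambda>t. t *\<^sub>R (detail z mm k g t + (if k = 0 then 0 else detail z mm (k - 1) g t))) t"
proof -
  have "detail z mm k (\<lambda>t. t *\<^sub>R g t) t = detail z mm k (\<lambda>t. t *\<^sub>R lagrange_interp z (mm k) g t) t"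
    by (intro detail_cong) (simp add: lagrange_interp_node[OF inj_z])
  also have "\<dots> = (\<Sum>l\<le>k. detail z mm k (\<lambda>t. t *\<^sub>R detail z mm l g t) t)"
    by (simp add: interp_eq_sum_detail scaleR_sum_right detail_sum)
  also have "\<dots> = (\<Sum>l\<in>(if k = 0 then {0} else {k, k - 1}). detail z mm k (\<lambda>t. t *\<^sub>R detail z mm l g t) t)"
    by (rule sum.mono_neutral_right) (auto intro!: detail_times_detail split: if_splits)
  finally show ?thesis
    by (cases "k = 0") (simp_all add: scaleR_right_distrib detail_add)
qed

section \<open>Details in one coordinate direction\<close>

lemma detail_dir_eq:
  "detail_dir z mm m k g y = (\<Sum>i\<le>mm k. poly (detail_poly k i) (y m) *\<^sub>R g (y(m := z i)))"
  by (simp add: detail_dir_def detail_eq)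

lemma detail_dir_upd: "detail_dir z mm m k g (y(m := t)) = detail z mm k (\<lambda>s. g (y(m := s))) t"
  by (simp add: detail_dir_def)

lemma detail_dir_idem:
  "detail_dir z mm m k (detail_dir z mm m l g) = (if k = l then detail_dir z mm m k g else (\<lambda>y. 0))"
proof
  fix y
  have "detail_dir z mm m k (detail_dir z mm m l g) y
      = detail z mm k (detail z mm l (\<lambda>s. g (y(m := s)))) (y m)"
    by (simp add: detail_dir_def[of z mm m k] detail_dir_upd)
  thus "detail_dir z mm m k (detail_dir z mm m l g) y
      = (if k = l then detail_dir z mm m k g else (\<lambda>y. 0)) y"
    by (simp add: detail_detail detail_dir_def)
qed

lemma detail_dir_mult_var_same:
  "detail_dir z mm m k (mult_var m g) =
     detail_dir z mm m k (mult_var m (\<lambda>y. detail_dir z mm m k g y + (if k = 0 then 0 else detail_dir z mm m (k - 1) g y)))"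
proof
  fix y
  show "detail_dir z mm m k (mult_var m g) y =
     detail_dir z mm m k (mult_var m (\<lambda>y. detail_dir z mm m k g y + (if k = 0 then 0 else detail_dir z mm m (k - 1) g y))) y"
    using detail_times[of k "\<lambda>s. g (y(m := s))" "y m"]
    by (simp add: detail_dir_def[of z mm m k "mult_var m _"] mult_var_def detail_dir_upd[abs_def]
        cong: if_cong)
qed

lemma mult_var_detail_dir:
  "mult_var m (detail_dir z mm m k g) = (\<lambda>y. detail_dir z mm m k (mult_var m (detail_dir z mm m k g)) y
     + detail_dir z mm m (Suc k) (mult_var m (detail_dir z mm m k g)) y)"
proof
  fix y
  show "mult_var m (detail_dir z mm m k g) y = detail_dir z mm m k (mult_var m (detail_dir z mm m k g)) y
     + detail_dir z mm m (Suc k) (mult_var m (detail_dir z mm m k g)) y"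
    using times_detail_decomp[of "y m" k "\<lambda>s. g (y(m := s))"]
    by (simp add: detail_dir_def[of z mm m _ "mult_var m _"] mult_var_def detail_dir_upd)
       (simp add: detail_dir_def)
qed

lemma detail_dir_commute:
  assumes "m \<noteq> m'"
  shows "detail_dir z mm m k (detail_dir z mm m' l g) = detail_dir z mm m' l (detail_dir z mm m k g)"
proof
  fix y
  have "detail_dir z mm m k (detail_dir z mm m' l g) y = (\<Sum>i\<le>mm k. \<Sum>j\<le>mm l.
      (poly (detail_poly k i) (y m) * poly (detail_poly l j) (y m')) *\<^sub>R g (y(m := z i, m' := z j)))"
    using assms by (simp add: detail_dir_eq scaleR_sum_right)
  also have "\<dots> = (\<Sum>j\<le>mm l. \<Sum>i\<le>mm k.
      (poly (detail_poly l j) (y m') * poly (detail_poly k i) (y m)) *\<^sub>R g (y(m' := z j, m := z i)))"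
    using assms by (subst sum.swap) (simp add: fun_upd_twist mult.commute)
  also have "\<dots> = detail_dir z mm m' l (detail_dir z mm m k g) y"
    using assms by (simp add: detail_dir_eq scaleR_sum_right)
  finally show "detail_dir z mm m k (detail_dir z mm m' l g) y = detail_dir z mm m' l (detail_dir z mm m k g) y" .
qed

lemma detail_dir_mult_var: "m \<noteq> m' \<Longrightarrow> detail_dir z mm m k (mult_var m' g) = mult_var m' (detail_dir z mm m k g)"
  by (auto simp: detail_dir_eq mult_var_def scaleR_sum_right fun_eq_iff mult.commute)

lemma dir_ops_detail_dir:
  "m \<notin> set xs \<Longrightarrow> dir_ops z mm i xs (detail_dir z mm m k g) = detail_dir z mm m k (dir_ops z mm i xs g)"
proof (induction xs)
  case (Cons j xs)
  thus ?case
    by (simp add: detail_dir_commute[of j m])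
qed simp

lemma dir_ops_mult_var: "m \<notin> set xs \<Longrightarrow> dir_ops z mm i xs (mult_var m g) = mult_var m (dir_ops z mm i xs g)"
  by (induction xs) (auto simp: detail_dir_mult_var)

lemma dir_ops_extract:
  "distinct xs \<Longrightarrow> m \<in> set xs \<Longrightarrow> dir_ops z mm i xs g = detail_dir z mm m (i m) (dir_ops z mm i (remove1 m xs) g)"
proof (induction xs)
  case (Cons j xs)
  thus ?case
    by (auto simp: detail_dir_commute[of j m])
qed simp

lemma dir_ops_idem: "distinct xs \<Longrightarrow> dir_ops z mm i xs (dir_ops z mm i xs g) = dir_ops z mm i xs g"
proof (induction xs)
  case (Cons j xs)
  thus ?case
    by (simp add: dir_ops_detail_dir detail_dir_idem)
qed simp

section \<open>Tensor product details\<close>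

context
  fixes M :: nat
begin

abbreviation "\<Delta> \<equiv> tensor_detail z mm M"

abbreviation "rest m i \<equiv> dir_ops z mm i (remove1 m [1..<Suc M])"

lemma notin_rest: "m \<notin> set (remove1 m [1..<Suc M])"
  by (simp del: upt_Suc)

lemma tensor_detail_extract:
  "m \<in> {1..M} \<Longrightarrow> \<Delta> i g = detail_dir z mm m (i m) (rest m i g)"
  unfolding tensor_detail_dir_ops by (intro dir_ops_extract) auto

lemma tensor_detail_extract':
  "m \<in> {1..M} \<Longrightarrow> \<Delta> i g = rest m i (detail_dir z mm m (i m) g)"
  by (simp only: tensor_detail_extract dir_ops_detail_dir[OF notin_rest])

lemma rest_cong: "(\<And>j. j \<noteq> m \<Longrightarrow> i j = i' j) \<Longrightarrow> rest m i g = rest m i' g"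
  by (rule dir_ops_cong) (metis notin_rest)

lemma rest_idem: "rest m i (rest m i g) = rest m i g"
  by (intro dir_ops_idem distinct_remove1) simp

lemma tensor_detail_eq_zero:
  "m \<in> {1..M} \<Longrightarrow> detail_dir z mm m (i m) g = (\<lambda>y. 0) \<Longrightarrow> \<Delta> i g = (\<lambda>y. 0)"
  by (simp add: tensor_detail_extract' dir_ops_zero)

lemma tensor_detail_idem: "\<Delta> k (\<Delta> k g) = \<Delta> k g"
  unfolding tensor_detail_dir_ops by (intro dir_ops_idem) simp

lemma tensor_detail_orth:
  assumes "k \<in> multi_indices M" "i \<in> multi_indices M" "k \<noteq> i"
  shows "\<Delta> k (\<Delta> i g) = (\<lambda>y. 0)"
proof -
  obtain m where m: "k m \<noteq> i m"
    using assms(3) by auto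
  hence "m \<in> {1..M}"
    using assms by (auto simp: multi_indices_def)
  thus ?thesis
    using m by (intro tensor_detail_eq_zero[of m]) (simp_all add: tensor_detail_extract detail_dir_idem)
qed

text \<open>Multiplication by y_m interacts with direction m only, where \<open>detail_times\<close>
  applies; the operators of all other directions commute with it.\<close>

lemma tensor_detail_mult_var:
  assumes m: "m \<in> {1..M}"
  shows "\<Delta> k (mult_var m w) = (\<lambda>y. \<Delta> k (mult_var m (\<Delta> k w)) y
     + (if k m = 0 then 0 else \<Delta> k (mult_var m (\<Delta> (level_down m k) w)) y))"
proof -
  let ?D = "detail_dir z mm m"
  define S where "S = (\<lambda>y. ?D (k m) w y + (if k m = 0 then 0 else ?D (k m - 1) w y))"
  have S: "rest m k S = (\<lambda>y. \<Delta> k w y + (if k m = 0 then 0 else \<Delta> (level_down m k) w y))"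
  proof (cases "k m = 0")
    case True
    thus ?thesis
      by (simp add: S_def tensor_detail_extract'[OF m])
  next
    case False
    have "rest m (level_down m k) g = rest m k g" for g :: "(nat \<Rightarrow> real) \<Rightarrow> 'a"
      by (rule rest_cong) (simp add: level_down_def)
    moreover have "level_down m k m = k m - 1"
      by (simp add: level_down_def)
    ultimately show ?thesis
      using False by (simp add: S_def tensor_detail_extract'[OF m] dir_ops_add)
  qed
  have "\<Delta> k (mult_var m w) = rest m k (?D (k m) (mult_var m S))"
    by (simp only: tensor_detail_extract'[OF m] detail_dir_mult_var_same[of m "k m" w] S_def)
  \<comment> \<open>The projection in the other directions is doubled: one copy completes the outer
    tensor detail, the other acts on S and turns its univariate details into tensor details.\<close>
  also have "\<dots> = ?D (k m) (rest m k (rest m k (mult_var m S)))"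
    by (simp only: dir_ops_detail_dir[OF notin_rest] rest_idem)
  also have "\<dots> = \<Delta> k (mult_var m (rest m k S))"
    by (simp only: dir_ops_mult_var[OF notin_rest] tensor_detail_extract[OF m])
  also have "mult_var m (rest m k S) = (\<lambda>y. mult_var m (\<Delta> k w) y
      + (if k m = 0 then 0 else mult_var m (\<Delta> (level_down m k) w) y))"
    unfolding S by (auto simp: mult_var_def scaleR_right_distrib)
  finally show ?thesis
    by (cases "k m = 0") (simp_all add: fun_eq_iff tensor_detail_add)
qed

lemma mult_var_tensor_detail:
  assumes m: "m \<in> {1..M}"
  shows "mult_var m (\<Delta> i V) = (\<lambda>y. \<Delta> i (mult_var m (\<Delta> i V)) y + \<Delta> (level_up m i) (mult_var m (\<Delta> i V)) y)"
proof -
  define g where "g = rest m i V"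
  have W: "\<Delta> i V = detail_dir z mm m (i m) g"
    using m by (simp add: g_def tensor_detail_extract)
  \<comment> \<open>In the other directions this function is already in the range of the
    projections, so both tensor details below reduce to direction m.\<close>
  have R: "rest m i (mult_var m (\<Delta> i V)) = mult_var m (\<Delta> i V)"
    unfolding W by (simp only: dir_ops_mult_var[OF notin_rest] dir_ops_detail_dir[OF notin_rest] g_def rest_idem)
  have R': "rest m (level_up m i) h = rest m i h" for h :: "(nat \<Rightarrow> real) \<Rightarrow> 'a"
    by (rule rest_cong) (simp add: level_up_def)
  have "\<Delta> i (mult_var m (\<Delta> i V)) = detail_dir z mm m (i m) (mult_var m (\<Delta> i V))"
    "\<Delta> (level_up m i) (mult_var m (\<Delta> i V)) = detail_dir z mm m (Suc (i m)) (mult_var m (\<Delta> i V))"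
    by (simp_all only: tensor_detail_extract[OF m] R[unfolded tensor_detail_extract[OF m]] R')
       (simp_all add: level_up_def)
  thus ?thesis
    unfolding W using mult_var_detail_dir[of m "i m" g] by simp
qed

lemma tensor_detail_const: "\<Delta> k (\<lambda>y. c) = (\<lambda>y. if \<forall>m\<in>{1..M}. k m = 0 then c else 0)"
proof -
  have d: "detail z mm l (\<lambda>t. c) t = (if l = 0 then c else 0)" for l t
    using interp_reproduces[of "{()}" "\<lambda>_. 1" _ "\<lambda>_. c"] by (auto simp: detail_def)
  show ?thesis
  proof (cases "\<forall>m\<in>{1..M}. k m = 0")
    case True
    have "dir_ops z mm k xs (\<lambda>y. c) = (\<lambda>y. c)" if "set xs \<subseteq> {1..M}" for xs
      using that True by (induction xs) (auto simp: detail_dir_def d)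
    moreover have "set [1..<Suc M] \<subseteq> {1..M}"
      by auto
    ultimately show ?thesis
      using True by (simp add: tensor_detail_dir_ops del: upt_Suc set_upt)
  next
    case False
    then obtain m where "m \<in> {1..M}" "k m \<noteq> 0"
      by auto
    hence "\<Delta> k (\<lambda>y. c) = (\<lambda>y. 0)"
      by (intro tensor_detail_eq_zero[of m]) (auto simp: detail_dir_def d fun_eq_iff)
    thus ?thesis
      using False by auto
  qed
qed

section \<open>Sparse operators and affine multipliers\<close>

lemma finite_Marg:
  assumes "finite \<Lambda>"
  shows "finite (Marg M \<Lambda>)"
proof (rule finite_subset)
  show "Marg M \<Lambda> \<subseteq> (\<lambda>(i, m). level_up m i) ` (\<Lambda> \<times> {1..M})"
  proof
    fix k assume "k \<in> Marg M \<Lambda>"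
    then obtain m where "m \<in> {1..M}" "1 \<le> k m" "level_down m k \<in> \<Lambda>"
      by (auto simp: Marg_def level_down_def)
    thus "k \<in> (\<lambda>(i, m). level_up m i) ` (\<Lambda> \<times> {1..M})"
      using level_up_down[of k m] by (intro image_eqI[of _ _ "(level_down m k, m)"]) auto
  qed
qed (use assms in auto)

lemma level_up_mem_Marg:
  assumes "\<Lambda> \<subseteq> multi_indices M" "i \<in> \<Lambda>" "m \<in> {1..M}"
  shows "level_up m i \<in> \<Lambda> \<union> Marg M \<Lambda>"
proof -
  have "level_up m i \<in> multi_indices M"
    using assms by (intro level_multi_indices) auto
  moreover have "(level_up m i)(m := level_up m i m - 1) = i"
    by (simp add: level_up_def)
  moreover have "1 \<le> level_up m i m"
    by (simp add: level_up_def)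
  ultimately show ?thesis
    using assms by (auto simp: Marg_def)
qed

definition affine_fun :: "(nat \<Rightarrow> real) \<Rightarrow> (nat \<Rightarrow> real) \<Rightarrow> real" where
  "affine_fun \<alpha> y = \<alpha> 0 + (\<Sum>m=1..M. \<alpha> m * y m)"

lemma tensor_detail_affine:
  "\<Delta> k (\<lambda>y. affine_fun \<alpha> y *\<^sub>R w y) y = \<alpha> 0 *\<^sub>R \<Delta> k w y + (\<Sum>m=1..M. \<alpha> m *\<^sub>R \<Delta> k (mult_var m w) y)"
proof -
  have "(\<lambda>y. affine_fun \<alpha> y *\<^sub>R w y) = (\<lambda>y. \<alpha> 0 *\<^sub>R w y + (\<Sum>m=1..M. \<alpha> m *\<^sub>R mult_var m w y))"
    by (auto simp: affine_fun_def mult_var_def scaleR_left_distrib scaleR_sum_left)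
  thus ?thesis
    by (simp only: tensor_detail_add tensor_detail_sum tensor_detail_scaleR)
qed

context
  fixes \<Lambda> :: "(nat \<Rightarrow> nat) set"
  assumes fin: "finite \<Lambda>" and mono: "monotone_set M \<Lambda>"
begin

lemma index_set_subset: "\<Lambda> \<subseteq> multi_indices M"
  using mono by (simp add: monotone_set_def)

abbreviation "S V \<equiv> (\<lambda>y. \<Sum>i\<in>\<Lambda>. \<Delta> i V y)"

lemma tensor_detail_sparse:
  assumes k: "k \<in> multi_indices M"
  shows "\<Delta> k (S V) = (if k \<in> \<Lambda> then \<Delta> k V else (\<lambda>y. 0))"
proof
  fix y
  have "\<Delta> k (S V) y = (\<Sum>i\<in>\<Lambda>. if i = k then \<Delta> k V y else 0)"
    unfolding tensor_detail_sum using index_set_subset k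
    by (intro sum.cong) (auto simp: tensor_detail_idem tensor_detail_orth)
  thus "\<Delta> k (S V) y = (if k \<in> \<Lambda> then \<Delta> k V else (\<lambda>y. 0)) y"
    using fin by simp
qed

text \<open>The detail k of y_m V involves V on the levels k and k - e_m only. Both lie in the
  downward closed \<open>\<Lambda>\<close>, where \<open>S V\<close> and V have the same
  details.\<close>

lemma tensor_detail_affine_sparse:
  assumes k: "k \<in> \<Lambda>"
  shows "\<Delta> k (\<lambda>y. affine_fun \<alpha> y *\<^sub>R S V y) y = \<Delta> k (\<lambda>y. affine_fun \<alpha> y *\<^sub>R V y) y"
proof -
  have km: "k \<in> multi_indices M"
    using k index_set_subset by blast
  have "\<Delta> k (mult_var m (S V)) y = \<Delta> k (mult_var m V) y" if m: "m \<in> {1..M}" for m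
  proof -
    have "level_down m k \<in> \<Lambda>" if "k m \<noteq> 0"
      using mono k m that by (auto simp: monotone_set_def level_down_def)
    moreover have "level_down m k \<in> multi_indices M"
      using km by (rule level_multi_indices)
    ultimately show ?thesis
      using k km by (simp add: tensor_detail_mult_var[OF m, of k "S V"] tensor_detail_mult_var[OF m, of k V]
          tensor_detail_sparse)
  qed
  thus ?thesis
    using k km by (simp add: tensor_detail_affine tensor_detail_sparse)
qed

text \<open>The level k contributes nothing to \<open>S V\<close>, which leaves one predecessor per
  direction. The result contains details of V itself and depends on \<open>\<Lambda>\<close> only
  through the selection of summands.\<close>

lemma tensor_detail_affine_sparse_margin:
  assumes k: "k \<in> multi_indices M" "k \<notin> \<Lambda>"
  shows "\<Delta> k (\<lambda>y. affine_fun \<alpha> y *\<^sub>R S V y) y = (\<Sum>m | m \<in> {1..M} \<and> k m \<noteq> 0 \<and> level_down m k \<in> \<Lambda>.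
     \<alpha> m *\<^sub>R \<Delta> k (mult_var m (\<Delta> (level_down m k) V)) y)"
proof -
  have z: "mult_var m (\<lambda>y. 0) = (\<lambda>y. 0)" for m
    by (simp add: mult_var_def fun_eq_iff)
  have "\<Delta> k (mult_var m (S V)) y = (if k m \<noteq> 0 \<and> level_down m k \<in> \<Lambda>
      then \<Delta> k (mult_var m (\<Delta> (level_down m k) V)) y else 0)" if m: "m \<in> {1..M}" for m
    using k level_multi_indices(2)[OF k(1), of m]
    by (simp add: tensor_detail_mult_var[OF m, of k "S V"] tensor_detail_sparse z tensor_detail_zero)
  hence "\<Delta> k (\<lambda>y. affine_fun \<alpha> y *\<^sub>R S V y) y = (\<Sum>m=1..M. if k m \<noteq> 0 \<and> level_down m k \<in> \<Lambda>
      then \<alpha> m *\<^sub>R \<Delta> k (mult_var m (\<Delta> (level_down m k) V)) y else 0)"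
    using k by (simp add: tensor_detail_affine tensor_detail_sparse) (rule sum.cong, auto)
  also have "\<dots> = (\<Sum>m | m \<in> {1..M} \<and> k m \<noteq> 0 \<and> level_down m k \<in> \<Lambda>.
     \<alpha> m *\<^sub>R \<Delta> k (mult_var m (\<Delta> (level_down m k) V)) y)"
    by (subst sum.inter_filter[symmetric]) auto
  finally show ?thesis .
qed

text \<open>Multiplication by y_m spreads the detail i over the indices i and i + e_m, and the
  latter is in \<open>\<Lambda>\<close> or in its margin.\<close>

lemma mult_var_tensor_detail_sum:
  assumes i: "i \<in> \<Lambda>" and m: "m \<in> {1..M}"
  shows "(\<Sum>k\<in>\<Lambda> \<union> Marg M \<Lambda>. \<Delta> k (mult_var m (\<Delta> i V)) y) = mult_var m (\<Delta> i V) y"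
proof -
  have im: "i \<in> multi_indices M"
    using i index_set_subset by blast
  have z: "mult_var m (\<lambda>y. 0) = (\<lambda>y. 0)"
    by (simp add: mult_var_def fun_eq_iff)
  have "(\<Sum>k\<in>{i, level_up m i}. \<Delta> k (mult_var m (\<Delta> i V)) y)
      = (\<Sum>k\<in>\<Lambda> \<union> Marg M \<Lambda>. \<Delta> k (mult_var m (\<Delta> i V)) y)"
  proof (rule sum.mono_neutral_left)
    show "finite (\<Lambda> \<union> Marg M \<Lambda>)"
      using fin finite_Marg by blast
    show "{i, level_up m i} \<subseteq> \<Lambda> \<union> Marg M \<Lambda>"
      using i level_up_mem_Marg[OF index_set_subset i m] by auto
    show "\<forall>k\<in>\<Lambda> \<union> Marg M \<Lambda> - {i, level_up m i}. \<Delta> k (mult_var m (\<Delta> i V)) y = 0"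
    proof
      fix k assume k: "k \<in> \<Lambda> \<union> Marg M \<Lambda> - {i, level_up m i}"
      hence km: "k \<in> multi_indices M"
        using index_set_subset by (auto simp: Marg_def)
      have "level_down m k \<noteq> i" if "k m \<noteq> 0"
        using level_up_down[of k m] that k by auto
      thus "\<Delta> k (mult_var m (\<Delta> i V)) y = 0"
        using k km im level_multi_indices(2)[OF km, of m]
        by (simp add: tensor_detail_mult_var[OF m, of k "\<Delta> i V"] tensor_detail_orth z tensor_detail_zero)
    qed
  qed
  moreover have "(\<Sum>k\<in>{i, level_up m i}. \<Delta> k (mult_var m (\<Delta> i V)) y) = mult_var m (\<Delta> i V) y"
    using level_up_neq[of m i] fun_cong[OF mult_var_tensor_detail[OF m, of i V], of y]
    by (simp add: eq_commute[of i])
  ultimately show ?thesis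
    by simp
qed

lemma affine_sparse_eq_sum:
  "affine_fun \<alpha> y *\<^sub>R S V y = (\<Sum>k\<in>\<Lambda> \<union> Marg M \<Lambda>. \<Delta> k (\<lambda>y. affine_fun \<alpha> y *\<^sub>R S V y) y)"
proof -
  let ?K = "\<Lambda> \<union> Marg M \<Lambda>"
  have fK: "finite ?K"
    using fin finite_Marg by blast
  have "(\<Sum>k\<in>?K. \<Delta> k (S V) y) = (\<Sum>k\<in>\<Lambda>. \<Delta> k V y)"
  proof (rule sum.mono_neutral_cong_right)
    show "\<Delta> k (S V) y = \<Delta> k V y" if "k \<in> \<Lambda>" for k
      using that index_set_subset by (subst tensor_detail_sparse) auto
    show "\<forall>k\<in>?K - \<Lambda>. \<Delta> k (S V) y = 0"
      by (auto simp: Marg_def tensor_detail_sparse)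
  qed (use fK in auto)
  moreover have "(\<Sum>k\<in>?K. \<Delta> k (mult_var m (S V)) y) = mult_var m (S V) y" if m: "m \<in> {1..M}" for m
  proof -
    have "mult_var m (S V) = (\<lambda>y. \<Sum>i\<in>\<Lambda>. mult_var m (\<Delta> i V) y)"
      by (simp add: mult_var_def scaleR_sum_right fun_eq_iff)
    hence "(\<Sum>k\<in>?K. \<Delta> k (mult_var m (S V)) y) = (\<Sum>i\<in>\<Lambda>. \<Sum>k\<in>?K. \<Delta> k (mult_var m (\<Delta> i V)) y)"
      by (simp only: tensor_detail_sum) (rule sum.swap)
    also have "\<dots> = (\<Sum>i\<in>\<Lambda>. mult_var m (\<Delta> i V) y)"
      using m by (intro sum.cong refl mult_var_tensor_detail_sum)
    finally show ?thesis
      by (simp add: mult_var_def scaleR_sum_right)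
  qed
  ultimately have "(\<Sum>k\<in>?K. \<Delta> k (\<lambda>y. affine_fun \<alpha> y *\<^sub>R S V y) y)
      = \<alpha> 0 *\<^sub>R S V y + (\<Sum>m=1..M. \<alpha> m *\<^sub>R mult_var m (S V) y)"
    unfolding tensor_detail_affine sum.distrib
    by (subst sum.swap) (simp add: scaleR_sum_right[symmetric])
  also have "\<dots> = affine_fun \<alpha> y *\<^sub>R S V y"
    by (simp add: affine_fun_def mult_var_def scaleR_left_distrib scaleR_sum_left)
  finally show ?thesis
    by simp
qed

text \<open>Since \<open>S V\<close> agrees with \<open>V\<close> on all levels in \<open>\<Lambda>\<close>, the part of \<open>affine_fun \<alpha> * S V\<close> on
  \<open>\<Lambda>\<close> may be computed from \<open>V\<close>; multiplication by an affine function only reaches the margin.\<close>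

lemma affine_sparse_decomp:
  "affine_fun \<alpha> y *\<^sub>R S V y = (\<Sum>k\<in>\<Lambda>. \<Delta> k (\<lambda>y. affine_fun \<alpha> y *\<^sub>R V y) y)
     + (\<Sum>k\<in>Marg M \<Lambda>. \<Delta> k (\<lambda>y. affine_fun \<alpha> y *\<^sub>R S V y) y)"
proof -
  have "\<Lambda> \<inter> Marg M \<Lambda> = {}"
    by (auto simp: Marg_def)
  thus ?thesis
    unfolding affine_sparse_eq_sum[of \<alpha> y V]
    using fin finite_Marg by (simp add: sum.union_disjoint tensor_detail_affine_sparse)
qed

end

end

end

section \<open>Node weights and Lebesgue constants\<close>

context nested_nodes
begin

text \<open>Expands the iterated operators into a single sum over a tensor grid, so that norms,
  integrals and measurability can be treated term by term.\<close>

lemma dir_ops_formula: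
  "distinct xs \<Longrightarrow> dir_ops z mm i xs g y =
     (\<Sum>\<nu>\<in>PiE (set xs) (\<lambda>m. {..mm (i m)}). (\<Prod>m\<in>set xs. poly (detail_poly (i m) (\<nu> m)) (y m)) *\<^sub>R
        g (\<lambda>j. if j \<in> set xs then z (\<nu> j) else y j))"
proof (induction xs arbitrary: y)
  case (Cons m xs)
  let ?T = "\<lambda>m. {..mm (i m)}" and ?A = "set xs"
  let ?F = "\<lambda>\<nu>. (\<Prod>m\<in>insert m ?A. poly (detail_poly (i m) (\<nu> m)) (y m)) *\<^sub>R
      g (\<lambda>j. if j \<in> insert m ?A then z (\<nu> j) else y j)"
  have m: "m \<notin> ?A" and d: "distinct xs"
    using Cons.prems by auto
  have "(\<Sum>\<nu>\<in>PiE (insert m ?A) ?T. ?F \<nu>) = (\<Sum>(l, \<nu>)\<in>?T m \<times> PiE ?A ?T. ?F (\<nu>(m := l)))"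
    unfolding PiE_insert_eq by (subst sum.reindex[OF inj_combinator[OF m]]) (simp add: case_prod_unfold)
  also have "\<dots> = (\<Sum>l\<le>mm (i m). \<Sum>\<nu>\<in>PiE ?A ?T. ?F (\<nu>(m := l)))"
    by (simp add: sum.cartesian_product)
  also have "\<dots> = (\<Sum>l\<le>mm (i m). poly (detail_poly (i m) l) (y m) *\<^sub>R dir_ops z mm i xs g (y(m := z l)))"
  proof (rule sum.cong[OF refl])
    fix l
    have "?F (\<nu>(m := l)) = poly (detail_poly (i m) l) (y m) *\<^sub>R
        ((\<Prod>m'\<in>?A. poly (detail_poly (i m') (\<nu> m')) ((y(m := z l)) m')) *\<^sub>R
          g (\<lambda>j. if j \<in> ?A then z (\<nu> j) else (y(m := z l)) j))" for \<nu>
    proof -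
      have "(\<Prod>m'\<in>?A. poly (detail_poly (i m') ((\<nu>(m := l)) m')) (y m'))
          = (\<Prod>m'\<in>?A. poly (detail_poly (i m') (\<nu> m')) ((y(m := z l)) m'))"
        using m by (intro prod.cong) auto
      moreover have "(\<lambda>j. if j \<in> insert m ?A then z ((\<nu>(m := l)) j) else y j)
          = (\<lambda>j. if j \<in> ?A then z (\<nu> j) else (y(m := z l)) j)"
        using m by auto
      ultimately show ?thesis
        using m by simp
    qed
    thus "(\<Sum>\<nu>\<in>PiE ?A ?T. ?F (\<nu>(m := l)))
        = poly (detail_poly (i m) l) (y m) *\<^sub>R dir_ops z mm i xs g (y(m := z l))"
      by (simp only: Cons.IH[OF d] scaleR_sum_right)
  qed
  also have "\<dots> = dir_ops z mm i (m # xs) g y"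
    by (simp add: detail_dir_eq)
  finally show ?case
    by simp
qed simp

context
  fixes M :: nat
begin

definition node_indices :: "(nat \<Rightarrow> nat) \<Rightarrow> (nat \<Rightarrow> nat) set" where
  "node_indices i = PiE {1..M} (\<lambda>m. {..mm (i m)})"

definition weight :: "(nat \<Rightarrow> nat) \<Rightarrow> (nat \<Rightarrow> nat) \<Rightarrow> (nat \<Rightarrow> real) \<Rightarrow> real" where
  "weight i \<nu> y = (\<Prod>m\<in>{1..M}. poly (detail_poly (i m) (\<nu> m)) (y m))"

text \<open>Coordinates outside \<open>{1..M}\<close> are inherited from y, which keeps the grid
  points of an extensional y in \<open>Gam M\<close>.\<close>

definition node :: "(nat \<Rightarrow> nat) \<Rightarrow> (nat \<Rightarrow> real) \<Rightarrow> nat \<Rightarrow> real" where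
  "node \<nu> y j = (if j \<in> {1..M} then z (\<nu> j) else y j)"

lemma finite_node_indices: "finite (node_indices i)"
  by (simp add: node_indices_def finite_PiE)

lemma tensor_detail_formula:
  "tensor_detail z mm M i g y = (\<Sum>\<nu>\<in>node_indices i. weight i \<nu> y *\<^sub>R g (node \<nu> y))"
proof -
  have "set [1..<Suc M] = {1..M}"
    by auto
  moreover have "node \<nu> y = (\<lambda>j. if j \<in> {1..M} then z (\<nu> j) else y j)" for \<nu>
    by (simp add: node_def fun_eq_iff)
  ultimately show ?thesis
    unfolding tensor_detail_dir_ops node_indices_def weight_def
    by (subst dir_ops_formula) (simp_all only: distinct_upt)
qed

lemma node_in_Gam: "range z \<subseteq> {-1..1} \<Longrightarrow> y \<in> Gam M \<Longrightarrow> node \<nu> y \<in> Gam M"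
  by (auto simp: Gam_def node_def PiE_iff extensional_def image_subset_iff)

lemma node_eq: "y \<in> Gam M \<Longrightarrow> y' \<in> Gam M \<Longrightarrow> node \<nu> y = node \<nu> y'"
  by (auto simp: Gam_def node_def PiE_iff extensional_def fun_eq_iff)

lemma tensor_detail_cong_Gam:
  assumes "range z \<subseteq> {-1..1}" "y \<in> Gam M" "\<And>y. y \<in> Gam M \<Longrightarrow> g y = h y"
  shows "tensor_detail z mm M i g y = tensor_detail z mm M i h y"
  using node_in_Gam[OF assms(1,2)] assms(3) by (simp add: tensor_detail_formula)

text \<open>The sum is the value at t of the detail of any function whose node values are the signs
  of the basis polynomials at t. A continuous one of norm 1 is the interpolant of these signs,
  clipped to [-1,1].\<close>

lemma lebesgue_constant_le:
  assumes z: "range z \<subseteq> {-1..1}" and C: "detail_op_norm z mm k \<le> ereal C" "0 \<le> C" and t: "t \<in> {-1..1}"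
  shows "(\<Sum>i\<le>mm k. \<bar>poly (detail_poly k i) t\<bar>) \<le> C"
proof (cases "\<forall>i\<le>mm k. poly (detail_poly k i) t = 0")
  case True
  thus ?thesis
    using C by simp
next
  case False
  \<comment> \<open>Without a nonzero basis value g would vanish identically, and it could not be
    used in the operator norm.\<close>
  then obtain i0 where i0: "i0 \<le> mm k" "poly (detail_poly k i0) t \<noteq> 0"
    by auto
  define s where "s x = sgn (poly (detail_poly k (inv z x)) t)" for x
  define g where "g x = max (- 1) (min 1 (lagrange_interp z (mm k) s x))" for x
  have s: "s (z i) = sgn (poly (detail_poly k i) t)" for i
    by (simp add: s_def inv_f_f[OF inj_z])
  have g_node: "g (z i) = sgn (poly (detail_poly k i) t)" if "i \<le> mm k" for i
    using lagrange_interp_node[OF inj_z that, of s] by (simp add: g_def s sgn_if)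
  have g1: "\<bar>g x\<bar> \<le> 1" for x
    by (auto simp: g_def)
  have contg: "continuous_on {-1..1} g"
    unfolding g_def lagrange_interp_def by (intro continuous_intros)
  have zm: "z i \<in> {-1..1}" for i
    using z by (auto simp: image_subset_iff)
  have g0: "g (z i0) = 1 \<or> g (z i0) = - 1"
    using g_node[OF i0(1)] i0 by (auto simp: sgn_if)
  have "unif_norm g \<le> 1"
    unfolding unif_norm_def by (intro cSUP_least g1) auto
  moreover have "\<bar>g (z i0)\<bar> \<le> unif_norm g"
    unfolding unif_norm_def using g1 zm by (intro cSUP_upper bdd_aboveI2) auto
  ultimately have ung: "unif_norm g = 1"
    using g0 by auto
  have "continuous_on {-1..1} (\<lambda>x. \<bar>detail z mm k g x\<bar>)"
    unfolding detail_eq by (intro continuous_intros)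
  hence "bdd_above ((\<lambda>x. \<bar>detail z mm k g x\<bar>) ` {-1..1})"
    by (intro bounded_imp_bdd_above compact_imp_bounded compact_continuous_image) auto
  hence "\<bar>detail z mm k g t\<bar> \<le> unif_norm (detail z mm k g)"
    unfolding unif_norm_def using t by (intro cSUP_upper)
  also have "ereal (unif_norm (detail z mm k g)) \<le> ereal C"
  proof -
    have "\<exists>x\<in>{-1..1}. g x \<noteq> 0"
      using g0 zm[of i0] by (intro bexI[of _ "z i0"]) auto
    hence "ereal (unif_norm (detail z mm k g) / unif_norm g) \<le> detail_op_norm z mm k"
      unfolding detail_op_norm_def using contg by (intro SUP_upper) simp
    from order.trans[OF this C(1)] show ?thesis
      using ung by simp
  qed
  finally have "\<bar>detail z mm k g t\<bar> \<le> C"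
    by simp
  moreover have "detail z mm k g t = (\<Sum>i\<le>mm k. \<bar>poly (detail_poly k i) t\<bar>)"
    unfolding detail_eq using g_node by (intro sum.cong) (auto simp: abs_sgn)
  ultimately show ?thesis
    by simp
qed

lemma sum_abs_weight_le:
  assumes leb: "\<And>k t. t \<in> {-1..1} \<Longrightarrow> (\<Sum>i\<le>mm k. \<bar>poly (detail_poly k i) t\<bar>) \<le> L k" and y: "y \<in> Gam M"
  shows "(\<Sum>\<nu>\<in>node_indices i. \<bar>weight i \<nu> y\<bar>) \<le> (\<Prod>m=1..M. L (i m))"
proof -
  have "(\<Sum>\<nu>\<in>node_indices i. \<bar>weight i \<nu> y\<bar>)
      = (\<Prod>m=1..M. \<Sum>l\<le>mm (i m). \<bar>poly (detail_poly (i m) l) (y m)\<bar>)"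
    unfolding node_indices_def weight_def abs_prod by (subst prod_sum_PiE) auto
  also have "\<dots> \<le> (\<Prod>m=1..M. L (i m))"
    using y by (intro prod_mono conjI leb sum_nonneg) (auto simp: Gam_def PiE_iff)
  finally show ?thesis .
qed

lemma tensor_detail_L2:
  fixes G :: "(nat \<Rightarrow> real) \<Rightarrow> 'x \<Rightarrow> 'b::euclidean_space"
  assumes "range z \<subseteq> {-1..1}" "y \<in> Gam M" "\<And>y. y \<in> Gam M \<Longrightarrow> G y \<in> L2 N"
  shows "(\<lambda>x. tensor_detail z mm M i (\<lambda>y. G y x) y) \<in> L2 N"
  unfolding tensor_detail_formula
  using assms node_in_Gam by (intro L2_sum L2_scaleR) blast

text \<open>The Lebesgue constants for real functions also serve for functions with values in L2,
  because the triangle inequality involves the absolute weights alone, and their sum factorises over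
  the directions.\<close>

lemma l2norm_tensor_detail_le:
  fixes G :: "(nat \<Rightarrow> real) \<Rightarrow> 'x \<Rightarrow> 'b::euclidean_space"
  assumes leb: "\<And>k t. t \<in> {-1..1} \<Longrightarrow> (\<Sum>i\<le>mm k. \<bar>poly (detail_poly k i) t\<bar>) \<le> L k"
    and z: "range z \<subseteq> {-1..1}" and y: "y \<in> Gam M"
    and G: "\<And>y. y \<in> Gam M \<Longrightarrow> G y \<in> L2 N" "\<And>y. y \<in> Gam M \<Longrightarrow> l2norm N (G y) \<le> B"
  shows "l2norm N (\<lambda>x. tensor_detail z mm M i (\<lambda>y. G y x) y) \<le> (\<Prod>m=1..M. L (i m)) * B"
proof -
  have B: "0 \<le> B"
    using G(2)[OF y] by (rule order.trans[OF l2norm_nonneg])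
  have "l2norm N (\<lambda>x. tensor_detail z mm M i (\<lambda>y. G y x) y)
      \<le> (\<Sum>\<nu>\<in>node_indices i. \<bar>weight i \<nu> y\<bar> * l2norm N (G (node \<nu> y)))"
    unfolding tensor_detail_formula by (intro l2norm_lincomb G node_in_Gam z y)
  also have "\<dots> \<le> (\<Sum>\<nu>\<in>node_indices i. \<bar>weight i \<nu> y\<bar> * B)"
    by (intro sum_mono mult_left_mono G node_in_Gam z y) auto
  also have "\<dots> \<le> (\<Prod>m=1..M. L (i m)) * B"
    unfolding sum_distrib_right[symmetric] using B
    by (intro mult_right_mono sum_abs_weight_le leb y)
  finally show ?thesis .
qed

lemma integral_inner_tensor_detail:
  fixes G :: "(nat \<Rightarrow> real) \<Rightarrow> 'x \<Rightarrow> 'b::euclidean_space"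
  assumes "range z \<subseteq> {-1..1}" "y \<in> Gam M" "\<And>y. y \<in> Gam M \<Longrightarrow> G y \<in> L2 N" "e \<in> L2 N"
  shows "(LINT x|N. tensor_detail z mm M i (\<lambda>y. G y x) y \<bullet> e x)
     = tensor_detail z mm M i (\<lambda>y. LINT x|N. G y x \<bullet> e x) y"
proof -
  have "integrable N (\<lambda>x. G (node \<nu> y) x \<bullet> e x)" for \<nu>
    using assms node_in_Gam by (intro integrable_inner_L2) blast+
  thus ?thesis
    by (simp add: tensor_detail_formula inner_sum_left Bochner_Integration.integral_sum)
qed

end

end

section \<open>Newton interpolation of elliptic families\<close>

text \<open>The order n difference is a function of its last argument t, with \<tau>_0, ...,
  \<tau>_(n-1) as the other nodes. At those nodes the value is meaningless, as division by 0 gives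
  0; the lemmas exclude them.\<close>

primrec divided_diff :: "(nat \<Rightarrow> real) \<Rightarrow> (real \<Rightarrow> 'b::real_vector) \<Rightarrow> nat \<Rightarrow> real \<Rightarrow> 'b" where
  "divided_diff \<tau> w 0 t = w t"
| "divided_diff \<tau> w (Suc n) t = (divided_diff \<tau> w n t - divided_diff \<tau> w n (\<tau> n)) /\<^sub>R (t - \<tau> n)"

definition newton_poly :: "(nat \<Rightarrow> real) \<Rightarrow> nat \<Rightarrow> real poly" where
  "newton_poly \<tau> n = (\<Prod>i<n. [:- \<tau> i, 1:])"

lemma poly_newton_poly: "poly (newton_poly \<tau> n) t = (\<Prod>i<n. t - \<tau> i)"
  by (simp add: newton_poly_def poly_prod)

lemma degree_newton_poly: "degree (newton_poly \<tau> n) \<le> n"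
proof -
  have "degree (newton_poly \<tau> n) \<le> (\<Sum>i<n. 1)"
    unfolding newton_poly_def by (rule order.trans[OF degree_prod_sum_le sum_mono]) auto
  thus ?thesis
    by simp
qed

lemma newton_expansion:
  assumes "t \<notin> \<tau> ` {..<n}"
  shows "w t = (\<Sum>j<n. poly (newton_poly \<tau> j) t *\<^sub>R divided_diff \<tau> w j (\<tau> j))
     + poly (newton_poly \<tau> n) t *\<^sub>R divided_diff \<tau> w n t"
  using assms
proof (induction n)
  case (Suc n)
  hence "t \<noteq> \<tau> n"
    by auto
  hence "divided_diff \<tau> w n t = divided_diff \<tau> w n (\<tau> n) + (t - \<tau> n) *\<^sub>R divided_diff \<tau> w (Suc n) t"
    by simp
  hence "poly (newton_poly \<tau> n) t *\<^sub>R divided_diff \<tau> w n t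
      = poly (newton_poly \<tau> n) t *\<^sub>R divided_diff \<tau> w n (\<tau> n)
        + poly (newton_poly \<tau> (Suc n)) t *\<^sub>R divided_diff \<tau> w (Suc n) t"
    by (simp add: poly_newton_poly scaleR_right_distrib del: divided_diff.simps)
  moreover have "t \<notin> \<tau> ` {..<n}"
    using Suc.prems by auto
  ultimately show ?case
    using Suc.IH by (simp del: divided_diff.simps)
qed (simp add: poly_newton_poly)

text \<open>At a node the expansion terminates by itself, since all later Newton polynomials contain
  the factor t - \<tau>_i.\<close>

lemma newton_expansion_node:
  assumes "inj \<tau>" "i < n"
  shows "w (\<tau> i) = (\<Sum>j<n. poly (newton_poly \<tau> j) (\<tau> i) *\<^sub>R divided_diff \<tau> w j (\<tau> j))"
proof -
  have "\<tau> i \<notin> \<tau> ` {..<i}"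
    using assms(1) by (auto simp: inj_eq)
  hence "w (\<tau> i) = (\<Sum>j<Suc i. poly (newton_poly \<tau> j) (\<tau> i) *\<^sub>R divided_diff \<tau> w j (\<tau> j))"
    using newton_expansion[of "\<tau> i" \<tau> i w] by (simp del: divided_diff.simps)
  also have "\<dots> = (\<Sum>j<n. poly (newton_poly \<tau> j) (\<tau> i) *\<^sub>R divided_diff \<tau> w j (\<tau> j))"
    using assms(2) by (intro sum.mono_neutral_left) (auto simp: poly_newton_poly)
  finally show ?thesis .
qed

text \<open>The coefficients under study are \<open>a + t * b\<close> with |t| \<le> 1. Since \<rho>
  < 1, they stay comparable to \<open>a\<close>, whose weighted integral serves as energy for all
  t.\<close>

locale elliptic_family =
  fixes N :: "'a measure" and a b :: "'a \<Rightarrow> real" and r A \<rho> :: real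
  assumes A_ge: "r \<le> A" and a_meas [measurable]: "a \<in> borel_measurable N" and b_meas [measurable]: "b \<in> borel_measurable N"
    and r_pos: "0 < r" and \<rho>: "0 < \<rho>" "\<rho> < 1"
    and a_lower: "AE x in N. r \<le> a x" and a_upper: "AE x in N. a x \<le> A"
    and b_bound: "AE x in N. \<bar>b x\<bar> \<le> \<rho> * a x"
begin

lemma A_bounds: "AE x in N. \<bar>a x\<bar> \<le> A" "AE x in N. \<bar>b x\<bar> \<le> A"
proof -
  show "AE x in N. \<bar>a x\<bar> \<le> A"
    using a_lower a_upper by eventually_elim (use r_pos in auto)
  show "AE x in N. \<bar>b x\<bar> \<le> A"
    using a_lower a_upper b_bound
  proof eventually_elim
    case (elim x)
    hence "\<rho> * a x \<le> 1 * a x"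
      using \<rho> r_pos by (intro mult_right_mono) auto
    thus ?case
      using elim by linarith
  qed
qed

lemma integrable_weighted:
  assumes "v \<in> L2 N" "w \<in> L2 N"
  shows "integrable N (\<lambda>x. a x * (v x \<bullet> w x))" "integrable N (\<lambda>x. b x * (v x \<bullet> w x))"
  using integrable_inner_L2[OF L2_bounded_mult[OF a_meas A_bounds(1) assms(1)] assms(2)]
    integrable_inner_L2[OF L2_bounded_mult[OF b_meas A_bounds(2) assms(1)] assms(2)]
  by simp_all

definition energy :: "('a \<Rightarrow> 'b::euclidean_space) \<Rightarrow> real" where
  "energy v = (LINT x|N. a x * (v x \<bullet> v x))"

lemma energy_bounds:
  assumes v: "v \<in> L2 N"
  shows "r * (l2norm N v)\<^sup>2 \<le> energy v" "energy v \<le> A * (l2norm N v)\<^sup>2"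
proof -
  have i: "integrable N (\<lambda>x. v x \<bullet> v x)"
    using v by (intro integrable_inner_L2)
  have "(LINT x|N. r * (v x \<bullet> v x)) \<le> energy v"
    unfolding energy_def using a_lower
    by (intro integral_mono_AE integrable_weighted v integrable_mult_right i)
       (auto elim!: eventually_mono intro!: mult_right_mono)
  thus "r * (l2norm N v)\<^sup>2 \<le> energy v"
    using i by (simp add: l2norm_power2 power2_norm_eq_inner)
  have "energy v \<le> (LINT x|N. A * (v x \<bullet> v x))"
    unfolding energy_def using a_upper
    by (intro integral_mono_AE integrable_weighted v integrable_mult_right i)
       (auto elim!: eventually_mono intro!: mult_right_mono)
  thus "energy v \<le> A * (l2norm N v)\<^sup>2"
    using i by (simp add: l2norm_power2 power2_norm_eq_inner)
qed

text \<open>The left side of the equation is at least 1 - s \<rho> times the energy of v, the right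
  side at most \<rho> times the product of the energy norms of u and v. Young's inequality with the
  expected ratio \<kappa> as parameter loses nothing in the end.\<close>

lemma energy_stability:
  assumes v: "v \<in> L2 N" and u: "u \<in> L2 N" and t: "\<bar>t\<bar> \<le> s" "s \<le> 1"
    and eq: "(LINT x|N. (a x + t * b x) * (v x \<bullet> v x)) = - (LINT x|N. b x * (u x \<bullet> v x))"
  shows "energy v \<le> (\<rho> / (1 - s * \<rho>))\<^sup>2 * energy u"
proof -
  have "s * \<rho> \<le> 1 * \<rho>"
    using t \<rho> by (intro mult_right_mono) auto
  hence sr: "s * \<rho> < 1"
    using \<rho> by linarith
  define \<kappa> where "\<kappa> = \<rho> / (1 - s * \<rho>)"
  have \<kappa>: "0 < \<kappa>" "\<rho> = \<kappa> * (1 - s * \<rho>)"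
    using sr \<rho> by (auto simp: \<kappa>_def)
  note int = integrable_weighted[OF v v] integrable_weighted[OF u u] integrable_weighted[OF u v]
  have "(1 - s * \<rho>) * energy v \<le> (LINT x|N. (a x + t * b x) * (v x \<bullet> v x))"
  proof -
    have "(LINT x|N. (1 - s * \<rho>) * (a x * (v x \<bullet> v x))) \<le> (LINT x|N. (a x + t * b x) * (v x \<bullet> v x))"
    proof (rule integral_mono_AE)
      show "integrable N (\<lambda>x. (a x + t * b x) * (v x \<bullet> v x))"
        using int by (simp add: distrib_right mult.assoc)
      show "AE x in N. (1 - s * \<rho>) * (a x * (v x \<bullet> v x)) \<le> (a x + t * b x) * (v x \<bullet> v x)"
        using b_bound
      proof eventually_elim
        case (elim x)
        have "\<bar>t * b x\<bar> \<le> s * (\<rho> * a x)"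
          unfolding abs_mult using elim t by (intro mult_mono) auto
        hence "(1 - s * \<rho>) * a x \<le> a x + t * b x"
          by (auto simp: algebra_simps)
        thus ?case
          unfolding mult.assoc[symmetric] by (intro mult_right_mono) auto
      qed
    qed (use int in auto)
    thus ?thesis
      by (simp add: energy_def)
  qed
  also have "\<dots> \<le> (LINT x|N. \<rho> / 2 * (\<kappa> * (a x * (u x \<bullet> u x)) + (a x * (v x \<bullet> v x)) / \<kappa>))"
    unfolding eq Bochner_Integration.integral_minus[symmetric]
  proof (rule integral_mono_AE)
    show "AE x in N. - (b x * (u x \<bullet> v x)) \<le> \<rho> / 2 * (\<kappa> * (a x * (u x \<bullet> u x)) + (a x * (v x \<bullet> v x)) / \<kappa>)"
      using b_bound
    proof eventually_elim
      case (elim x)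
      have "- (b x * (u x \<bullet> v x)) \<le> \<bar>b x\<bar> * \<bar>u x \<bullet> v x\<bar>"
        unfolding abs_mult[symmetric] by simp
      also have "\<dots> \<le> (\<rho> * a x) * \<bar>u x \<bullet> v x\<bar>"
        using elim by (intro mult_right_mono) auto
      also have "\<dots> \<le> (\<rho> * a x) * ((\<kappa> * (u x \<bullet> u x) + (v x \<bullet> v x) / \<kappa>) / 2)"
        using inner_Young[OF \<kappa>(1), of "u x" "v x"] elim
        by (intro mult_left_mono) (auto simp: power2_norm_eq_inner)
      finally show ?case
        by (simp add: algebra_simps)
    qed
  qed (use int in auto)
  also have "\<dots> = \<rho> / 2 * (\<kappa> * energy u + energy v / \<kappa>)"
    using int by (simp add: energy_def)
  also have "\<dots> = (1 - s * \<rho>) * ((\<kappa>\<^sup>2 * energy u + energy v) / 2)"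
    using \<kappa>(1) by (subst \<kappa>(2)) (simp add: power2_eq_square field_simps)
  finally have "energy v \<le> (\<kappa>\<^sup>2 * energy u + energy v) / 2"
    using sr by simp
  thus ?thesis
    by (simp add: \<kappa>_def)
qed

end

text \<open>\<open>V\<close> is the space of gradients, closed under the operations that build
  divided differences; \<open>L\<close> is the load, the same for all t. The nodes are confined to
  [-\<epsilon>, \<epsilon>].\<close>

locale elliptic_trajectory = elliptic_family N a b r A \<rho>
  for N :: "'a measure" and a b :: "'a \<Rightarrow> real" and r A \<rho> :: real +
  fixes V :: "('a \<Rightarrow> 'b::euclidean_space) set" and w :: "real \<Rightarrow> 'a \<Rightarrow> 'b" and L :: "('a \<Rightarrow> 'b) \<Rightarrow> real"
    and \<tau> :: "nat \<Rightarrow> real" and \<epsilon> B :: real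
  assumes V: "V \<subseteq> L2 N" "\<And>v u c. v \<in> V \<Longrightarrow> u \<in> V \<Longrightarrow> (\<lambda>x. (v x - u x) /\<^sub>R c) \<in> V"
    and w: "\<And>t. t \<in> {-1..1} \<Longrightarrow> w t \<in> V"
    and w_eq: "\<And>t g. t \<in> {-1..1} \<Longrightarrow> g \<in> V \<Longrightarrow> (LINT x|N. (a x + t * b x) * (w t x \<bullet> g x)) = L g"
    and w_bound: "\<And>t. t \<in> {-1..1} \<Longrightarrow> l2norm N (w t) \<le> B"
    and \<tau>: "inj \<tau>" "\<And>n. \<bar>\<tau> n\<bar> \<le> \<epsilon>" "\<epsilon> \<le> 1"
begin

abbreviation "W n t x \<equiv> divided_diff \<tau> (\<lambda>t. w t x) n t"

lemma node_mem: "\<tau> n \<in> {-1..1}" "\<tau> n \<notin> \<tau> ` {..<n}"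
  using \<tau>(2)[of n] \<tau>(1,3) by (auto simp: inj_eq)

lemma divided_diff_mem:
  "t \<in> {-1..1} \<Longrightarrow> t \<notin> \<tau> ` {..<n} \<Longrightarrow> W n t \<in> V"
proof (induction n arbitrary: t)
  case (Suc n)
  have "W n t \<in> V"
    using Suc.prems by (intro Suc.IH) auto
  moreover have "W n (\<tau> n) \<in> V"
    by (intro Suc.IH node_mem)
  ultimately show ?case
    using V(2) by simp
qed (use w in simp)

text \<open>Subtracting the equations at t and \<tau>_n cancels their common right-hand side; the
  change (t - \<tau>_n) b of the coefficient, acting on the value at \<tau>_n, moves to the right.
  The new right-hand side is again independent of t, so the step can be repeated.\<close>

lemma divided_diff_equation:
  assumes t: "t \<in> {-1..1}" "t \<notin> \<tau> ` {..<Suc n}" and g: "g \<in> V"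
  shows "(LINT x|N. (a x + t * b x) * (W (Suc n) t x \<bullet> g x)) = - (LINT x|N. b x * (W n (\<tau> n) x \<bullet> g x))"
proof -
  have step: "(LINT x|N. (a x + t * b x) * (W (Suc n) t x \<bullet> g x)) = - (LINT x|N. b x * (W n (\<tau> n) x \<bullet> g x))"
    if t: "t \<in> {-1..1}" "t \<notin> \<tau> ` {..<Suc n}"
      and eq: "(LINT x|N. (a x + t * b x) * (W n t x \<bullet> g x)) = (LINT x|N. (a x + \<tau> n * b x) * (W n (\<tau> n) x \<bullet> g x))"
    for n t
  proof -
    have "t \<notin> \<tau> ` {..<n}"
      using t by auto
    hence s: "W n t \<in> L2 N" "W n (\<tau> n) \<in> L2 N" "g \<in> L2 N"
      using divided_diff_mem[of t n] divided_diff_mem[OF node_mem] t V(1) g by auto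
    note int = integrable_weighted[OF s(1,3)] integrable_weighted[OF s(2,3)]
    have tn: "t - \<tau> n \<noteq> 0"
      using t by auto
    have "(LINT x|N. (a x + t * b x) * (W (Suc n) t x \<bullet> g x))
        = (LINT x|N. ((a x + t * b x) * (W n t x \<bullet> g x) - (a x + \<tau> n * b x) * (W n (\<tau> n) x \<bullet> g x)
            - (t - \<tau> n) * (b x * (W n (\<tau> n) x \<bullet> g x))) / (t - \<tau> n))"
      by (simp add: inner_diff_left algebra_simps divide_inverse)
    also have "\<dots> = ((LINT x|N. (a x + t * b x) * (W n t x \<bullet> g x)) - (LINT x|N. (a x + \<tau> n * b x) * (W n (\<tau> n) x \<bullet> g x))
            - (t - \<tau> n) * (LINT x|N. b x * (W n (\<tau> n) x \<bullet> g x))) / (t - \<tau> n)"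
      using int by (simp add: distrib_right mult.assoc)
    also have "\<dots> = - (LINT x|N. b x * (W n (\<tau> n) x \<bullet> g x))"
      unfolding eq using tn by simp
    finally show ?thesis .
  qed
  have "(LINT x|N. (a x + t * b x) * (W n t x \<bullet> g x)) = (LINT x|N. (a x + \<tau> n * b x) * (W n (\<tau> n) x \<bullet> g x))"
  proof (cases n)
    case 0
    thus ?thesis
      using w_eq[OF t(1) g] w_eq[OF node_mem(1) g] by simp
  next
    case (Suc n')
    have H: "(LINT x|N. (a x + s * b x) * (W (Suc n') s x \<bullet> g x)) = - (LINT x|N. b x * (W n' (\<tau> n') x \<bullet> g x))"
      if "s \<in> {-1..1}" "s \<notin> \<tau> ` {..<Suc n'}" for s
      using that
    proof (induction n' arbitrary: s)
      case 0
      show ?case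
        using w_eq[OF 0(1) g] w_eq[OF node_mem(1) g] by (intro step[OF 0]) simp
    next
      case (Suc n')
      have "s \<notin> \<tau> ` {..<Suc n'}"
        using Suc.prems by auto
      show ?case
        by (intro step[OF Suc.prems] trans[OF Suc.IH Suc.IH[symmetric]] Suc.prems(1) node_mem) fact
    qed
    have "t \<notin> \<tau> ` {..<Suc n'}"
      using t by (auto simp: Suc)
    thus ?thesis
      unfolding Suc by (intro trans[OF H H[symmetric]] t(1) node_mem)
  qed
  thus ?thesis
    by (rule step[OF t])
qed

lemma divided_diff_energy:
  assumes t: "t \<in> {-1..1}" "t \<notin> \<tau> ` {..<Suc n}" "\<bar>t\<bar> \<le> s" "s \<le> 1"
  shows "energy (W (Suc n) t) \<le> (\<rho> / (1 - s * \<rho>))\<^sup>2 * energy (W n (\<tau> n))"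
proof -
  have v: "W (Suc n) t \<in> V"
    by (intro divided_diff_mem t)
  show ?thesis
    using divided_diff_equation[OF t(1,2) v] v divided_diff_mem[OF node_mem] V(1) t(3,4)
    by (intro energy_stability) auto
qed

lemma divided_diff_energy_node:
  "energy (W n (\<tau> n)) \<le> ((\<rho> / (1 - \<epsilon> * \<rho>))\<^sup>2) ^ n * (A * B\<^sup>2)"
proof (induction n)
  case 0
  have w0: "w (\<tau> 0) \<in> L2 N"
    using w[OF node_mem(1)] V(1) by auto
  have "A * (l2norm N (w (\<tau> 0)))\<^sup>2 \<le> A * B\<^sup>2"
    using w_bound[OF node_mem(1)] A_ge r_pos by (intro mult_left_mono power_mono) auto
  thus ?case
    using energy_bounds(2)[OF w0] by simp
next
  case (Suc n)
  have "energy (W (Suc n) (\<tau> (Suc n))) \<le> (\<rho> / (1 - \<epsilon> * \<rho>))\<^sup>2 * energy (W n (\<tau> n))"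
    by (intro divided_diff_energy node_mem \<tau>)
  also have "\<dots> \<le> (\<rho> / (1 - \<epsilon> * \<rho>))\<^sup>2 * (((\<rho> / (1 - \<epsilon> * \<rho>))\<^sup>2) ^ n * (A * B\<^sup>2))"
    by (intro mult_left_mono Suc.IH) simp
  finally show ?case
    by simp
qed

text \<open>The remainder consists of n factors of modulus at most 1 + \<epsilon> and a divided
  difference. Between nodes each order contracts the energy norm by \<rho>/(1 - \<epsilon> \<rho>).
  The last step ends at a general t and contracts by \<rho>/(1 - \<rho>) only; its denominator goes
  into the constant. The root of A / r comes from changing between energy and L2 norm.\<close>

lemma newton_approximation:
  assumes t: "t \<in> {-1..1}"
  shows "l2norm N (\<lambda>x. w t x - (\<Sum>j<n. poly (newton_poly \<tau> j) t *\<^sub>R W j (\<tau> j) x))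
    \<le> sqrt (A / r) * B / (1 - \<rho>) * ((1 + \<epsilon>) * \<rho> / (1 - \<epsilon> * \<rho>)) ^ n"
proof -
  have \<epsilon>: "0 \<le> \<epsilon>"
    using \<tau>(2)[of 0] by linarith
  have "\<epsilon> * \<rho> \<le> 1 * \<rho>"
    using \<tau>(3) \<rho> by (intro mult_right_mono) auto
  hence er: "0 < 1 - \<epsilon> * \<rho>"
    using \<rho> by linarith
  have er1: "1 - \<epsilon> * \<rho> \<le> 1"
    using \<rho> \<epsilon> by simp
  have B: "0 \<le> B"
    using w_bound[OF t] by (rule order.trans[OF l2norm_nonneg])
  have rhs: "0 \<le> sqrt (A / r) * B / (1 - \<rho>) * ((1 + \<epsilon>) * \<rho> / (1 - \<epsilon> * \<rho>)) ^ n"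
    using A_ge r_pos \<rho> B \<epsilon> er by simp
  show ?thesis
  proof (cases "t \<in> \<tau> ` {..<n}")
    case True
    then obtain i where i: "i < n" "t = \<tau> i"
      by auto
    have "w t x - (\<Sum>j<n. poly (newton_poly \<tau> j) t *\<^sub>R W j (\<tau> j) x) = 0" for x
      unfolding i(2) using newton_expansion_node[OF \<tau>(1) i(1), of "\<lambda>t. w t x"] by simp
    thus ?thesis
      using rhs by simp
  next
    case False
    have eq: "w t x - (\<Sum>j<n. poly (newton_poly \<tau> j) t *\<^sub>R W j (\<tau> j) x) = poly (newton_poly \<tau> n) t *\<^sub>R W n t x" for x
      using newton_expansion[OF False, of "\<lambda>t. w t x"] by simp
    have wn: "W n t \<in> L2 N"
      using divided_diff_mem[OF t False] V(1) by auto
    define \<kappa> where "\<kappa> = \<rho> / (1 - \<epsilon> * \<rho>)"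
    have \<kappa>: "0 < \<kappa>" "\<rho> \<le> \<kappa>"
      using er er1 \<rho> by (auto simp: \<kappa>_def le_divide_eq intro: mult_left_le)
    have sAr: "1 \<le> sqrt (A / r)"
      using A_ge r_pos by simp
    have "l2norm N (W n t) \<le> sqrt (A / r) * B / (1 - \<rho>) * \<kappa> ^ n"
    proof (cases n)
      case 0
      have "l2norm N (w t) \<le> 1 * B / 1"
        using w_bound[OF t] by simp
      also have "\<dots> \<le> sqrt (A / r) * B / (1 - \<rho>)"
        using sAr \<rho> B by (intro frac_le mult_mono) auto
      finally show ?thesis
        using 0 by simp
    next
      case (Suc n')
      have "r * (l2norm N (W n t))\<^sup>2 \<le> energy (W n t)"
        by (rule energy_bounds[OF wn])
      also have "\<dots> \<le> (\<rho> / (1 - 1 * \<rho>))\<^sup>2 * energy (W n' (\<tau> n'))"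
        using t False unfolding Suc by (intro divided_diff_energy) auto
      also have "\<dots> \<le> (\<rho> / (1 - 1 * \<rho>))\<^sup>2 * ((\<kappa>\<^sup>2) ^ n' * (A * B\<^sup>2))"
        unfolding \<kappa>_def by (intro mult_left_mono divided_diff_energy_node) simp
      finally have "(l2norm N (W n t))\<^sup>2 \<le> ((\<rho> / (1 - 1 * \<rho>))\<^sup>2 * ((\<kappa>\<^sup>2) ^ n' * (A * B\<^sup>2))) / r"
        using r_pos by (simp only: pos_le_divide_eq mult.commute)
      also have "\<dots> = (\<rho> / (1 - \<rho>))\<^sup>2 * (\<kappa>\<^sup>2) ^ n' * B\<^sup>2 * (A / r)"
        by simp
      also have "A / r = (sqrt (A / r))\<^sup>2"
        using A_ge r_pos by simp
      also have "(\<rho> / (1 - \<rho>))\<^sup>2 * (\<kappa>\<^sup>2) ^ n' * B\<^sup>2 * (sqrt (A / r))\<^sup>2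
          = (sqrt (A / r) * B / (1 - \<rho>) * (\<rho> * \<kappa> ^ n'))\<^sup>2"
        by (simp add: power_mult_distrib power_divide power_mult[symmetric] mult.commute)
      finally have "l2norm N (W n t) \<le> sqrt (A / r) * B / (1 - \<rho>) * (\<rho> * \<kappa> ^ n')"
        by (rule power2_le_imp_le) (use sAr B \<rho> \<kappa> in auto)
      also have "\<dots> \<le> sqrt (A / r) * B / (1 - \<rho>) * (\<kappa> * \<kappa> ^ n')"
        using sAr B \<rho> \<kappa> by (intro mult_left_mono mult_right_mono) auto
      finally show ?thesis
        using Suc by simp
    qed
    moreover have "\<bar>poly (newton_poly \<tau> n) t\<bar> \<le> (1 + \<epsilon>) ^ n"
    proof -
      have "\<bar>t - \<tau> i\<bar> \<le> 1 + \<epsilon>" for i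
        using t \<tau>(2)[of i] by auto
      hence "(\<Prod>i<n. \<bar>t - \<tau> i\<bar>) \<le> (\<Prod>i<n. 1 + \<epsilon>)"
        by (intro prod_mono) auto
      thus ?thesis
        by (simp add: poly_newton_poly abs_prod)
    qed
    ultimately have "\<bar>poly (newton_poly \<tau> n) t\<bar> * l2norm N (W n t)
        \<le> (1 + \<epsilon>) ^ n * (sqrt (A / r) * B / (1 - \<rho>) * \<kappa> ^ n)"
      using \<epsilon> by (intro mult_mono) auto
    thus ?thesis
      unfolding eq l2norm_scaleR by (simp add: \<kappa>_def power_mult_distrib power_divide mult_ac)
  qed
qed

end

section \<open>Decay of the details and the residual estimate\<close>

lemma affine_coeff_update:
  assumes "m \<in> {1..M}"
  shows "affine_coeff M a x (y(m := t)) = affine_coeff M a x (y(m := 0)) + t * a m x"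
proof -
  have "(\<Sum>j=1..M. a j x * (y(m := s)) j) = a m x * s + (\<Sum>j\<in>{1..M} - {m}. a j x * y j)" for s
    using assms by (subst sum.remove[of _ m]) (auto intro!: sum.cong)
  thus ?thesis
    by (simp add: affine_coeff_def)
qed

text \<open>\<open>A\<close> bounds a_0, so ellipticity bounds the whole coefficient by 2 A. The
  hypothesis \<open>lebesgue\<close> is the form in which the growth of the operator norms is used;
  \<open>lebesgue_constant_le\<close> supplies it.\<close>

locale diffusion = nested_nodes z mm for z :: "nat \<Rightarrow> real" and mm +
  fixes M :: nat and D :: "(real^'d) set" and f :: "real^'d \<Rightarrow> real" and a :: "nat \<Rightarrow> real^'d \<Rightarrow> real"
    and r A :: real and u :: "(nat \<Rightarrow> real) \<Rightarrow> real^'d \<Rightarrow> real" and c \<theta> :: real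
  assumes M_pos: "1 \<le> M" and D_open: "open D" and D_bounded: "bounded D"
    and a_meas [measurable]: "m \<le> M \<Longrightarrow> a m \<in> borel_measurable (lebesgue_on D)"
    and a0_le: "AE x in lebesgue_on D. a 0 x \<le> A" and r_pos: "0 < r" and r_le_A: "r \<le> A"
    and elliptic: "AE x in lebesgue_on D. (\<Sum>m=1..M. \<bar>a m x\<bar>) \<le> a 0 x - r"
    and solution: "y \<in> Gam M \<Longrightarrow> weak_solution D (\<lambda>x. affine_coeff M a x y) f (u y)"
    and z_range: "range z \<subseteq> {-1..1}" and c_nonneg: "0 \<le> c" and \<theta>_nonneg: "0 \<le> \<theta>"
    and lebesgue: "t \<in> {-1..1} \<Longrightarrow> (\<Sum>i\<le>mm k. \<bar>poly (detail_poly k i) t\<bar>) \<le> (1 + c * real k) powr \<theta>"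
begin

abbreviation "N \<equiv> lebesgue_on D"

abbreviation "\<S> \<equiv> sparse_op z mm M"

definition U :: "(nat \<Rightarrow> real) \<Rightarrow> real^'d \<Rightarrow> real^'d" where "U y = wgrad D (u y)"

definition V :: "(real^'d \<Rightarrow> real^'d) set" where "V = {g. \<exists>v. H01_gradient D v g}"

lemma V_L2: "g \<in> V \<Longrightarrow> g \<in> L2 N"
  by (auto simp: V_def H01_gradient_def)

lemma V_diff:
  assumes "v \<in> V" "w \<in> V"
  shows "(\<lambda>x. (v x - w x) /\<^sub>R t) \<in> V"
proof -
  obtain v' w' where "H01_gradient D v' v" "H01_gradient D w' w"
    using assms by (auto simp: V_def)
  from H01_gradient_lincomb[OF D_open D_bounded this, of "inverse t" "- inverse t"]
  show ?thesis
    by (auto simp: V_def scaleR_right_diff_distrib)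
qed

lemma U_gradient: "y \<in> Gam M \<Longrightarrow> H01_gradient D (u y) (U y)"
  using solution[of y] H01_gradient_wgrad[OF D_open D_bounded]
  by (auto simp: weak_solution_def U_def)

lemma U_V: "y \<in> Gam M \<Longrightarrow> U y \<in> V"
  using U_gradient by (auto simp: V_def)

lemma U_L2: "y \<in> Gam M \<Longrightarrow> U y \<in> L2 N"
  by (intro V_L2 U_V)

lemma coeff_measurable [measurable]: "(\<lambda>x. affine_coeff M a x y) \<in> borel_measurable N"
  unfolding affine_coeff_def by measurable

lemma Gam_abs_le: "y \<in> Gam M \<Longrightarrow> m \<in> {1..M} \<Longrightarrow> \<bar>y m\<bar> \<le> 1"
  by (auto simp: Gam_def PiE_iff abs_le_iff)

lemma Gam_update: "y \<in> Gam M \<Longrightarrow> m \<in> {1..M} \<Longrightarrow> t \<in> {-1..1} \<Longrightarrow> y(m := t) \<in> Gam M"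
  by (auto simp: Gam_def PiE_iff extensional_def)

lemma coeff_a_bound: "m \<in> {1..M} \<Longrightarrow> AE x in N. \<bar>a m x\<bar> \<le> A"
  using elliptic a0_le
proof eventually_elim
  case (elim x)
  have "\<bar>a m x\<bar> \<le> (\<Sum>m=1..M. \<bar>a m x\<bar>)"
    using elim(1) by (intro member_le_sum) auto
  thus ?case
    using elim r_pos by linarith
qed

lemma coeff_bounds: "AE x in N. \<forall>y\<in>Gam M. r \<le> affine_coeff M a x y \<and> affine_coeff M a x y \<le> 2 * A"
  using elliptic a0_le
proof eventually_elim
  case (elim x)
  show ?case
  proof
    fix y assume y: "y \<in> Gam M"
    have "\<bar>\<Sum>m=1..M. a m x * y m\<bar> \<le> (\<Sum>m=1..M. \<bar>a m x\<bar> * 1)"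
      unfolding abs_mult[symmetric]
      by (rule order.trans[OF sum_abs sum_mono]) (auto simp: abs_mult intro!: mult_left_le Gam_abs_le[OF y])
    thus "r \<le> affine_coeff M a x y \<and> affine_coeff M a x y \<le> 2 * A"
      using elim r_pos by (auto simp: affine_coeff_def)
  qed
qed

lemma coeff_abs_bound: "y \<in> Gam M \<Longrightarrow> AE x in N. \<bar>affine_coeff M a x y\<bar> \<le> 2 * A"
  using coeff_bounds by (eventually_elim) (use r_pos in force)

lemma coeff_L2:
  fixes g :: "real^'d \<Rightarrow> 'b::euclidean_space"
  shows "y \<in> Gam M \<Longrightarrow> g \<in> L2 N \<Longrightarrow> (\<lambda>x. affine_coeff M a x y *\<^sub>R g x) \<in> L2 N"
  by (rule L2_bounded_mult[OF _ coeff_abs_bound]) auto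

text \<open>Both sides are the load applied to a function with gradient g. As g is an arbitrary
  representative, it is first exchanged for \<open>wgrad\<close> almost everywhere.\<close>

lemma weak_equation:
  assumes y: "y \<in> Gam M" "y' \<in> Gam M" and g: "g \<in> V"
  shows "(LINT x|N. affine_coeff M a x y * (U y x \<bullet> g x)) = (LINT x|N. affine_coeff M a x y' * (U y' x \<bullet> g x))"
proof -
  obtain v where v: "H01_gradient D v g"
    using g by (auto simp: V_def)
  have vH: "v \<in> H01 D"
    using H01_gradient_imp_H01[OF D_open D_bounded v] .
  note wv = H01_gradient_wgrad[OF D_open D_bounded vH]
  have "(LINT x|N. affine_coeff M a x y * (U y x \<bullet> g x)) = (LINT x|N. f x * v x)" if y: "y \<in> Gam M" for y
  proof -
    note [measurable] = L2_measurable[OF U_L2[OF y]]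
      L2_measurable[OF V_L2[OF g]]
      L2_measurable[OF H01_gradient_L2[OF wv]]
    have "(LINT x|N. affine_coeff M a x y * (U y x \<bullet> g x)) = (LINT x|N. affine_coeff M a x y * (U y x \<bullet> wgrad D v x))"
    proof (rule integral_cong_AE)
      show "AE x in N. affine_coeff M a x y * (U y x \<bullet> g x) = affine_coeff M a x y * (U y x \<bullet> wgrad D v x)"
        using H01_gradient_unique[OF D_open D_bounded v wv] by eventually_elim simp
    qed measurable
    also have "\<dots> = (LINT x|N. f x * v x)"
      using solution[OF y] vH by (simp add: weak_solution_def U_def)
    finally show ?thesis .
  qed
  thus ?thesis
    using y by simp
qed

lemma coercive:
  fixes g :: "real^'d \<Rightarrow> real^'d"
  assumes y: "y \<in> Gam M" and g: "g \<in> L2 N"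
  shows "r * (l2norm N g)\<^sup>2 \<le> (LINT x|N. affine_coeff M a x y * (g x \<bullet> g x))"
proof -
  have i: "integrable N (\<lambda>x. g x \<bullet> g x)"
    using g by (intro integrable_inner_L2)
  have "(LINT x|N. r * (g x \<bullet> g x)) \<le> (LINT x|N. affine_coeff M a x y * (g x \<bullet> g x))"
  proof (rule integral_mono_AE)
    show "integrable N (\<lambda>x. affine_coeff M a x y * (g x \<bullet> g x))"
      using integrable_inner_L2[OF coeff_L2[OF y g] g] by simp
    show "AE x in N. r * (g x \<bullet> g x) \<le> affine_coeff M a x y * (g x \<bullet> g x)"
      using coeff_bounds by eventually_elim (use y in \<open>auto intro!: mult_right_mono\<close>)
  qed (use i in auto)
  thus ?thesis
    using i by (simp add: l2norm_power2 power2_norm_eq_inner)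
qed

lemma coercive_dual:
  fixes g h :: "real^'d \<Rightarrow> real^'d"
  assumes y: "y \<in> Gam M" and g: "g \<in> L2 N" and h: "h \<in> L2 N"
    and eq: "(LINT x|N. affine_coeff M a x y * (g x \<bullet> g x)) = (LINT x|N. h x \<bullet> g x)"
  shows "r * l2norm N g \<le> l2norm N h"
proof (cases "l2norm N g = 0")
  case False
  hence pos: "0 < l2norm N g"
    using l2norm_nonneg[of N g] by linarith
  have "(r * l2norm N g) * l2norm N g \<le> (LINT x|N. h x \<bullet> g x)"
    using coercive[OF y g] eq by (simp add: power2_eq_square mult.assoc)
  also have "\<dots> \<le> l2norm N h * l2norm N g"
    using l2norm_Cauchy_Schwarz[OF h g] by linarith
  finally show ?thesis
    using pos by simp
qed simp

definition U_bound :: real where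
  "U_bound = 2 * A / r * l2norm N (U (\<lambda>m\<in>{1..M}. 0))"

text \<open>Tested with \<open>U y\<close> itself, the load is expressed by the flux at the centre
  \<open>y0\<close> of the parameter domain, which makes the bound uniform in y and keeps it in
  terms of gradients.\<close>

lemma l2norm_U_le:
  assumes y: "y \<in> Gam M"
  shows "l2norm N (U y) \<le> U_bound"
proof -
  define y0 where "y0 = (\<lambda>m\<in>{1..M}. 0 :: real)"
  have y0: "y0 \<in> Gam M"
    by (auto simp: y0_def Gam_def)
  have "r * l2norm N (U y) \<le> l2norm N (\<lambda>x. affine_coeff M a x y0 *\<^sub>R U y0 x)"
    using weak_equation[OF y y0 U_V[OF y]]
    by (intro coercive_dual[OF y] U_L2 y coeff_L2 y0) simp_all
  also have "\<dots> \<le> 2 * A * l2norm N (U y0)"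
    using r_pos r_le_A by (intro l2norm_bounded_mult coeff_abs_bound U_L2 y0) auto
  finally show ?thesis
    using r_pos by (simp add: U_bound_def y0_def field_simps)
qed

text \<open>If b is the coefficient at y_m = 0, ellipticity gives |a_m| \<le> b - r, and b \<le> 2 A
  turns this into |a_m| \<le> (1 - r / (2 A)) b.\<close>

definition rho :: real where "rho = 1 - r / (2 * A)"

text \<open>The condition \<open>rate < 1\<close> amounts to 2 eps rho < 1 - rho, which this choice
  satisfies.\<close>

definition eps :: real where "eps = (1 - rho) / 4"

definition rate :: real where "rate = (1 + eps) * rho / (1 - eps * rho)"

definition nodes0 :: "nat \<Rightarrow> real" where "nodes0 n = eps / real (Suc n)"

definition approx_const :: real where "approx_const = sqrt (2 * A / r) * U_bound / (1 - rho)"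

lemma rho_bounds: "0 < rho" "rho < 1" "0 < eps" "eps < 1"
proof -
  show "0 < rho" "rho < 1"
    using r_pos r_le_A by (auto simp: rho_def field_simps)
  thus "0 < eps" "eps < 1"
    by (auto simp: eps_def)
qed

lemma rate_bounds: "0 < rate" "rate < 1"
proof -
  have "eps * rho < 1 * 1"
    using rho_bounds by (intro mult_strict_mono) auto
  moreover have "eps * rho \<le> eps * 1"
    using rho_bounds by (intro mult_left_mono) auto
  moreover have "4 * eps = 1 - rho"
    by (simp add: eps_def)
  ultimately have "rho + eps * rho < 1 - eps * rho"
    using rho_bounds(2) by linarith
  hence "(1 + eps) * rho < 1 - eps * rho"
    by (simp add: distrib_right)
  moreover have "0 < 1 - eps * rho"
    using \<open>eps * rho < 1 * 1\<close> by linarith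
  ultimately show "0 < rate" "rate < 1"
    using rho_bounds by (auto simp: rate_def)
qed

lemma nodes0: "inj nodes0" "\<bar>nodes0 n\<bar> \<le> eps"
  using rho_bounds by (auto simp: nodes0_def inj_def field_simps)

lemma elliptic_family_direction:
  assumes y: "y \<in> Gam M" and m: "m \<in> {1..M}"
  shows "elliptic_family N (\<lambda>x. affine_coeff M a x (y(m := 0))) (a m) r (2 * A) rho"
proof
  have y0: "y(m := 0) \<in> Gam M"
    using y m by (intro Gam_update) auto
  show "r \<le> 2 * A"
    using r_pos r_le_A by linarith
  show "AE x in N. r \<le> affine_coeff M a x (y(m := 0))" "AE x in N. affine_coeff M a x (y(m := 0)) \<le> 2 * A"
    using coeff_bounds by (eventually_elim, use y0 in blast)+
  show "AE x in N. \<bar>a m x\<bar> \<le> rho * affine_coeff M a x (y(m := 0))"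
    using coeff_bounds
  proof eventually_elim
    case (elim x)
    let ?b = "affine_coeff M a x (y(m := 0))"
    \<comment> \<open>The lower bound r at both end points of the segment controls a_m with either
      sign.\<close>
    have "y(m := 1) \<in> Gam M" "y(m := -1) \<in> Gam M"
      using y m by (auto intro!: Gam_update)
    hence "r \<le> ?b + 1 * a m x" "r \<le> ?b + (- 1) * a m x" "?b \<le> 2 * A"
      unfolding affine_coeff_update[OF m, symmetric] using elim y0 by blast+
    hence "\<bar>a m x\<bar> \<le> ?b - r" "?b \<le> 2 * A"
      by auto
    moreover have "r / (2 * A) * ?b \<le> r"
      using calculation(2) r_pos r_le_A by (simp add: field_simps)
    ultimately show ?case
      by (simp add: rho_def left_diff_distrib)
  qed
qed (use r_pos rho_bounds m in auto)

text \<open>Newton interpolation in direction m with degree below n. Its coefficients do not depend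
  on \<open>y m\<close>, so it is a polynomial in that variable.\<close>

definition newton_part :: "nat \<Rightarrow> nat \<Rightarrow> (nat \<Rightarrow> real) \<Rightarrow> real^'d \<Rightarrow> real^'d" where
  "newton_part m n y x = (\<Sum>j<n. poly (newton_poly nodes0 j) (y m) *\<^sub>R
     divided_diff nodes0 (\<lambda>t. U (y(m := t)) x) j (nodes0 j))"

lemma newton_part:
  assumes y: "y \<in> Gam M" and m: "m \<in> {1..M}"
  shows "newton_part m n y \<in> L2 N"
    and "l2norm N (\<lambda>x. U y x - newton_part m n y x) \<le> approx_const * rate ^ n"
proof -
  interpret elliptic_family N "\<lambda>x. affine_coeff M a x (y(m := 0))" "a m" r "2 * A" rho
    by (rule elliptic_family_direction[OF y m])
  let ?w = "\<lambda>t. U (y(m := t))" and ?L = "\<lambda>g. LINT x|N. affine_coeff M a x y * (U y x \<bullet> g x)"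
  have G: "y(m := t) \<in> Gam M" if "t \<in> {-1..1}" for t
    using y m that by (rule Gam_update)
  interpret elliptic_trajectory N "\<lambda>x. affine_coeff M a x (y(m := 0))" "a m" r "2 * A" rho
    V ?w ?L nodes0 eps U_bound
  proof
    show "(LINT x|N. (affine_coeff M a x (y(m := 0)) + t * a m x) * (?w t x \<bullet> g x)) = ?L g"
      if "t \<in> {-1..1}" "g \<in> V" for t g
      unfolding affine_coeff_update[OF m, symmetric] by (intro weak_equation G that y)
  qed (use V_L2 V_diff U_V l2norm_U_le G nodes0 rho_bounds in auto)
  have dd: "(\<lambda>x. divided_diff nodes0 (\<lambda>t. ?w t x) j (nodes0 j)) \<in> L2 N" for j
    by (intro V_L2 divided_diff_mem node_mem)
  show "newton_part m n y \<in> L2 N"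
    unfolding newton_part_def[abs_def] by (rule L2_sum, rule L2_scaleR, rule dd)
  have "y m \<in> {-1..1}"
    using Gam_abs_le[OF y m] by auto
  from newton_approximation[OF this, of n]
  show "l2norm N (\<lambda>x. U y x - newton_part m n y x) \<le> approx_const * rate ^ n"
    by (simp only: newton_part_def approx_const_def rate_def fun_upd_triv)
qed

abbreviation "lam k \<equiv> (1 + c * real k) powr \<theta>"

lemma lam_mono: "k \<le> l \<Longrightarrow> lam k \<le> lam l"
  using c_nonneg \<theta>_nonneg by (intro powr_mono2) (auto intro: mult_left_mono)

text \<open>For level l = i m > 0 the degree is at most l - 1 \<le> mm (l - 1), so both interpolants
  in direction m reproduce the polynomial. For level 0 the sum is empty.\<close>

lemma detail_newton_part:
  "m \<in> {1..M} \<Longrightarrow> \<Delta> M i (\<lambda>y. newton_part m (i m) y x) = (\<lambda>y. 0)"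
proof (rule tensor_detail_eq_zero)
  show "detail_dir z mm m (i m) (\<lambda>y. newton_part m (i m) y x) = (\<lambda>y. 0)"
  proof
    fix y
    have deg: "degree (newton_poly nodes0 j) \<le> mm (i m - 1)" if "j < i m" for j
      using degree_newton_poly[of nodes0 j] strict_mono_imp_increasing[OF strict_mono_mm, of "i m - 1"] that by linarith
    show "detail_dir z mm m (i m) (\<lambda>y. newton_part m (i m) y x) y = 0"
    proof (cases "i m = 0")
      case True
      thus ?thesis
        by (simp add: newton_part_def detail_dir_zero)
    next
      case False
      thus ?thesis
        unfolding detail_dir_def newton_part_def using deg
        by simp (rule detail_vanishes_poly, auto)
    qed
  qed
qed

text \<open>Subtracting the Newton part leaves the detail unchanged but makes the function small
  before the operator bound is applied.\<close>

lemma detail_U_decay_direction: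
  assumes y: "y \<in> Gam M" and m: "m \<in> {1..M}"
  shows "l2norm N (\<lambda>x. \<Delta> M i (\<lambda>y. U y x) y) \<le> (\<Prod>m=1..M. lam (i m)) * (approx_const * rate ^ i m)"
proof -
  have "\<Delta> M i (\<lambda>y. U y x - newton_part m (i m) y x) y = \<Delta> M i (\<lambda>y. U y x) y" for x
  proof -
    have "\<Delta> M i (\<lambda>y. U y x) y
        = \<Delta> M i (\<lambda>y. (U y x - newton_part m (i m) y x) + newton_part m (i m) y x) y"
      by simp
    thus ?thesis
      by (simp only: tensor_detail_add detail_newton_part[OF m]) simp
  qed
  moreover have "l2norm N (\<lambda>x. \<Delta> M i (\<lambda>y. U y x - newton_part m (i m) y x) y)
      \<le> (\<Prod>m=1..M. lam (i m)) * (approx_const * rate ^ i m)"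
    by (intro l2norm_tensor_detail_le lebesgue z_range y newton_part m L2_diff U_L2)
  ultimately show ?thesis
    by simp
qed

definition sig :: real where "sig = root M rate"

lemma sig: "0 < sig" "sig < 1" "sig ^ M = rate"
  using M_pos rate_bounds by (auto simp: sig_def real_root_pow_pos)

lemma approx_const_nonneg: "0 \<le> approx_const"
proof -
  have "(\<lambda>m\<in>{1..M}. 0) \<in> Gam M"
    by (auto simp: Gam_def)
  hence "0 \<le> U_bound"
    using l2norm_U_le l2norm_nonneg order.trans by blast
  thus ?thesis
    using r_pos r_le_A rho_bounds by (auto simp: approx_const_def)
qed

text \<open>The bounds for all M directions hold at the same time. Their product bounds the M-th
  power of the norm, and since \<open>sig ^ M = rate\<close> its M-th root is a product over the
  directions.\<close>

lemma detail_U_decay: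
  assumes y: "y \<in> Gam M"
  shows "l2norm N (\<lambda>x. \<Delta> M i (\<lambda>y. U y x) y) \<le> approx_const * (\<Prod>m=1..M. lam (i m) * sig ^ i m)"
proof -
  let ?X = "l2norm N (\<lambda>x. \<Delta> M i (\<lambda>y. U y x) y)" and ?K = "(\<Prod>m=1..M. lam (i m)) * approx_const"
  have K: "0 \<le> ?K"
    using approx_const_nonneg by (intro mult_nonneg_nonneg prod_nonneg) auto
  have "?X ^ card {1..M} = (\<Prod>m=1..M. ?X)"
    by simp
  also have "\<dots> \<le> (\<Prod>m=1..M. ?K * rate ^ i m)"
    using detail_U_decay_direction[OF y] by (intro prod_mono) (auto simp: mult.assoc)
  also have "\<dots> = (?K * (\<Prod>m=1..M. sig ^ i m)) ^ M"
    unfolding sig(3)[symmetric] by (simp add: prod.distrib power_mult_distrib prod_power_distrib mult.commute flip: power_mult)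
  finally have "?X ^ Suc (M - 1) \<le> (?K * (\<Prod>m=1..M. sig ^ i m)) ^ Suc (M - 1)"
    using M_pos by simp
  hence "?X \<le> ?K * (\<Prod>m=1..M. sig ^ i m)"
    using K sig by (intro power_le_imp_le_base[of ?X "M - 1"]) (auto intro!: mult_nonneg_nonneg prod_nonneg)
  thus ?thesis
    by (simp add: prod.distrib mult_ac)
qed

text \<open>One factor \<open>lam\<close> comes from the decay of the detail of U, the other from
  the outer operator of index k. Division by \<open>sig\<close> accounts for the inner index k -
  e_m, and \<open>M * A\<close> for at most M directions with |a_m| \<le> A.\<close>

definition majorant :: "(nat \<Rightarrow> nat) \<Rightarrow> real" where
  "majorant k = real M * A * approx_const / sig * (\<Prod>m=1..M. (lam (k m))\<^sup>2 * sig ^ k m)"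

definition residual_part :: "(nat \<Rightarrow> nat) set \<Rightarrow> (nat \<Rightarrow> nat) \<Rightarrow> (nat \<Rightarrow> real) \<Rightarrow> real^'d \<Rightarrow> real^'d" where
  "residual_part \<Lambda> k y x = \<Delta> M k (\<lambda>y. affine_coeff M a x y *\<^sub>R \<S> \<Lambda> U y x) y"

lemma affine_coeff_affine: "affine_coeff M a x y = affine_fun M (\<lambda>m. a m x) y"
  by (simp add: affine_coeff_def affine_fun_def)

lemma sparse_op_U: "\<S> \<Lambda> U y x = (\<Sum>i\<in>\<Lambda>. \<Delta> M i (\<lambda>y. U y x) y)"
  by (simp add: sparse_op_def tensor_detail_fun_def)

lemma l2norm_shifted_detail:
  assumes y: "y \<in> Gam M" and m: "m \<in> {1..M}" and k: "k m \<noteq> 0"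
  shows "(\<lambda>x. \<Delta> M k (mult_var m (\<Delta> M (level_down m k) (\<lambda>y. U y x))) y) \<in> L2 N"
    and "l2norm N (\<lambda>x. \<Delta> M k (mult_var m (\<Delta> M (level_down m k) (\<lambda>y. U y x))) y)
      \<le> approx_const / sig * (\<Prod>m=1..M. (lam (k m))\<^sup>2 * sig ^ k m)"
proof -
  let ?i = "level_down m k"
  let ?G = "\<lambda>y x. mult_var m (\<Delta> M ?i (\<lambda>y. U y x)) y"
  have G: "?G y \<in> L2 N" if "y \<in> Gam M" for y
    unfolding mult_var_def
    by (intro L2_scaleR tensor_detail_L2 z_range that U_L2)
  have "l2norm N (?G y) \<le> approx_const / sig * (\<Prod>m=1..M. lam (k m) * sig ^ k m)" if y: "y \<in> Gam M" for y
  proof -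
    have "l2norm N (?G y) \<le> 1 * l2norm N (\<lambda>x. \<Delta> M ?i (\<lambda>y. U y x) y)"
      unfolding mult_var_def l2norm_scaleR by (intro mult_right_mono Gam_abs_le y m) simp
    also have "\<dots> \<le> 1 * (approx_const * (\<Prod>j=1..M. lam (?i j) * sig ^ ?i j))"
      by (intro mult_left_mono detail_U_decay y) simp
    \<comment> \<open>Passing from k - e_m to k costs exactly one factor \<open>sig\<close>, while
      \<open>lam\<close> can only increase.\<close>
    also have "(\<Prod>j=1..M. lam (?i j) * sig ^ ?i j) \<le> (\<Prod>j=1..M. lam (k j) * sig ^ k j) / sig"
    proof -
      have "(\<Prod>j=1..M. sig ^ ?i j) * sig = (\<Prod>j=1..M. sig ^ k j)"
      proof -
        obtain l where l: "k m = Suc l"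
          using k by (cases "k m") auto
        have rem: "(\<Prod>j=1..M. F j) = F m * (\<Prod>j\<in>{1..M} - {m}. F j)" for F :: "nat \<Rightarrow> real"
          using m by (intro prod.remove) auto
        have "(\<Prod>j\<in>{1..M} - {m}. sig ^ ?i j) = (\<Prod>j\<in>{1..M} - {m}. sig ^ k j)"
          by (intro prod.cong) (auto simp: level_down_def)
        thus ?thesis
          by (simp only: rem) (simp add: level_down_def l)
      qed
      hence "(\<Prod>j=1..M. sig ^ ?i j) = (\<Prod>j=1..M. sig ^ k j) / sig"
        using sig by (simp add: field_simps)
      moreover have "(\<Prod>j=1..M. lam (?i j)) \<le> (\<Prod>j=1..M. lam (k j))"
        by (intro prod_mono conjI lam_mono) (auto simp: level_down_def)
      ultimately show ?thesis
        using sig by (simp add: prod.distrib) (intro divide_right_mono mult_right_mono prod_nonneg, auto)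
    qed
    finally show ?thesis
      using approx_const_nonneg by (simp add: mult_left_mono)
  qed
  note bd = this
  show "(\<lambda>x. \<Delta> M k (mult_var m (\<Delta> M ?i (\<lambda>y. U y x))) y) \<in> L2 N"
    by (rule tensor_detail_L2[OF z_range y G])
  have "l2norm N (\<lambda>x. \<Delta> M k (\<lambda>y. ?G y x) y)
      \<le> (\<Prod>m=1..M. lam (k m)) * (approx_const / sig * (\<Prod>m=1..M. lam (k m) * sig ^ k m))"
    by (intro l2norm_tensor_detail_le lebesgue z_range y G bd)
  also have "\<dots> = approx_const / sig * (\<Prod>m=1..M. (lam (k m))\<^sup>2 * sig ^ k m)"
    by (simp add: prod.distrib power2_eq_square mult_ac)
  finally show "l2norm N (\<lambda>x. \<Delta> M k (mult_var m (\<Delta> M ?i (\<lambda>y. U y x))) y)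
      \<le> approx_const / sig * (\<Prod>m=1..M. (lam (k m))\<^sup>2 * sig ^ k m)" .
qed

lemma sparse_op_U_L2: "y \<in> Gam M \<Longrightarrow> \<S> \<Lambda> U y \<in> L2 N"
  unfolding sparse_op_U[abs_def]
  by (intro L2_sum tensor_detail_L2 z_range U_L2)

lemma residual_part_L2: "y \<in> Gam M \<Longrightarrow> residual_part \<Lambda> k y \<in> L2 N"
  unfolding residual_part_def
  by (intro tensor_detail_L2 z_range coeff_L2 sparse_op_U_L2)

text \<open>By \<open>tensor_detail_affine_sparse_margin\<close> there is at most one summand per
  direction, each a shifted detail of the exact gradient.\<close>

lemma residual_part_le_majorant:
  assumes \<Lambda>: "finite \<Lambda>" "monotone_set M \<Lambda>" and k: "k \<in> Marg M \<Lambda>" and y: "y \<in> Gam M"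
  shows "l2norm N (residual_part \<Lambda> k y) \<le> majorant k"
proof -
  define I where "I = {m. m \<in> {1..M} \<and> k m \<noteq> 0 \<and> level_down m k \<in> \<Lambda>}"
  define T where "T m x = \<Delta> M k (mult_var m (\<Delta> M (level_down m k) (\<lambda>y. U y x))) y" for m x
  define P where "P = approx_const / sig * (\<Prod>m=1..M. (lam (k m))\<^sup>2 * sig ^ k m)"
  have P: "0 \<le> P"
    using approx_const_nonneg sig unfolding P_def by (intro mult_nonneg_nonneg divide_nonneg_nonneg prod_nonneg) auto
  have k': "k \<in> multi_indices M" "k \<notin> \<Lambda>"
    using k by (auto simp: Marg_def)
  have eq: "residual_part \<Lambda> k y = (\<lambda>x. \<Sum>m\<in>I. a m x *\<^sub>R T m x)"
    unfolding residual_part_def sparse_op_U affine_coeff_affine I_def T_def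
    by (intro ext tensor_detail_affine_sparse_margin \<Lambda> k')
  have T: "T m \<in> L2 N" "l2norm N (T m) \<le> P" if "m \<in> I" for m
    using that l2norm_shifted_detail[OF y, of m k] by (auto simp: I_def T_def[abs_def] P_def)
  have aT: "(\<lambda>x. a m x *\<^sub>R T m x) \<in> L2 N" if "m \<in> I" for m
    using that coeff_a_bound by (intro L2_bounded_mult T) (auto simp: I_def intro: a_meas)
  have "l2norm N (residual_part \<Lambda> k y) \<le> (\<Sum>m\<in>I. l2norm N (\<lambda>x. a m x *\<^sub>R T m x))"
    unfolding eq by (intro l2norm_sum aT)
  also have "\<dots> \<le> (\<Sum>m\<in>I. A * P)"
  proof (rule sum_mono)
    fix m assume m: "m \<in> I"
    hence m': "m \<in> {1..M}"
      by (simp add: I_def)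
    have "l2norm N (\<lambda>x. a m x *\<^sub>R T m x) \<le> A * l2norm N (T m)"
      using m' r_pos r_le_A by (intro l2norm_bounded_mult coeff_a_bound T m a_meas) auto
    also have "\<dots> \<le> A * P"
      using r_pos r_le_A by (intro mult_left_mono T m) auto
    finally show "l2norm N (\<lambda>x. a m x *\<^sub>R T m x) \<le> A * P" .
  qed
  also have "\<dots> = real (card I) * (A * P)"
    by simp
  also have "\<dots> \<le> real M * (A * P)"
  proof (intro mult_right_mono)
    have "card I \<le> card {1..M}"
      by (intro card_mono) (auto simp: I_def)
    thus "real (card I) \<le> real M"
      by simp
    show "0 \<le> A * P"
      using r_pos r_le_A P by simp
  qed
  finally show ?thesis
    by (simp add: majorant_def P_def)
qed

text \<open>Tested with e, the flux of the exact solution is constant in y, being the load. Details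
  of nonzero index annihilate constants, so only the index 0 contributes.\<close>

lemma detail_orthogonality:
  assumes y: "y \<in> Gam M" and e: "e \<in> V" and \<Lambda>: "finite \<Lambda>" "(\<lambda>_. 0) \<in> \<Lambda>" "\<Lambda> \<subseteq> multi_indices M"
  shows "(LINT x|N. (\<Sum>k\<in>\<Lambda>. \<Delta> M k (\<lambda>y. affine_coeff M a x y *\<^sub>R U y x) y) \<bullet> e x)
     = (LINT x|N. affine_coeff M a x y * (U y x \<bullet> e x))"
proof -
  define L where "L = (LINT x|N. affine_coeff M a x y * (U y x \<bullet> e x))"
  note aU = coeff_L2[OF _ U_L2]
  have "(LINT x|N. \<Delta> M k (\<lambda>y. affine_coeff M a x y *\<^sub>R U y x) y \<bullet> e x)
      = (if k = (\<lambda>_. 0) then L else 0)" if k: "k \<in> \<Lambda>" for k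
  proof -
    have "(LINT x|N. \<Delta> M k (\<lambda>y. affine_coeff M a x y *\<^sub>R U y x) y \<bullet> e x)
        = \<Delta> M k (\<lambda>y. LINT x|N. (affine_coeff M a x y *\<^sub>R U y x) \<bullet> e x) y"
      by (intro integral_inner_tensor_detail z_range y aU V_L2 e)
    also have "\<dots> = \<Delta> M k (\<lambda>y. L) y"
      unfolding L_def using weak_equation[OF _ y e]
      by (intro tensor_detail_cong_Gam z_range y) simp
    also have "\<dots> = (if k = (\<lambda>_. 0) then L else 0)"
    proof -
      have "(\<forall>m\<in>{1..M}. k m = 0) \<longleftrightarrow> k = (\<lambda>_. 0)"
        using k \<Lambda>(3) by (fastforce simp: multi_indices_def fun_eq_iff)
      thus ?thesis
        by (simp add: tensor_detail_const)
    qed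
    finally show ?thesis .
  qed
  moreover have "(LINT x|N. (\<Sum>k\<in>\<Lambda>. \<Delta> M k (\<lambda>y. affine_coeff M a x y *\<^sub>R U y x) y) \<bullet> e x)
      = (\<Sum>k\<in>\<Lambda>. LINT x|N. \<Delta> M k (\<lambda>y. affine_coeff M a x y *\<^sub>R U y x) y \<bullet> e x)"
    unfolding inner_sum_left
    by (intro Bochner_Integration.integral_sum integrable_inner_L2 tensor_detail_L2
        z_range y aU V_L2 e)
  ultimately show ?thesis
    using \<Lambda> by (simp add: L_def)
qed

lemma sparse_op_gradient:
  assumes y: "y \<in> Gam M"
  shows "H01_gradient D (\<S> \<Lambda> u y) (\<S> \<Lambda> U y)"
proof -
  have inner: "H01_gradient D (\<lambda>x. \<Delta> M i (\<lambda>y. u y x) y) (\<lambda>x. \<Delta> M i (\<lambda>y. U y x) y)" for i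
    unfolding tensor_detail_formula real_scaleR_def
    by (intro H01_gradient_sum D_open D_bounded U_gradient node_in_Gam z_range y)
  have "H01_gradient D (\<lambda>x. \<Sum>i\<in>\<Lambda>. 1 * \<Delta> M i (\<lambda>y. u y x) y)
      (\<lambda>x. \<Sum>i\<in>\<Lambda>. 1 *\<^sub>R \<Delta> M i (\<lambda>y. U y x) y)"
    by (intro H01_gradient_sum D_open D_bounded inner)
  thus ?thesis
    by (simp add: sparse_op_def[abs_def] tensor_detail_fun_def)
qed

text \<open>The flux of the sparse gradient is P + R, with P over \<open>\<Lambda>\<close> and R
  over the margin. Tested with the error e, P equals the exact flux, so the weighted square of e
  reduces to -R tested with e, and coercivity applies.\<close>

lemma residual_estimate:
  assumes \<Lambda>: "finite \<Lambda>" "monotone_set M \<Lambda>" "(\<lambda>_. 0) \<in> \<Lambda>" and y: "y \<in> Gam M"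
  shows "r * l2norm N (\<lambda>x. U y x - \<S> \<Lambda> U y x) \<le> (\<Sum>k\<in>Marg M \<Lambda>. l2norm N (residual_part \<Lambda> k y))"
proof -
  define S where "S = \<S> \<Lambda> U"
  define e where "e x = U y x - S y x" for x
  define P where "P x = (\<Sum>k\<in>\<Lambda>. \<Delta> M k (\<lambda>y. affine_coeff M a x y *\<^sub>R U y x) y)" for x
  define R where "R x = (\<Sum>k\<in>Marg M \<Lambda>. residual_part \<Lambda> k y x)" for x
  have \<Lambda>m: "\<Lambda> \<subseteq> multi_indices M"
    using \<Lambda>(2) by (simp add: monotone_set_def)
  have SV: "S y \<in> V"
    using sparse_op_gradient[OF y] by (auto simp: V_def S_def)
  have eV: "e \<in> V"
    using V_diff[OF U_V[OF y] SV, of 1] by (simp add: e_def[abs_def])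
  note sq = V_L2[OF eV] V_L2[OF SV] U_L2[OF y]
  have R: "R \<in> L2 N"
    unfolding R_def[abs_def] by (intro L2_sum residual_part_L2 y)
  have P: "P \<in> L2 N"
    unfolding P_def[abs_def]
    by (intro L2_sum tensor_detail_L2 z_range y coeff_L2 U_L2)
  have decomp: "affine_coeff M a x y *\<^sub>R S y x = P x + R x" for x
    unfolding S_def P_def R_def residual_part_def sparse_op_U affine_coeff_affine
    by (rule affine_sparse_decomp[OF \<Lambda>(1,2)])
  have "(LINT x|N. affine_coeff M a x y * (e x \<bullet> e x))
      = (LINT x|N. affine_coeff M a x y * (U y x \<bullet> e x) - (P x \<bullet> e x + R x \<bullet> e x))"
  proof (rule Bochner_Integration.integral_cong[OF refl])
    fix x
    have "affine_coeff M a x y * (S y x \<bullet> e x) = (P x + R x) \<bullet> e x"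
      unfolding decomp[symmetric] by simp
    thus "affine_coeff M a x y * (e x \<bullet> e x) = affine_coeff M a x y * (U y x \<bullet> e x) - (P x \<bullet> e x + R x \<bullet> e x)"
      unfolding inner_add_left by (simp add: e_def inner_diff_left right_diff_distrib)
  qed
  also have "\<dots> = (LINT x|N. affine_coeff M a x y * (U y x \<bullet> e x)) - ((LINT x|N. P x \<bullet> e x) + (LINT x|N. R x \<bullet> e x))"
    using integrable_inner_L2[OF P sq(1)] integrable_inner_L2[OF R sq(1)]
      integrable_inner_L2[OF coeff_L2[OF y sq(3)] sq(1)] by simp
  also have "(LINT x|N. P x \<bullet> e x) = (LINT x|N. affine_coeff M a x y * (U y x \<bullet> e x))"
    unfolding P_def by (intro detail_orthogonality y eV \<Lambda> \<Lambda>m)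
  finally have "(LINT x|N. affine_coeff M a x y * (e x \<bullet> e x)) = (LINT x|N. (- 1 *\<^sub>R R x) \<bullet> e x)"
    by simp
  hence "r * l2norm N e \<le> l2norm N (\<lambda>x. - 1 *\<^sub>R R x)"
    by (intro coercive_dual[OF y] sq L2_scaleR R)
  also have "\<dots> = l2norm N R"
    unfolding l2norm_scaleR by simp
  also have "\<dots> \<le> (\<Sum>k\<in>Marg M \<Lambda>. l2norm N (residual_part \<Lambda> k y))"
    unfolding R_def[abs_def] by (intro l2norm_sum residual_part_L2 y)
  finally show ?thesis
    by (simp add: e_def[abs_def] S_def)
qed

lemma H01_norm_error:
  assumes y: "y \<in> Gam M"
  shows "H01_norm D (\<lambda>x. u y x - \<S> \<Lambda> u y x)
     = ennreal (l2norm N (\<lambda>x. U y x - \<S> \<Lambda> U y x))"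
proof -
  have g: "H01_gradient D (\<lambda>x. u y x - \<S> \<Lambda> u y x) (\<lambda>x. U y x - \<S> \<Lambda> U y x)"
    using H01_gradient_lincomb[OF D_open D_bounded U_gradient[OF y] sparse_op_gradient[OF y], of 1 "- 1"] by simp
  note w = H01_gradient_wgrad[OF D_open D_bounded H01_gradient_imp_H01[OF D_open D_bounded g]]
  have "l2norm N (wgrad D (\<lambda>x. u y x - \<S> \<Lambda> u y x))
      = l2norm N (\<lambda>x. U y x - \<S> \<Lambda> U y x)"
    by (intro l2norm_cong_AE L2_measurable H01_gradient_L2[OF w]
        H01_gradient_L2[OF g] H01_gradient_unique[OF D_open D_bounded w g])
  thus ?thesis
    using H01_gradient_L2[OF w] by (simp add: H01_norm_def L2_norm_on_eq)
qed

text \<open>For each y \<open>wgrad\<close> selects some representative, equal to the sparse sum of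
  gradients only for almost every x. A detail uses finitely many nodes, so one null set serves all
  of them.\<close>

lemma L2_norm_residual:
  assumes y: "y \<in> Gam M"
  shows "L2_norm_on D (tensor_detail_fun z mm M k
      (\<lambda>y x. affine_coeff M a x y *\<^sub>R wgrad D (\<S> \<Lambda> u y) x) y)
    = ennreal (l2norm N (residual_part \<Lambda> k y))"
proof -
  let ?w = "\<lambda>y. wgrad D (\<S> \<Lambda> u y)"
  let ?T = "tensor_detail_fun z mm M k (\<lambda>y x. affine_coeff M a x y *\<^sub>R ?w y x) y"
  have w: "H01_gradient D (\<S> \<Lambda> u y) (?w y)" if "y \<in> Gam M" for y
    by (intro H01_gradient_wgrad D_open D_bounded H01_gradient_imp_H01[OF D_open D_bounded sparse_op_gradient[OF that]])
  have T: "?T \<in> L2 N"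
    unfolding tensor_detail_fun_def[abs_def]
    by (intro tensor_detail_L2 z_range y coeff_L2 H01_gradient_L2[OF w])
  have "AE x in N. \<forall>\<nu>\<in>node_indices M k. ?w (node M \<nu> y) x = \<S> \<Lambda> U (node M \<nu> y) x"
    by (intro AE_finite_allI finite_node_indices H01_gradient_unique[OF D_open D_bounded w sparse_op_gradient]
        node_in_Gam z_range y)
  hence "AE x in N. ?T x = residual_part \<Lambda> k y x"
    by eventually_elim (simp add: tensor_detail_fun_def residual_part_def tensor_detail_formula)
  hence "l2norm N ?T = l2norm N (residual_part \<Lambda> k y)"
    by (intro l2norm_cong_AE L2_measurable T residual_part_L2 y)
  thus ?thesis
    using T by (simp add: L2_norm_on_eq)
qed

end

section \<open>Lebesgue norms on the parameter domain and summability\<close>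

text \<open>The end point 0 is included because residual norms may vanish; there convexity reduces
  to s^q \<le> s for 0 < s < 1.\<close>

lemma powr_convex_nonneg:
  assumes "1 \<le> (q::real)"
  shows "convex_on {0..} (\<lambda>x. x powr q)"
proof (rule convex_onI)
  fix t x y :: real assume t: "0 < t" "t < 1" and xy: "x \<in> {0..}" "y \<in> {0..}"
  have scale: "(s * v) powr q \<le> s * v powr q" if "0 < s" "s < 1" "0 \<le> v" for s v :: real
  proof -
    have "s powr q \<le> s powr 1"
      using that assms by (intro powr_mono') auto
    thus ?thesis
      using that by (simp add: powr_mult mult_right_mono)
  qed
  consider "x = 0" | "y = 0" | "0 < x" "0 < y"
    using xy by fastforce
  thus "((1 - t) *\<^sub>R x + t *\<^sub>R y) powr q \<le> (1 - t) * x powr q + t * y powr q"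
  proof cases
    case 1
    thus ?thesis
      using scale[of t y] t xy assms by simp
  next
    case 2
    thus ?thesis
      using scale[of "1 - t" x] t xy assms by simp
  next
    case 3
    thus ?thesis
      using convex_onD[OF powr_convex[OF assms], of t x y] t by simp
  qed
qed simp

lemma Lp_norm_cong:
  assumes "\<And>x. x \<in> space N \<Longrightarrow> f x = g x"
  shows "Lp_norm p N f = Lp_norm p N g"
proof -
  have "f \<in> borel_measurable N \<longleftrightarrow> g \<in> borel_measurable N"
    using assms by (intro measurable_cong) auto
  moreover have "Limsup (ae_filter N) f = Limsup (ae_filter N) g"
    using assms by (intro Limsup_eq) auto
  ultimately have "esssup N f = esssup N g"
    by (simp add: esssup_def)
  moreover have "(\<integral>\<^sup>+ x. epowr (f x) q \<partial>N) = (\<integral>\<^sup>+ x. epowr (g x) q \<partial>N)" for q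
    using assms by (intro nn_integral_cong) simp
  ultimately show ?thesis
    by (simp add: Lp_norm_def)
qed

lemma exponent_ge_1:
  assumes "1 \<le> p" "p \<noteq> \<infinity>"
  shows "1 \<le> enn2real p"
  using assms by (cases p) (auto simp: ennreal_1[symmetric] simp del: ennreal_1)

lemma Lp_norm_le_imp_nn_integral_le:
  assumes p: "1 \<le> p" "p \<noteq> \<infinity>" and "0 \<le> \<delta>" and H: "\<And>y. 0 \<le> H y"
    and le: "Lp_norm p \<mu> (\<lambda>y. ennreal (H y)) \<le> ennreal \<delta>"
  shows "(\<integral>\<^sup>+ y. ennreal (H y powr enn2real p) \<partial>\<mu>) \<le> ennreal (\<delta> powr enn2real p)"
proof -
  let ?q = "enn2real p"
  have q: "1 \<le> ?q"
    by (rule exponent_ge_1[OF p])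
  define I where "I = (\<integral>\<^sup>+ y. ennreal (H y powr ?q) \<partial>\<mu>)"
  have "epowr I (1 / ?q) \<le> ennreal \<delta>"
    using le p H by (simp add: Lp_norm_def I_def epowr_ennreal)
  moreover from this obtain t where t: "0 \<le> t" "I = ennreal t"
    by (cases I) (auto simp: epowr_def top_unique)
  ultimately have "t powr (1 / ?q) \<le> \<delta>"
    using \<open>0 \<le> \<delta>\<close> by (simp add: epowr_ennreal)
  hence "(t powr (1 / ?q)) powr ?q \<le> \<delta> powr ?q"
    using q by (intro powr_mono2) auto
  hence "t \<le> \<delta> powr ?q"
    using q t by (simp add: powr_powr)
  thus ?thesis
    using t by (simp add: I_def)
qed

text \<open>A Minkowski-type bound from Jensen's inequality. After division by S, the right side is
  a convex combination of the functions H k / \<delta>, with weights \<delta> / S, and the constant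
  1, with weight \<epsilon> / S. All of them have q-th moment at most 1, hence so has r e /
  S.\<close>

lemma Lp_norm_sum_bound:
  fixes H :: "'k \<Rightarrow> 'a \<Rightarrow> real"
  assumes "prob_space \<mu>" and p: "1 \<le> p" and F: "finite F" and r: "0 < r" and \<delta>: "0 < \<delta>" and \<epsilon>: "0 < \<epsilon>"
    and e_meas: "e \<in> borel_measurable \<mu>" and e: "\<And>y. 0 \<le> e y"
    and H_meas: "\<And>k. k \<in> F \<Longrightarrow> H k \<in> borel_measurable \<mu>" and H: "\<And>k y. 0 \<le> H k y"
    and H_le: "\<And>k. k \<in> F \<Longrightarrow> Lp_norm p \<mu> (\<lambda>y. ennreal (H k y)) \<le> ennreal \<delta>"
    and e_le: "\<And>y. y \<in> space \<mu> \<Longrightarrow> r * e y \<le> (\<Sum>k\<in>F. H k y) + \<epsilon>"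
  shows "Lp_norm p \<mu> (\<lambda>y. ennreal (e y)) \<le> ennreal ((real (card F) * \<delta> + \<epsilon>) / r)"
proof -
  interpret prob_space \<mu> by fact
  define S where "S = real (card F) * \<delta> + \<epsilon>"
  have S: "0 < S"
    using \<delta> \<epsilon> by (simp add: S_def add_nonneg_pos)
  show ?thesis
  proof (cases "p = \<infinity>")
    case True
    have "AE y in \<mu>. \<forall>k\<in>F. H k y \<le> \<delta>"
    proof (rule AE_finite_allI[OF F])
      fix k assume k: "k \<in> F"
      have "AE y in \<mu>. ennreal (H k y) \<le> esssup \<mu> (\<lambda>y. ennreal (H k y))"
        by (rule esssup_AE)
      moreover have "esssup \<mu> (\<lambda>y. ennreal (H k y)) \<le> ennreal \<delta>"
        using H_le[OF k] True by (simp add: Lp_norm_def)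
      ultimately have "AE y in \<mu>. ennreal (H k y) \<le> ennreal \<delta>"
        by (auto elim!: eventually_mono intro: order.trans)
      thus "AE y in \<mu>. H k y \<le> \<delta>"
        using \<delta> by (simp add: ennreal_le_iff)
    qed
    hence "AE y in \<mu>. ennreal (e y) \<le> ennreal (S / r)"
    proof (rule AE_mp[OF _ AE_I2], intro impI ennreal_leI)
      fix y assume y: "y \<in> space \<mu>" and le: "\<forall>k\<in>F. H k y \<le> \<delta>"
      have "r * e y \<le> (\<Sum>k\<in>F. \<delta>) + \<epsilon>"
        using le by (intro order.trans[OF e_le[OF y]] add_mono sum_mono) auto
      thus "e y \<le> S / r"
        using r by (simp add: S_def field_simps)
    qed
    thus ?thesis
      using True e_meas by (auto simp: Lp_norm_def S_def intro!: esssup_I)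
  next
    case False
    define q where "q = enn2real p"
    have q: "1 \<le> q"
      unfolding q_def by (rule exponent_ge_1[OF p False])
    note conv = powr_convex_nonneg[OF q]
    have pointwise: "e y powr q \<le> (S / r) powr q * ((\<Sum>k\<in>F. \<delta> / S * (H k y / \<delta>) powr q) + \<epsilon> / S)"
      if y: "y \<in> space \<mu>" for y
    proof -
      \<comment> \<open>The index \<open>None\<close> carries the constant function.\<close>
      define J where "J = insert None (Some ` F)"
      define w where "w j = (case j of None \<Rightarrow> \<epsilon> / S | Some k \<Rightarrow> \<delta> / S)" for j :: "'k option"
      define v where "v j = (case j of None \<Rightarrow> 1 | Some k \<Rightarrow> H k y / \<delta>)" for j
      have J: "finite J" "J \<noteq> {}"
        using F by (auto simp: J_def)
      have sumJ: "(\<Sum>j\<in>J. g j) = (\<Sum>k\<in>F. g (Some k)) + g None" for g :: "'k option \<Rightarrow> real"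
        using F by (simp add: J_def sum.reindex add.commute)
      have "(\<Sum>j\<in>J. w j) = 1"
        using S by (simp add: sumJ w_def S_def add_divide_distrib[symmetric])
      moreover have "0 \<le> w j" "v j \<in> {0..}" for j
        using S \<delta> \<epsilon> H by (auto simp: w_def v_def split: option.splits)
      ultimately have J1: "(\<Sum>j\<in>J. w j *\<^sub>R v j) powr q \<le> (\<Sum>j\<in>J. w j * v j powr q)"
        using J by (intro convex_on_sum[OF _ _ conv]) auto
      have "r * e y / S \<le> ((\<Sum>k\<in>F. H k y) + \<epsilon>) / S"
        using e_le[OF y] S by (intro divide_right_mono) auto
      also have "\<dots> = (\<Sum>j\<in>J. w j *\<^sub>R v j)"
        using \<delta> by (simp add: sumJ w_def v_def sum_divide_distrib add_divide_distrib)
      finally have "(r * e y / S) powr q \<le> (\<Sum>j\<in>J. w j *\<^sub>R v j) powr q"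
        using r S e q by (intro powr_mono2) auto
      also note J1
      also have "(\<Sum>j\<in>J. w j * v j powr q) = (\<Sum>k\<in>F. \<delta> / S * (H k y / \<delta>) powr q) + \<epsilon> / S"
        by (simp add: sumJ w_def v_def)
      finally have le: "(r * e y / S) powr q \<le> (\<Sum>k\<in>F. \<delta> / S * (H k y / \<delta>) powr q) + \<epsilon> / S" .
      have "e y powr q = (S / r * (r * e y / S)) powr q"
        using S r by simp
      also have "\<dots> = (S / r) powr q * (r * e y / S) powr q"
        by (rule powr_mult)
      also have "\<dots> \<le> (S / r) powr q * ((\<Sum>k\<in>F. \<delta> / S * (H k y / \<delta>) powr q) + \<epsilon> / S)"
        using le by (intro mult_left_mono) auto
      finally show ?thesis .
    qed
    have int: "(\<integral>\<^sup>+ y. ennreal (\<delta> / S * (H k y / \<delta>) powr q) \<partial>\<mu>) \<le> ennreal (\<delta> / S)" if k: "k \<in> F" for k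
    proof -
      note [measurable] = H_meas[OF k]
      have "(\<integral>\<^sup>+ y. ennreal (\<delta> / S * (H k y / \<delta>) powr q) \<partial>\<mu>)
          = (\<integral>\<^sup>+ y. ennreal (\<delta> / S * (1 / \<delta>) powr q) * ennreal (H k y powr q) \<partial>\<mu>)"
        using \<delta> S H by (intro nn_integral_cong) (simp add: powr_divide ennreal_mult[symmetric])
      also have "\<dots> = ennreal (\<delta> / S * (1 / \<delta>) powr q) * (\<integral>\<^sup>+ y. ennreal (H k y powr q) \<partial>\<mu>)"
        by (intro nn_integral_cmult) measurable
      also have "\<dots> \<le> ennreal (\<delta> / S * (1 / \<delta>) powr q) * ennreal (\<delta> powr q)"
        unfolding q_def using \<delta>
        by (intro mult_left_mono Lp_norm_le_imp_nn_integral_le[OF p False] H H_le k) auto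
      also have "\<dots> = ennreal (\<delta> / S)"
        using \<delta> S by (simp add: ennreal_mult[symmetric] powr_divide)
      finally show ?thesis .
    qed
    have "(\<integral>\<^sup>+ y. ennreal (e y powr q) \<partial>\<mu>)
        \<le> (\<integral>\<^sup>+ y. ennreal ((S / r) powr q) * ((\<Sum>k\<in>F. ennreal (\<delta> / S * (H k y / \<delta>) powr q)) + ennreal (\<epsilon> / S)) \<partial>\<mu>)"
    proof (rule nn_integral_mono)
      fix y assume y: "y \<in> space \<mu>"
      have nn: "0 \<le> \<delta> / S * (H k y / \<delta>) powr q" for k
        using \<delta> S by simp
      have "ennreal (e y powr q) \<le> ennreal ((S / r) powr q * ((\<Sum>k\<in>F. \<delta> / S * (H k y / \<delta>) powr q) + \<epsilon> / S))"
        by (intro ennreal_leI pointwise y)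
      also have "\<dots> = ennreal ((S / r) powr q) * ((\<Sum>k\<in>F. ennreal (\<delta> / S * (H k y / \<delta>) powr q)) + ennreal (\<epsilon> / S))"
        using nn \<epsilon> S by (simp add: ennreal_mult ennreal_plus sum_nonneg)
      finally show "ennreal (e y powr q) \<le> ennreal ((S / r) powr q) * ((\<Sum>k\<in>F. ennreal (\<delta> / S * (H k y / \<delta>) powr q)) + ennreal (\<epsilon> / S))" .
    qed
    also have "\<dots> = ennreal ((S / r) powr q) * ((\<Sum>k\<in>F. \<integral>\<^sup>+ y. ennreal (\<delta> / S * (H k y / \<delta>) powr q) \<partial>\<mu>) + ennreal (\<epsilon> / S))"
      using H_meas by (simp add: nn_integral_cmult nn_integral_add nn_integral_sum emeasure_space_1)
    also have "\<dots> \<le> ennreal ((S / r) powr q) * ((\<Sum>k\<in>F. ennreal (\<delta> / S)) + ennreal (\<epsilon> / S))"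
      by (intro mult_left_mono add_mono sum_mono int) auto
    also have "(\<Sum>k\<in>F. ennreal (\<delta> / S)) + ennreal (\<epsilon> / S) = ennreal 1"
    proof -
      have "(\<Sum>k\<in>F. ennreal (\<delta> / S)) = ennreal (\<Sum>k\<in>F. \<delta> / S)"
        using \<delta> S by (intro sum_ennreal) auto
      moreover have "(\<Sum>k\<in>F. \<delta> / S) + \<epsilon> / S = 1"
        using S by (simp add: S_def add_divide_distrib[symmetric])
      ultimately show ?thesis
        using \<delta> S \<epsilon> by (simp add: sum_nonneg flip: ennreal_plus)
    qed
    finally have le: "(\<integral>\<^sup>+ y. ennreal (e y powr q) \<partial>\<mu>) \<le> ennreal ((S / r) powr q)"
      by simp
    then obtain t where t: "0 \<le> t" "(\<integral>\<^sup>+ y. ennreal (e y powr q) \<partial>\<mu>) = ennreal t"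
      by (cases "\<integral>\<^sup>+ y. ennreal (e y powr q) \<partial>\<mu>") (auto simp: top_unique)
    have "t powr (1 / q) \<le> ((S / r) powr q) powr (1 / q)"
      using le t q by (intro powr_mono2) (auto simp: ennreal_le_iff)
    also have "\<dots> = S / r"
      using q S r by (simp add: powr_powr)
    finally show ?thesis
      using False e t by (simp add: Lp_norm_def epowr_ennreal q_def[symmetric] S_def ennreal_leI)
  qed
qed

section \<open>The parameter measure\<close>

lemma prob_space_mu: "prob_space (mu M)"
  unfolding mu_def
proof (intro prob_space_PiM prob_space_uniform_measure)
  have "emeasure (restrict_space lborel {-1..1::real}) {-1..1} = emeasure lborel {-1..1::real}"
    by (intro emeasure_restrict_space) auto
  thus "emeasure (restrict_space lborel {-1..1::real}) {-1..1} \<noteq> 0"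
    "emeasure (restrict_space lborel {-1..1::real}) {-1..1} \<noteq> \<infinity>"
    by auto
qed

lemma space_mu: "space (mu M) = Gam M"
  by (simp add: mu_def Gam_def space_PiM space_restrict_space)

lemma component_measurable_mu: "m \<in> {1..M} \<Longrightarrow> (\<lambda>y. y m) \<in> borel_measurable (mu M)"
proof -
  assume m: "m \<in> {1..M}"
  have "(\<lambda>y. y m) \<in> measurable (mu M) (uniform_measure (restrict_space lborel {-1..1}) {-1..1})"
    unfolding mu_def by (rule measurable_component_singleton[OF m])
  hence "(\<lambda>y. y m) \<in> measurable (mu M) (restrict_space lborel {-1..1})"
    by (simp cong: measurable_cong_sets)
  moreover have "(\<lambda>t. t) \<in> measurable (restrict_space lborel {-1..1::real}) borel"
    by (intro measurable_restrict_space1) simp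
  ultimately show ?thesis
    by (rule measurable_compose)
qed

text \<open>A finite set of multi-indices lies in a box, where a sum of products is a product of
  sums. Restriction to \<open>{1..M}\<close> translates indices that vanish outside into extensional
  ones.\<close>

lemma multi_index_product_sum_le:
  fixes h :: "nat \<Rightarrow> real"
  assumes h: "summable h" "\<And>l. 0 \<le> h l" and G: "finite G" "G \<subseteq> multi_indices M"
  shows "(\<Sum>k\<in>G. \<Prod>m=1..M. h (k m)) \<le> suminf h ^ M"
proof -
  define n where "n = (\<Sum>k\<in>G. \<Sum>m=1..M. k m)"
  have n: "k m \<le> n" if "k \<in> G" "m \<in> {1..M}" for k m
  proof -
    have "k m \<le> (\<Sum>m=1..M. k m)"
      using that by (intro member_le_sum) auto
    also have "\<dots> \<le> n"
      unfolding n_def using that G by (intro member_le_sum) auto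
    finally show ?thesis .
  qed
  have inj: "inj_on (\<lambda>k. restrict k {1..M}) G"
  proof (rule inj_onI)
    fix k l assume kl: "k \<in> G" "l \<in> G" and eq: "restrict k {1..M} = restrict l {1..M}"
    show "k = l"
    proof
      fix m
      show "k m = l m"
      proof (cases "m \<in> {1..M}")
        case True
        thus ?thesis
          using fun_cong[OF eq, of m] by simp
      next
        case False
        moreover have "k \<in> multi_indices M" "l \<in> multi_indices M"
          using kl G(2) by auto
        ultimately show ?thesis
          by (simp add: multi_indices_def)
      qed
    qed
  qed
  have "(\<Sum>k\<in>G. \<Prod>m=1..M. h (k m)) = (\<Sum>\<nu>\<in>(\<lambda>k. restrict k {1..M}) ` G. \<Prod>m=1..M. h (\<nu> m))"
    by (subst sum.reindex[OF inj]) (auto intro!: sum.cong prod.cong)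
  also have "\<dots> \<le> (\<Sum>\<nu>\<in>PiE {1..M} (\<lambda>m. {..n}). \<Prod>m=1..M. h (\<nu> m))"
    using n h by (intro sum_mono2 finite_PiE prod_nonneg) auto
  also have "\<dots> = (\<Prod>m=1..M. \<Sum>l\<le>n. h l)"
    by (subst prod_sum_PiE) auto
  also have "\<dots> \<le> (\<Prod>m=1..M. suminf h)"
    using h by (intro prod_mono conjI sum_nonneg sum_le_suminf) auto
  finally show ?thesis
    by simp
qed

text \<open>F nearly attains the supremum of the finite sums; a disjoint set with sum above
  \<epsilon> would push the union beyond it.\<close>

lemma bounded_sums_imp_small_tails:
  fixes g :: "'a \<Rightarrow> real"
  assumes bd: "\<And>G. finite G \<Longrightarrow> G \<subseteq> A \<Longrightarrow> sum g G \<le> B" and \<epsilon>: "0 < \<epsilon>"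
  obtains F where "finite F" "F \<subseteq> A" "\<And>G. finite G \<Longrightarrow> G \<subseteq> A \<Longrightarrow> G \<inter> F = {} \<Longrightarrow> sum g G \<le> \<epsilon>"
proof -
  define X where "X = sum g ` {G. finite G \<and> G \<subseteq> A}"
  have X: "X \<noteq> {}" "bdd_above X"
    using bd by (auto simp: X_def intro!: bdd_aboveI2)
  obtain s where "s \<in> X" "Sup X - \<epsilon> < s"
    using less_cSupD[of X "Sup X - \<epsilon>"] X \<epsilon> by auto
  then obtain F where F: "finite F" "F \<subseteq> A" "Sup X - \<epsilon> < sum g F"
    by (auto simp: X_def)
  show thesis
  proof (rule that[OF F(1,2)])
    fix G assume G: "finite G" "G \<subseteq> A" "G \<inter> F = {}"
    have "sum g (G \<union> F) \<le> Sup X"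
      using X G F by (intro cSup_upper) (auto simp: X_def)
    thus "sum g G \<le> \<epsilon>"
      using F G by (simp add: sum.union_disjoint)
  qed
qed

text \<open>The ratio of consecutive terms tends to s, so it eventually stays below the midpoint (1
  + s) / 2.\<close>

lemma summable_powr_geometric:
  fixes c \<theta> s :: real
  assumes c: "0 \<le> c" and s: "0 < s" "s < 1"
  shows "summable (\<lambda>l. ((1 + c * real l) powr \<theta>)\<^sup>2 * s ^ l)"
proof -
  define R where "R l = 1 + c / (1 + c * real l)" for l
  have R: "R \<longlonglongrightarrow> 1"
  proof (cases "c = 0")
    case False
    hence "filterlim (\<lambda>l. 1 + c * real l) at_infinity sequentially"
      using c by (intro filterlim_at_top_imp_at_infinity filterlim_tendsto_add_at_top[OF tendsto_const]
          filterlim_tendsto_pos_mult_at_top[OF tendsto_const] filterlim_real_sequentially) auto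
    from tendsto_add[OF tendsto_const tendsto_divide_0[OF tendsto_const this]]
    show ?thesis
      by (auto simp: R_def[abs_def])
  qed (simp add: R_def[abs_def])
  hence "(\<lambda>l. (R l powr \<theta>)\<^sup>2 * s) \<longlonglongrightarrow> (1 powr \<theta>)\<^sup>2 * s"
    by (intro tendsto_intros) auto
  hence "\<forall>\<^sub>F l in sequentially. (R l powr \<theta>)\<^sup>2 * s < (1 + s) / 2"
    using s by (intro order_tendstoD) auto
  then obtain L where L: "\<And>l. L \<le> l \<Longrightarrow> (R l powr \<theta>)\<^sup>2 * s < (1 + s) / 2"
    by (auto simp: eventually_sequentially)
  show ?thesis
  proof (rule summable_ratio_test)
    show "(1 + s) / 2 < 1"
      using s by simp
    fix l assume l: "L \<le> l"
    have pos: "0 < 1 + c * real l"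
      using c by (simp add: add_pos_nonneg)
    have "1 + c * real (Suc l) = R l * (1 + c * real l)"
      using pos by (simp add: R_def field_simps)
    hence "((1 + c * real (Suc l)) powr \<theta>)\<^sup>2 * s ^ Suc l
        = ((R l powr \<theta>)\<^sup>2 * s) * (((1 + c * real l) powr \<theta>)\<^sup>2 * s ^ l)"
      using pos c by (simp add: powr_mult power_mult_distrib R_def)
    also have "\<dots> \<le> (1 + s) / 2 * (((1 + c * real l) powr \<theta>)\<^sup>2 * s ^ l)"
      using L[OF l] s by (intro mult_right_mono) auto
    finally show "norm (((1 + c * real (Suc l)) powr \<theta>)\<^sup>2 * s ^ Suc l)
        \<le> (1 + s) / 2 * norm (((1 + c * real l) powr \<theta>)\<^sup>2 * s ^ l)"
      using s by simp
  qed
qed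

section \<open>Margins and monotone envelopes\<close>

lemma monotone_set_union_margin:
  assumes "monotone_set M \<Lambda>"
  shows "monotone_set M (\<Lambda> \<union> Marg M \<Lambda>)"
  unfolding monotone_set_def
proof (intro conjI ballI impI)
  show "\<Lambda> \<union> Marg M \<Lambda> \<subseteq> multi_indices M"
    using assms by (auto simp: monotone_set_def Marg_def)
  fix k m assume k: "k \<in> \<Lambda> \<union> Marg M \<Lambda>" and m: "m \<in> {1..M}" "1 \<le> k m"
  show "k(m := k m - 1) \<in> \<Lambda> \<union> Marg M \<Lambda>"
  proof (cases "k \<in> \<Lambda>")
    case True
    thus ?thesis
      using assms m by (auto simp: monotone_set_def)
  next
    case False
    then obtain j where j: "j \<in> {1..M}" "1 \<le> k j" "k(j := k j - 1) \<in> \<Lambda>" and km: "k \<in> multi_indices M"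
      using k by (auto simp: Marg_def)
    show ?thesis
    proof (cases "j = m")
      case True
      thus ?thesis
        using j by simp
    next
      case False
      \<comment> \<open>The predecessor in direction j lies in \<open>\<Lambda>\<close> and can be
        lowered in direction m; the two steps commute.\<close>
      have "(k(j := k j - 1))(m := (k(j := k j - 1)) m - 1) \<in> \<Lambda>"
      proof -
        have "\<And>i m. i \<in> \<Lambda> \<Longrightarrow> m \<in> {1..M} \<Longrightarrow> 1 \<le> i m \<Longrightarrow> i(m := i m - 1) \<in> \<Lambda>"
          using assms unfolding monotone_set_def by blast
        from this[OF j(3) m(1)] show ?thesis
          using m(2) False by simp
      qed
      hence "(k(m := k m - 1))(j := (k(m := k m - 1)) j - 1) \<in> \<Lambda>"
        using False by (simp add: fun_upd_twist)
      moreover have "k(m := k m - 1) \<in> multi_indices M"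
        using km by (auto simp: multi_indices_def)
      moreover have "1 \<le> (k(m := k m - 1)) j"
        using False j by simp
      ultimately show ?thesis
        unfolding Marg_def using j(1) by blast
    qed
  qed
qed

text \<open>Monotonicity of \<open>\<Lambda> \<union> E\<close> passes to the intersection of the
  sets E. The family is nonempty, since the whole margin belongs to it.\<close>

lemma envelope_properties:
  assumes \<Lambda>: "monotone_set M \<Lambda>" and k: "k \<in> Marg M \<Lambda>"
  shows "k \<in> envelope M \<Lambda> k" "envelope M \<Lambda> k \<subseteq> Marg M \<Lambda>" "monotone_set M (\<Lambda> \<union> envelope M \<Lambda> k)"
proof -
  define \<E> where "\<E> = {E. E \<subseteq> Marg M \<Lambda> \<and> k \<in> E \<and> monotone_set M (\<Lambda> \<union> E)}"
  have env: "envelope M \<Lambda> k = \<Inter>\<E>"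
    by (simp add: envelope_def \<E>_def)
  have "Marg M \<Lambda> \<in> \<E>"
    using monotone_set_union_margin[OF \<Lambda>] k by (simp add: \<E>_def)
  thus sub: "envelope M \<Lambda> k \<subseteq> Marg M \<Lambda>"
    unfolding env by blast
  show "k \<in> envelope M \<Lambda> k"
    unfolding env by (auto simp: \<E>_def)
  show "monotone_set M (\<Lambda> \<union> envelope M \<Lambda> k)"
    unfolding monotone_set_def
  proof (intro conjI ballI impI)
    show "\<Lambda> \<union> envelope M \<Lambda> k \<subseteq> multi_indices M"
      using sub \<Lambda> by (auto simp: monotone_set_def Marg_def)
    fix i m assume i: "i \<in> \<Lambda> \<union> envelope M \<Lambda> k" and m: "m \<in> {1..M}" "1 \<le> i m"
    have "i(m := i m - 1) \<in> \<Lambda> \<union> E" if E: "E \<in> \<E>" for E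
    proof -
      have "i \<in> \<Lambda> \<union> E"
        using i E unfolding env by blast
      moreover have "monotone_set M (\<Lambda> \<union> E)"
        using E by (simp add: \<E>_def)
      ultimately show ?thesis
        using m unfolding monotone_set_def by blast
    qed
    thus "i(m := i m - 1) \<in> \<Lambda> \<union> envelope M \<Lambda> k"
      unfolding env by blast
  qed
qed

lemma finite_bounded_multi_indices: "finite {k \<in> multi_indices M. \<forall>m. k m \<le> n}"
proof (rule finite_subset)
  show "finite {k. \<forall>m. (m \<in> {1..M} \<longrightarrow> k m \<in> {..n}) \<and> (m \<notin> {1..M} \<longrightarrow> k m = 0)}"
    by (intro finite_set_of_finite_funs) auto
qed (auto simp: multi_indices_def)

context diffusion
begin

section \<open>Measurability in the parameter\<close>

lemma finite_measure_N: "finite_measure N"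
proof -
  have "D \<in> lmeasurable"
    using D_open D_bounded by (simp add: bounded_set_imp_lmeasurable lmeasurable_open)
  thus ?thesis
    by (rule finite_measure_lebesgue_on)
qed

lemma majorant_small_tails:
  assumes "0 < \<epsilon>"
  obtains F where "finite F" "F \<subseteq> multi_indices M"
    "\<And>G. finite G \<Longrightarrow> G \<subseteq> multi_indices M \<Longrightarrow> G \<inter> F = {} \<Longrightarrow> sum majorant G \<le> \<epsilon>"
proof -
  let ?h = "\<lambda>l. (lam l)\<^sup>2 * sig ^ l" and ?K = "real M * A * approx_const / sig"
  have K: "0 \<le> ?K"
    using r_pos r_le_A approx_const_nonneg sig by (intro mult_nonneg_nonneg divide_nonneg_nonneg) auto
  have "sum majorant G \<le> ?K * suminf ?h ^ M" if "finite G" "G \<subseteq> multi_indices M" for G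
  proof -
    have "sum majorant G = ?K * (\<Sum>k\<in>G. \<Prod>m=1..M. ?h (k m))"
      by (simp add: majorant_def sum_distrib_left)
    also have "\<dots> \<le> ?K * suminf ?h ^ M"
      using sig by (intro mult_left_mono K multi_index_product_sum_le that summable_powr_geometric c_nonneg) auto
    finally show ?thesis .
  qed
  from bounded_sums_imp_small_tails[OF this assms] show thesis
    using that by metis
qed

text \<open>On \<open>Gam M\<close> the nodes do not depend on y, so the detail is a finite sum of
  polynomials in y times fixed functions of x.\<close>

lemma tensor_detail_joint_measurable:
  fixes G :: "(nat \<Rightarrow> real) \<Rightarrow> real^'d \<Rightarrow> 'b::euclidean_space"
  assumes G: "\<And>y. y \<in> Gam M \<Longrightarrow> G y \<in> L2 N"
  shows "(\<lambda>(y, x). \<Delta> M k (\<lambda>y. G y x) y) \<in> borel_measurable (mu M \<Otimes>\<^sub>M N)"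
proof -
  define y0 where "y0 = (\<lambda>m\<in>{1..M}. 0 :: real)"
  have y0: "y0 \<in> Gam M"
    by (auto simp: y0_def Gam_def)
  have [measurable]: "weight M k \<nu> \<in> borel_measurable (mu M)" for \<nu>
  proof -
    have "(\<lambda>y. poly q (y m)) \<in> borel_measurable (mu M)" if "m \<in> {1..M}" for q :: "real poly" and m
      using component_measurable_mu[OF that] borel_measurable_continuous_onI[OF continuous_on_poly[OF continuous_on_id]]
      by (rule measurable_compose)
    thus ?thesis
      unfolding weight_def[abs_def] by (intro borel_measurable_prod) auto
  qed
  have [measurable]: "G (node M \<nu> y0) \<in> borel_measurable N" for \<nu>
    by (intro L2_measurable G node_in_Gam z_range y0)
  have "(\<lambda>(y, x). \<Sum>\<nu>\<in>node_indices M k. weight M k \<nu> y *\<^sub>R G (node M \<nu> y0) x) \<in> borel_measurable (mu M \<Otimes>\<^sub>M N)"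
    by measurable
  also have "?this \<longleftrightarrow> ?thesis"
  proof (rule measurable_cong)
    fix w assume w: "w \<in> space (mu M \<Otimes>\<^sub>M N)"
    obtain y x where yx: "w = (y, x)"
      by (cases w)
    hence "y \<in> Gam M"
      using w by (simp add: space_pair_measure space_mu)
    hence "node M \<nu> y = node M \<nu> y0" for \<nu>
      by (intro node_eq y0)
    thus "(case w of (y, x) \<Rightarrow> \<Sum>\<nu>\<in>node_indices M k. weight M k \<nu> y *\<^sub>R G (node M \<nu> y0) x)
        = (case w of (y, x) \<Rightarrow> \<Delta> M k (\<lambda>y. G y x) y)"
      by (simp add: yx tensor_detail_formula)
  qed
  finally show ?thesis .
qed

lemma l2norm_measurable:
  fixes G :: "(nat \<Rightarrow> real) \<Rightarrow> real^'d \<Rightarrow> 'b::euclidean_space"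
  assumes [measurable]: "(\<lambda>(y, x). G y x) \<in> borel_measurable (mu M \<Otimes>\<^sub>M N)"
  shows "(\<lambda>y. l2norm N (G y)) \<in> borel_measurable (mu M)"
proof -
  interpret finite_measure N
    by (rule finite_measure_N)
  show ?thesis
    unfolding l2norm_def by measurable
qed

lemma residual_part_norm_measurable: "(\<lambda>y. l2norm N (residual_part \<Lambda> k y)) \<in> borel_measurable (mu M)"
  unfolding residual_part_def[abs_def]
  by (intro l2norm_measurable tensor_detail_joint_measurable coeff_L2 sparse_op_U_L2)

lemma sparse_op_joint_measurable:
  "(\<lambda>(y, x). \<S> \<Lambda> U y x) \<in> borel_measurable (mu M \<Otimes>\<^sub>M N)"
  using tensor_detail_joint_measurable[of U, OF U_L2]
  by (simp add: sparse_op_U case_prod_unfold borel_measurable_sum)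

text \<open>Measurability of the error is needed because the essential supremum of a non-measurable function is
  infinite by convention; the interpolants on the boxes converge to \<open>U\<close> uniformly.\<close>

lemma error_norm_measurable: "(\<lambda>y. l2norm N (\<lambda>x. U y x - \<S> \<Lambda> U y x)) \<in> borel_measurable (mu M)"
proof -
  \<comment> \<open>These boxes exhaust all multi-indices, so their margins eventually avoid any
    finite set, and the residual estimate bounds the error by a tail of the majorant.\<close>
  define box where "box n = {k \<in> multi_indices M. \<forall>m. k m \<le> n}" for n
  have box: "finite (box n)" "monotone_set M (box n)" "(\<lambda>_. 0) \<in> box n" for n
    unfolding box_def by (rule finite_bounded_multi_indices) (auto simp: monotone_set_def multi_indices_def intro: order.trans[OF diff_le_self])
  have approx: "(\<lambda>n. l2norm N (\<lambda>x. U y x - \<S> (box n) U y x)) \<longlonglongrightarrow> 0" if y: "y \<in> Gam M" for y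
  proof (rule LIMSEQ_I)
    fix \<epsilon> :: real assume \<epsilon>: "0 < \<epsilon>"
    hence "0 < r * \<epsilon> / 2"
      using r_pos by simp
    then obtain F where F: "finite F" "F \<subseteq> multi_indices M"
      "\<And>G. finite G \<Longrightarrow> G \<subseteq> multi_indices M \<Longrightarrow> G \<inter> F = {} \<Longrightarrow> sum majorant G \<le> r * \<epsilon> / 2"
      by (rule majorant_small_tails) blast
    define n0 where "n0 = (\<Sum>k\<in>F. \<Sum>m=1..M. k m)"
    have n0: "k m \<le> n0" if "k \<in> F" for k m
    proof (cases "m \<in> {1..M}")
      case True
      have "k m \<le> (\<Sum>m=1..M. k m)"
        using True by (intro member_le_sum) auto
      also have "\<dots> \<le> n0"
        unfolding n0_def using that F by (intro member_le_sum) auto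
      finally show ?thesis .
    next
      case False
      have "k \<in> multi_indices M"
        using F(2) that by (rule subsetD)
      thus ?thesis
        using False by (simp add: multi_indices_def)
    qed
    have "l2norm N (\<lambda>x. U y x - \<S> (box n) U y x) < \<epsilon>" if n: "n0 \<le> n" for n
    proof -
      have "F \<subseteq> box n"
        unfolding box_def using order.trans[OF n0 n] F(2) by blast
      hence disj: "Marg M (box n) \<inter> F = {}"
        by (auto simp: Marg_def)
      have "r * l2norm N (\<lambda>x. U y x - \<S> (box n) U y x)
          \<le> (\<Sum>k\<in>Marg M (box n). l2norm N (residual_part (box n) k y))"
        by (intro residual_estimate box y)
      also have "\<dots> \<le> sum majorant (Marg M (box n))"
        by (intro sum_mono residual_part_le_majorant box y)
      also have "\<dots> \<le> r * \<epsilon> / 2"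
        using disj by (intro F finite_Marg box) (auto simp: Marg_def)
      also have "\<dots> < r * \<epsilon>"
        using r_pos \<epsilon> by simp
      finally show ?thesis
        using r_pos by simp
    qed
    thus "\<exists>no. \<forall>n\<ge>no. norm (l2norm N (\<lambda>x. U y x - \<S> (box n) U y x) - 0) < \<epsilon>"
      by auto
  qed
  show ?thesis
  proof (rule borel_measurable_LIMSEQ_real)
    show "(\<lambda>y. l2norm N (\<lambda>x. \<S> (box n) U y x - \<S> \<Lambda> U y x)) \<in> borel_measurable (mu M)" for n
    proof (rule l2norm_measurable)
      note [measurable] = sparse_op_joint_measurable
      show "(\<lambda>(y, x). \<S> (box n) U y x - \<S> \<Lambda> U y x) \<in> borel_measurable (mu M \<Otimes>\<^sub>M N)"
        by measurable
    qed
    fix y assume "y \<in> space (mu M)"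
    hence y: "y \<in> Gam M"
      by (simp add: space_mu)
    let ?S = "\<lambda>n. \<S> (box n) U y" and ?T = "\<S> \<Lambda> U y"
    note sq = U_L2[OF y] sparse_op_U_L2[OF y]
    have "\<bar>l2norm N (\<lambda>x. ?S n x - ?T x) - l2norm N (\<lambda>x. U y x - ?T x)\<bar> \<le> l2norm N (\<lambda>x. U y x - ?S n x)" for n
    proof -
      have "l2norm N (\<lambda>x. U y x - ?T x) \<le> l2norm N (\<lambda>x. ?S n x - ?T x) + l2norm N (\<lambda>x. (U y x - ?T x) - (?S n x - ?T x))"
        by (intro l2norm_triangle_diff L2_diff sq)
      moreover have "l2norm N (\<lambda>x. ?S n x - ?T x) \<le> l2norm N (\<lambda>x. U y x - ?T x) + l2norm N (\<lambda>x. (?S n x - ?T x) - (U y x - ?T x))"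
        by (intro l2norm_triangle_diff L2_diff sq)
      moreover have "l2norm N (\<lambda>x. ?S n x - U y x) = l2norm N (\<lambda>x. U y x - ?S n x)"
        unfolding l2norm_def by (simp add: norm_minus_commute)
      ultimately show ?thesis
        by simp
    qed
    hence "(\<lambda>n. l2norm N (\<lambda>x. ?S n x - ?T x) - l2norm N (\<lambda>x. U y x - ?T x)) \<longlonglongrightarrow> 0"
      by (intro Lim_null_comparison[OF _ approx[OF y]]) auto
    thus "(\<lambda>n. l2norm N (\<lambda>x. ?S n x - ?T x)) \<longlonglongrightarrow> l2norm N (\<lambda>x. U y x - ?T x)"
      by (simp add: LIM_zero_iff)
  qed
qed

section \<open>Error, estimator and adaptive convergence\<close>

lemma Bochner_H01_norm_error:
  "Bochner_H01_norm p M D (\<lambda>y x. u y x - \<S> \<Lambda> u y x)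
     = Lp_norm p (mu M) (\<lambda>y. ennreal (l2norm N (\<lambda>x. U y x - \<S> \<Lambda> U y x)))"
  unfolding Bochner_H01_norm_def by (intro Lp_norm_cong H01_norm_error) (simp add: space_mu)

lemma estimator_eq:
  "estimator z mm M p D a (\<S> \<Lambda> u) k
     = Lp_norm p (mu M) (\<lambda>y. ennreal (l2norm N (residual_part \<Lambda> k y)))"
  unfolding estimator_def Bochner_L2_norm_def by (intro Lp_norm_cong L2_norm_residual) (simp add: space_mu)

lemma estimator_le:
  assumes "1 \<le> p" "finite \<Lambda>" "monotone_set M \<Lambda>" "k \<in> Marg M \<Lambda>" "majorant k \<le> \<delta>" "0 < \<delta>"
  shows "estimator z mm M p D a (\<S> \<Lambda> u) k \<le> ennreal \<delta>"
proof -
  have "Lp_norm p (mu M) (\<lambda>y. ennreal (l2norm N (residual_part \<Lambda> k y))) \<le> ennreal ((real (card {}) * 1 + \<delta>) / 1)"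
  \<comment> \<open>With an empty sum the bound says that a pointwise bound \<delta> passes to the
    p-norm, because the measure is a probability.\<close>
  proof (rule Lp_norm_sum_bound[OF prob_space_mu, where F = "{}" and H = "\<lambda>_ _. 0"])
    show "1 * l2norm N (residual_part \<Lambda> k y) \<le> (\<Sum>k\<in>{}. 0) + \<delta>" if "y \<in> space (mu M)" for y
      using residual_part_le_majorant[of \<Lambda> k y] assms that by (simp add: space_mu)
  qed (use assms residual_part_norm_measurable in auto)
  thus ?thesis
    by (simp add: estimator_eq)
qed

text \<open>Margin indices in F are controlled by the estimator in the p-norm, those outside F by
  the majorant pointwise. The factor \<open>card F\<close> stays fixed however large the margin
  is.\<close>

lemma error_bound:
  assumes p: "1 \<le> p" and \<Lambda>: "finite \<Lambda>" "monotone_set M \<Lambda>" "(\<lambda>_. 0) \<in> \<Lambda>"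
    and F: "finite F" "\<And>G. finite G \<Longrightarrow> G \<subseteq> multi_indices M \<Longrightarrow> G \<inter> F = {} \<Longrightarrow> sum majorant G \<le> \<epsilon>"
    and \<delta>: "0 < \<delta>" "\<And>k. k \<in> Marg M \<Lambda> \<Longrightarrow> estimator z mm M p D a (\<S> \<Lambda> u) k \<le> ennreal \<delta>"
    and \<epsilon>: "0 < \<epsilon>"
  shows "Bochner_H01_norm p M D (\<lambda>y x. u y x - \<S> \<Lambda> u y x) \<le> ennreal ((real (card F) * \<delta> + \<epsilon>) / r)"
proof -
  let ?H = "\<lambda>k y. l2norm N (residual_part \<Lambda> k y)"
  have "Bochner_H01_norm p M D (\<lambda>y x. u y x - \<S> \<Lambda> u y x)
      \<le> ennreal ((real (card (Marg M \<Lambda> \<inter> F)) * \<delta> + \<epsilon>) / r)"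
    unfolding Bochner_H01_norm_error
  proof (rule Lp_norm_sum_bound[OF prob_space_mu p, where H = ?H])
    show "Lp_norm p (mu M) (\<lambda>y. ennreal (?H k y)) \<le> ennreal \<delta>" if "k \<in> Marg M \<Lambda> \<inter> F" for k
      using that \<delta>(2)[of k] by (simp add: estimator_eq)
    fix y assume "y \<in> space (mu M)"
    hence y: "y \<in> Gam M"
      by (simp add: space_mu)
    have "r * l2norm N (\<lambda>x. U y x - \<S> \<Lambda> U y x) \<le> (\<Sum>k\<in>Marg M \<Lambda>. ?H k y)"
      by (intro residual_estimate \<Lambda> y)
    also have "\<dots> = (\<Sum>k\<in>Marg M \<Lambda> \<inter> F. ?H k y) + (\<Sum>k\<in>Marg M \<Lambda> - F. ?H k y)"
      using finite_Marg[OF \<Lambda>(1)] by (rule sum.Int_Diff)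
    also have "(\<Sum>k\<in>Marg M \<Lambda> - F. ?H k y) \<le> sum majorant (Marg M \<Lambda> - F)"
      by (intro sum_mono residual_part_le_majorant \<Lambda> y) auto
    also have "\<dots> \<le> \<epsilon>"
      using finite_Marg[OF \<Lambda>(1)] by (intro F) (auto simp: Marg_def)
    finally show "r * l2norm N (\<lambda>x. U y x - \<S> \<Lambda> U y x) \<le> (\<Sum>k\<in>Marg M \<Lambda> \<inter> F. ?H k y) + \<epsilon>"
      by simp
  qed (use F r_pos \<delta> \<epsilon> error_norm_measurable residual_part_norm_measurable in auto)
  also have "\<dots> \<le> ennreal ((real (card F) * \<delta> + \<epsilon>) / r)"
    using F(1) r_pos \<delta> by (intro ennreal_leI divide_right_mono add_right_mono mult_right_mono) (auto intro: card_mono)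
  finally show ?thesis .
qed

lemma adaptive_convergence:
  assumes p: "1 \<le> p" and alg: "adaptive_collocation z mm M p D a u un"
  shows "(\<lambda>n. Bochner_H01_norm p M D (\<lambda>y x. u y x - un n y x)) \<longlonglongrightarrow> 0"
proof -
  obtain \<Lambda> ks where \<Lambda>0: "\<Lambda> 0 = {\<lambda>_. 0}" and un: "\<And>n. un n = \<S> (\<Lambda> n) u"
    and ks: "\<And>n. ks n \<in> Marg M (\<Lambda> n)"
    and max: "\<And>n k. k \<in> Marg M (\<Lambda> n) \<Longrightarrow> estimator z mm M p D a (un n) k \<le> estimator z mm M p D a (un n) (ks n)"
    and step: "\<And>n. \<Lambda> (Suc n) = \<Lambda> n \<union> envelope M (\<Lambda> n) (ks n)"
    using alg unfolding adaptive_collocation_def by blast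
  have inv: "finite (\<Lambda> n) \<and> monotone_set M (\<Lambda> n) \<and> (\<lambda>_. 0) \<in> \<Lambda> n" for n
  proof (induction n)
    case 0
    show ?case
      by (auto simp: \<Lambda>0 monotone_set_def multi_indices_def)
  next
    case (Suc n)
    hence IH: "finite (\<Lambda> n)" "monotone_set M (\<Lambda> n)" "(\<lambda>_. 0) \<in> \<Lambda> n"
      by auto
    have "finite (envelope M (\<Lambda> n) (ks n))"
      using envelope_properties(2)[OF IH(2) ks] finite_Marg[OF IH(1)] by (rule finite_subset)
    thus ?case
      using IH envelope_properties(3)[OF IH(2) ks] by (simp add: step)
  qed
  \<comment> \<open>A marked index enters the next index set and stays there, so it never belongs to
    a later margin.\<close>
  have inj: "inj ks"
  proof (rule linorder_injI)
    fix i j :: nat assume "i < j"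
    have "\<Lambda> n \<subseteq> \<Lambda> (Suc n)" for n
      using step[of n] by blast
    hence "\<Lambda> (Suc i) \<subseteq> \<Lambda> j"
      by (rule lift_Suc_mono_le) (use \<open>i < j\<close> in simp)
    moreover have "ks i \<in> envelope M (\<Lambda> i) (ks i)"
      by (rule envelope_properties(1)[OF inv[of i, THEN conjunct2, THEN conjunct1] ks])
    hence "ks i \<in> \<Lambda> (Suc i)"
      unfolding step[of i] by (rule UnI2)
    moreover have "ks j \<notin> \<Lambda> j"
      using ks[of j] by (rule Marg_notin)
    ultimately show "ks i \<noteq> ks j"
      by (metis subsetD)
  qed
  have small: "\<forall>\<^sub>F n in sequentially. majorant (ks n) \<le> \<delta>" if "0 < \<delta>" for \<delta>
  proof -
    from that obtain F where F: "finite F" "F \<subseteq> multi_indices M"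
      "\<And>G. finite G \<Longrightarrow> G \<subseteq> multi_indices M \<Longrightarrow> G \<inter> F = {} \<Longrightarrow> sum majorant G \<le> \<delta>"
      by (rule majorant_small_tails) blast
    \<comment> \<open>An injective sequence leaves every finite set; outside F the tail bound,
      applied to a singleton, bounds the majorant itself.\<close>
    have "finite (ks -` F)"
      using F(1) inj by (rule finite_vimageI)
    hence "\<forall>\<^sub>F n in sequentially. ks n \<notin> F"
      unfolding cofinite_eq_sequentially[symmetric] eventually_cofinite by (simp add: vimage_def)
    thus ?thesis
    proof eventually_elim
      case (elim n)
      have "ks n \<in> multi_indices M"
        using ks[of n] by (simp add: Marg_def)
      thus ?case
        using F(3)[of "{ks n}"] elim by simp
    qed
  qed
  have eventually_le: "\<forall>\<^sub>F n in sequentially. Bochner_H01_norm p M D (\<lambda>y x. u y x - un n y x) \<le> ennreal \<epsilon>"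
    if \<epsilon>: "0 < \<epsilon>" for \<epsilon> :: real
  proof -
    have "0 < r * \<epsilon> / 2"
      using \<epsilon> r_pos by simp
    then obtain F where F: "finite F" "F \<subseteq> multi_indices M"
      "\<And>G. finite G \<Longrightarrow> G \<subseteq> multi_indices M \<Longrightarrow> G \<inter> F = {} \<Longrightarrow> sum majorant G \<le> r * \<epsilon> / 2"
      by (rule majorant_small_tails) blast
    \<comment> \<open>The bound \<delta> is spent at most \<open>card F\<close> times, for a total
      of at most r \<epsilon> / 2; the added 1 covers an empty F.\<close>
    define \<delta> where "\<delta> = r * \<epsilon> / (2 * (real (card F) + 1))"
    have \<delta>: "0 < \<delta>"
      using \<epsilon> r_pos by (simp add: \<delta>_def add_nonneg_pos)
    have "real (card F) * \<delta> \<le> (real (card F) + 1) * \<delta>"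
      using \<delta> by (intro mult_right_mono) auto
    also have "\<dots> = r * \<epsilon> / 2"
      by (simp add: \<delta>_def field_simps add_eq_0_iff_both_eq_0)
    finally have total: "(real (card F) * \<delta> + r * \<epsilon> / 2) / r \<le> \<epsilon>"
      using r_pos by (simp add: field_simps)
    show ?thesis
      using small[OF \<delta>]
    proof eventually_elim
      case (elim n)
      have "estimator z mm M p D a (\<S> (\<Lambda> n) u) k \<le> ennreal \<delta>" if "k \<in> Marg M (\<Lambda> n)" for k
      proof -
        have "estimator z mm M p D a (un n) k \<le> estimator z mm M p D a (un n) (ks n)"
          by (rule max[OF that])
        also have "\<dots> \<le> ennreal \<delta>"
          unfolding un using inv[of n] elim \<delta> ks p by (intro estimator_le) auto
        finally show ?thesis
          by (simp add: un)
      qed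
      hence "Bochner_H01_norm p M D (\<lambda>y x. u y x - un n y x) \<le> ennreal ((real (card F) * \<delta> + r * \<epsilon> / 2) / r)"
        unfolding un using inv[of n] F \<delta> \<open>0 < r * \<epsilon> / 2\<close> p by (intro error_bound) auto
      also have "\<dots> \<le> ennreal \<epsilon>"
        using total by (rule ennreal_leI)
      finally show ?case .
    qed
  qed
  show ?thesis
  proof (rule order_tendstoI)
    \<comment> \<open>As l may be infinite, a finite positive number below it is chosen
      first.\<close>
    fix l :: ennreal assume "0 < l"
    then obtain t where t: "0 < t" "t < l"
      using dense by blast
    then obtain \<epsilon> where \<epsilon>: "t = ennreal \<epsilon>" "0 \<le> \<epsilon>"
      by (cases t) auto
    hence "0 < \<epsilon>"
      using t by simp
    from eventually_le[OF this] show "\<forall>\<^sub>F n in sequentially. Bochner_H01_norm p M D (\<lambda>y x. u y x - un n y x) < l"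
      by eventually_elim (use \<epsilon> t in auto)
  qed simp
qed

end

theorem theorem9:
  fixes M :: nat
    and D :: "(real^'d) set"
    and f :: "real^'d \<Rightarrow> real"
    and a :: "nat \<Rightarrow> real^'d \<Rightarrow> real"
    and r :: real
    and u :: "(nat \<Rightarrow> real) \<Rightarrow> real^'d \<Rightarrow> real"
    and p :: ennreal
    and z :: "nat \<Rightarrow> real"
    and mm :: "nat \<Rightarrow> nat"
    and c \<theta> :: real
    and un :: "nat \<Rightarrow> (nat \<Rightarrow> real) \<Rightarrow> real^'d \<Rightarrow> real"
  assumes "1 \<le> M"
    and "bounded_Lipschitz_domain D"
    and "f \<in> Lp_on 2 D"
    and "\<And>m. m \<in> {0..M} \<Longrightarrow> a m \<in> Lp_on \<infinity> D"
    and "0 < r"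
    and "AE x in lebesgue_on D. (\<Sum>m=1..M. \<bar>a m x\<bar>) \<le> a 0 x - r"
    and "continuous_H01 M D u"
    and "\<And>y. y \<in> Gam M \<Longrightarrow> weak_solution D (\<lambda>x. affine_coeff M a x y) f (u y)"
    and "1 \<le> p"
    and "inj z"
    and "range z \<subseteq> {-1..1}"
    and "strict_mono mm"
    and "mm 0 = 0"
    and "0 \<le> c"
    and "0 \<le> \<theta>"
    and "\<And>k. detail_op_norm z mm k \<le> ereal ((1 + c * real k) powr \<theta>)"
    and "adaptive_collocation z mm M p D a u un"
  shows "(\<lambda>n. Bochner_H01_norm p M D (\<lambda>y x. u y x - un n y x)) \<longlonglongrightarrow> 0"
proof -
  obtain B where B: "0 \<le> B" "AE x in lebesgue_on D. norm (a 0 x) \<le> B"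
    using Lp_on_infty_bound[OF assms(4)[of 0]] by auto
  interpret nested_nodes z mm
    using assms(10,12) by unfold_locales
  \<comment> \<open>Taking the maximum with r gives the required \<open>r \<le> A\<close> at
    once.\<close>
  interpret diffusion z mm M D f a r "max B r" u c \<theta>
  proof
    show "AE x in lebesgue_on D. a 0 x \<le> max B r"
      using B(2) by eventually_elim auto
    show "a m \<in> borel_measurable (lebesgue_on D)" if "m \<le> M" for m
      using assms(4)[of m] that by (simp add: Lp_on_def)
    show "(\<Sum>i\<le>mm k. \<bar>poly (detail_poly k i) t\<bar>) \<le> (1 + c * real k) powr \<theta>" if "t \<in> {-1..1}" for t k
      by (intro lebesgue_constant_le assms that) simp
  qed (use assms in \<open>auto simp: bounded_Lipschitz_domain_def\<close>)
  show ?thesis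
    by (rule adaptive_convergence[OF assms(9,17)])
qed

end
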